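(* Let $X$ be a Grothendieck category in which products are exact (Grothendieck's condition (AB4* )). Let $Y$ be a localizing subcategory of $X$, with quotient category $X/Y$, quotient functor $\pi: X \to X/Y$ and section functor $\omega: X/Y\to X$. (1) If $Z$ is a closed subcategory of $X$ which is $Y$-essentially stable, then $\pi(Z) = \{ \pi(M) \mid M \in Z \}$ is a closed subcategory of $X/Y$. (2) If $\mathcal{Z}$ is a closed subcategory of $X/Y$, then the subcategory $Z$ of $X$ generated by all $Y$-torsionfree $M \in X$ with $\pi(M) \in \mathcal{Z}$ is a $Y$-closed subcategory of $X$. (3) There is a bijective correspondence between $Y$-closed subcategories $Z$ of $X$ and closed subcategories $\mathcal{Z}$ of $X/Y$ given by the inverse operations in (1) and (2).
   Context: A Grothendieck category is an abelian category with arbitrary small direct sums, exact small filtered colimits, and a generator. All subcategories are full. A full subcategory is weakly closed if it is closed under subobjects, quotient objects and small direct sums; localizing if it is weakly closed and closed under extensions; closed if it is weakly closed and closed under small products. The subcategory generated by a collection of objects is the full subcategory of all quotient objects of (small) direct sums of objects in the collection. For $Y$ localizing in $X$, $X/Y$ is the Gabriel quotient category, a Grothendieck category with exact quotient functor $\pi: X\to X/Y$ (the identity on objects), which has a right adjoint $\omega: X/Y\to X$. Each object $M\in X$ has a largest subobject $\tau(M)$ in $Y$; $M$ is $Y$-torsionfree if $\tau(M)=0$. A full subcategory $Z$ of $X$ is $Y$-torsionfree generated if the subcategory generated by the $Y$-torsionfree objects in $Z$ is all of $Z$; it is $Y$-essentially stable if $M\in Z$ implies $\omega\pi(M)\in Z$.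 $Z$ is $Y$-closed if it is closed, $Y$-torsionfree generated and $Y$-essentially stable. The subcategory $\pi(Z)$ is understood up to isomorphism, i.e. as the full subcategory of objects of $X/Y$ isomorphic to $\pi(M)$ for some $M\in Z$. *)

theory Defs
  imports "HOL-Algebra.Group"
begin

unbundle cardinal_syntax

section \<open>Smallness\<close>

text \<open>
  ``Small'' refers to a fixed universe, given by a cardinal \<open>\<kappa>\<close>: a set is small if it has fewer
  than \<open>\<kappa>\<close> elements.  The cardinals admitted are the infinite regular strong limit cardinals, that
  is, the strongly inaccessible ones together with aleph-zero (the universe of finite sets).  As
  every \<open>\<kappa>\<close>-small set is equipotent to a subset of the type \<open>'u\<close> carrying \<open>\<kappa>\<close>, it suffices to
  let small families be indexed by small sets of elements of \<open>'u\<close>.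
\<close>

definition universe :: "'u rel \<Rightarrow> bool" where
  "universe \<kappa> \<longleftrightarrow> Cinfinite \<kappa> \<and> regularCard \<kappa> \<and> (\<forall>A :: 'u set. |A| <o \<kappa> \<longrightarrow> |Pow A| <o \<kappa>)"

definition small :: "'u rel \<Rightarrow> 'a set \<Rightarrow> bool" where
  "small \<kappa> A \<longleftrightarrow> |A| <o \<kappa>"


section \<open>Categories and functors\<close>

record ('o, 'm) cat =
  Obj :: "'o set"
  Arr :: "'m set"
  Dom :: "'m \<Rightarrow> 'o"
  Cod :: "'m \<Rightarrow> 'o"
  Idt :: "'o \<Rightarrow> 'm"
  Cmp :: "'m \<Rightarrow> 'm \<Rightarrow> 'm" (infixl \<open>\<cdot>\<index>\<close> 70)

definition Hom :: "('o, 'm) cat \<Rightarrow> 'o \<Rightarrow> 'o \<Rightarrow> 'm set" where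
  "Hom C a b = {f \<in> Arr C. Dom C f = a \<and> Cod C f = b}"

locale category =
  fixes C :: "('o, 'm) cat" (structure)
  assumes Dom_in: "f \<in> Arr C \<Longrightarrow> Dom C f \<in> Obj C"
    and Cod_in: "f \<in> Arr C \<Longrightarrow> Cod C f \<in> Obj C"
    and Idt_in: "a \<in> Obj C \<Longrightarrow> Idt C a \<in> Hom C a a"
    and Cmp_in: "\<lbrakk>f \<in> Hom C a b; g \<in> Hom C b c\<rbrakk> \<Longrightarrow> g \<cdot> f \<in> Hom C a c"
    and Cmp_Idt: "f \<in> Hom C a b \<Longrightarrow> f \<cdot> Idt C a = f"
    and Idt_Cmp: "f \<in> Hom C a b \<Longrightarrow> Idt C b \<cdot> f = f"
    and Cmp_assoc: "\<lbrakk>f \<in> Hom C a b; g \<in> Hom C b c; h \<in> Hom C c d\<rbrakk> \<Longrightarrow> h \<cdot> (g \<cdot> f) = (h \<cdot> g) \<cdot> f"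

record ('o, 'm, 'p, 'n) ftor =
  omap :: "'o \<Rightarrow> 'p"
  amap :: "'m \<Rightarrow> 'n"

definition is_functor ::
    "('o, 'm) cat \<Rightarrow> ('p, 'n) cat \<Rightarrow> ('o, 'm, 'p, 'n) ftor \<Rightarrow> bool" where
  "is_functor C D F \<longleftrightarrow>
     (\<forall>a \<in> Obj C. omap F a \<in> Obj D) \<and>
     (\<forall>a \<in> Obj C. \<forall>b \<in> Obj C. \<forall>f \<in> Hom C a b. amap F f \<in> Hom D (omap F a) (omap F b)) \<and>
     (\<forall>a \<in> Obj C. amap F (Idt C a) = Idt D (omap F a)) \<and>
     (\<forall>a \<in> Obj C. \<forall>b \<in> Obj C. \<forall>c \<in> Obj C. \<forall>f \<in> Hom C a b. \<forall>g \<in> Hom C b c.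
        amap F (g \<cdot>\<^bsub>C\<^esub> f) = amap F g \<cdot>\<^bsub>D\<^esub> amap F f)"

definition is_nat_trans ::
    "('o, 'm) cat \<Rightarrow> ('p, 'n) cat \<Rightarrow> ('o, 'm, 'p, 'n) ftor \<Rightarrow> ('o, 'm, 'p, 'n) ftor
       \<Rightarrow> ('o \<Rightarrow> 'n) \<Rightarrow> bool" where
  "is_nat_trans C D F G \<alpha> \<longleftrightarrow>
     (\<forall>a \<in> Obj C. \<alpha> a \<in> Hom D (omap F a) (omap G a)) \<and>
     (\<forall>a \<in> Obj C. \<forall>b \<in> Obj C. \<forall>f \<in> Hom C a b.
        amap G f \<cdot>\<^bsub>D\<^esub> \<alpha> a = \<alpha> b \<cdot>\<^bsub>D\<^esub> amap F f)"

text \<open>\<open>G\<close> is right adjoint to \<open>F\<close>.\<close>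

definition right_adjoint ::
    "('o, 'm) cat \<Rightarrow> ('p, 'n) cat \<Rightarrow> ('o, 'm, 'p, 'n) ftor \<Rightarrow> ('p, 'n, 'o, 'm) ftor \<Rightarrow> bool" where
  "right_adjoint C D F G \<longleftrightarrow>
     is_functor C D F \<and> is_functor D C G \<and>
     (\<exists>\<phi>. (\<forall>a \<in> Obj C. \<forall>b \<in> Obj D.
              bij_betw (\<phi> a b) (Hom D (omap F a) b) (Hom C a (omap G b))) \<and>
          (\<forall>a \<in> Obj C. \<forall>a' \<in> Obj C. \<forall>b \<in> Obj D. \<forall>b' \<in> Obj D.
             \<forall>u \<in> Hom C a' a. \<forall>v \<in> Hom D b b'. \<forall>h \<in> Hom D (omap F a) b.
               \<phi> a' b' (v \<cdot>\<^bsub>D\<^esub> (h \<cdot>\<^bsub>D\<^esub> amap F u)) = amap G v \<cdot>\<^bsub>C\<^esub> (\<phi> a b h \<cdot>\<^bsub>C\<^esub> u)))"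

definition is_mono :: "('o, 'm) cat \<Rightarrow> 'm \<Rightarrow> bool" where
  "is_mono C f \<longleftrightarrow> f \<in> Arr C \<and>
     (\<forall>a \<in> Obj C. \<forall>g \<in> Hom C a (Dom C f). \<forall>h \<in> Hom C a (Dom C f).
        f \<cdot>\<^bsub>C\<^esub> g = f \<cdot>\<^bsub>C\<^esub> h \<longrightarrow> g = h)"

definition is_epi :: "('o, 'm) cat \<Rightarrow> 'm \<Rightarrow> bool" where
  "is_epi C f \<longleftrightarrow> f \<in> Arr C \<and>
     (\<forall>b \<in> Obj C. \<forall>g \<in> Hom C (Cod C f) b. \<forall>h \<in> Hom C (Cod C f) b.
        g \<cdot>\<^bsub>C\<^esub> f = h \<cdot>\<^bsub>C\<^esub> f \<longrightarrow> g = h)"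

definition is_iso :: "('o, 'm) cat \<Rightarrow> 'm \<Rightarrow> bool" where
  "is_iso C f \<longleftrightarrow> f \<in> Arr C \<and>
     (\<exists>g \<in> Hom C (Cod C f) (Dom C f).
        g \<cdot>\<^bsub>C\<^esub> f = Idt C (Dom C f) \<and> f \<cdot>\<^bsub>C\<^esub> g = Idt C (Cod C f))"

definition isomorphic :: "('o, 'm) cat \<Rightarrow> 'o \<Rightarrow> 'o \<Rightarrow> bool" where
  "isomorphic C a b \<longleftrightarrow> (\<exists>f \<in> Hom C a b. is_iso C f)"

definition is_product ::
    "('o, 'm) cat \<Rightarrow> 'i set \<Rightarrow> ('i \<Rightarrow> 'o) \<Rightarrow> 'o \<Rightarrow> ('i \<Rightarrow> 'm) \<Rightarrow> bool" where
  "is_product C I A P p \<longleftrightarrow>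
     P \<in> Obj C \<and> (\<forall>i \<in> I. p i \<in> Hom C P (A i)) \<and>
     (\<forall>T \<in> Obj C. \<forall>g. (\<forall>i \<in> I. g i \<in> Hom C T (A i)) \<longrightarrow>
        (\<exists>!h. h \<in> Hom C T P \<and> (\<forall>i \<in> I. p i \<cdot>\<^bsub>C\<^esub> h = g i)))"

definition is_coproduct ::
    "('o, 'm) cat \<Rightarrow> 'i set \<Rightarrow> ('i \<Rightarrow> 'o) \<Rightarrow> 'o \<Rightarrow> ('i \<Rightarrow> 'm) \<Rightarrow> bool" where
  "is_coproduct C I A S s \<longleftrightarrow>
     S \<in> Obj C \<and> (\<forall>i \<in> I. s i \<in> Hom C (A i) S) \<and>
     (\<forall>T \<in> Obj C. \<forall>g. (\<forall>i \<in> I. g i \<in> Hom C (A i) T) \<longrightarrow>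
        (\<exists>!h. h \<in> Hom C S T \<and> (\<forall>i \<in> I. h \<cdot>\<^bsub>C\<^esub> s i = g i)))"

definition is_colimit ::
    "('j, 'k) cat \<Rightarrow> ('o, 'm) cat \<Rightarrow> ('j, 'k, 'o, 'm) ftor \<Rightarrow> 'o \<Rightarrow> ('j \<Rightarrow> 'm) \<Rightarrow> bool" where
  "is_colimit J C F L c \<longleftrightarrow>
     L \<in> Obj C \<and> (\<forall>j \<in> Obj J. c j \<in> Hom C (omap F j) L) \<and>
     (\<forall>i \<in> Obj J. \<forall>j \<in> Obj J. \<forall>u \<in> Hom J i j. c j \<cdot>\<^bsub>C\<^esub> amap F u = c i) \<and>
     (\<forall>T \<in> Obj C. \<forall>g. (\<forall>j \<in> Obj J. g j \<in> Hom C (omap F j) T) \<and>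
        (\<forall>i \<in> Obj J. \<forall>j \<in> Obj J. \<forall>u \<in> Hom J i j. g j \<cdot>\<^bsub>C\<^esub> amap F u = g i) \<longrightarrow>
        (\<exists>!h. h \<in> Hom C L T \<and> (\<forall>j \<in> Obj J. h \<cdot>\<^bsub>C\<^esub> c j = g j)))"

definition filtered :: "('j, 'k) cat \<Rightarrow> bool" where
  "filtered J \<longleftrightarrow> Obj J \<noteq> {} \<and>
     (\<forall>i \<in> Obj J. \<forall>j \<in> Obj J. \<exists>k \<in> Obj J. Hom J i k \<noteq> {} \<and> Hom J j k \<noteq> {}) \<and>
     (\<forall>i \<in> Obj J. \<forall>j \<in> Obj J. \<forall>u \<in> Hom J i j. \<forall>v \<in> Hom J i j.
        \<exists>k \<in> Obj J. \<exists>w \<in> Hom J j k. w \<cdot>\<^bsub>J\<^esub> u = w \<cdot>\<^bsub>J\<^esub> v)"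


section \<open>Abelian and Grothendieck categories\<close>

definition zero_object :: "('o, 'm) cat \<Rightarrow> 'o \<Rightarrow> bool" where
  "zero_object C z \<longleftrightarrow> z \<in> Obj C \<and>
     (\<forall>a \<in> Obj C. (\<exists>!f. f \<in> Hom C a z) \<and> (\<exists>!f. f \<in> Hom C z a))"

definition zero_mor :: "('o, 'm) cat \<Rightarrow> 'm \<Rightarrow> bool" where
  "zero_mor C f \<longleftrightarrow> f \<in> Arr C \<and>
     (\<exists>z u v. zero_object C z \<and> u \<in> Hom C (Dom C f) z \<and> v \<in> Hom C z (Cod C f) \<and> f = v \<cdot>\<^bsub>C\<^esub> u)"

definition is_kernel :: "('o, 'm) cat \<Rightarrow> 'm \<Rightarrow> 'm \<Rightarrow> bool" where
  "is_kernel C f k \<longleftrightarrow>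
     f \<in> Arr C \<and> k \<in> Arr C \<and> Cod C k = Dom C f \<and> zero_mor C (f \<cdot>\<^bsub>C\<^esub> k) \<and>
     (\<forall>g \<in> Arr C. Cod C g = Dom C f \<and> zero_mor C (f \<cdot>\<^bsub>C\<^esub> g) \<longrightarrow>
        (\<exists>!h. h \<in> Hom C (Dom C g) (Dom C k) \<and> k \<cdot>\<^bsub>C\<^esub> h = g))"

definition is_cokernel :: "('o, 'm) cat \<Rightarrow> 'm \<Rightarrow> 'm \<Rightarrow> bool" where
  "is_cokernel C f q \<longleftrightarrow>
     f \<in> Arr C \<and> q \<in> Arr C \<and> Dom C q = Cod C f \<and> zero_mor C (q \<cdot>\<^bsub>C\<^esub> f) \<and>
     (\<forall>g \<in> Arr C. Dom C g = Cod C f \<and> zero_mor C (g \<cdot>\<^bsub>C\<^esub> f) \<longrightarrow>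
        (\<exists>!h. h \<in> Hom C (Cod C q) (Cod C g) \<and> h \<cdot>\<^bsub>C\<^esub> q = g))"

definition short_exact :: "('o, 'm) cat \<Rightarrow> 'm \<Rightarrow> 'm \<Rightarrow> bool" where
  "short_exact C f g \<longleftrightarrow> is_kernel C g f \<and> is_cokernel C f g"

definition preadditive ::
    "('o, 'm) cat \<Rightarrow> ('m \<Rightarrow> 'm \<Rightarrow> 'm) \<Rightarrow> ('o \<Rightarrow> 'o \<Rightarrow> 'm) \<Rightarrow> bool" where
  "preadditive C padd pzero \<longleftrightarrow> category C \<and>
     (\<forall>a \<in> Obj C. \<forall>b \<in> Obj C.
        comm_group \<lparr>carrier = Hom C a b, mult = padd, one = pzero a b\<rparr>) \<and>
     (\<forall>a \<in> Obj C. \<forall>b \<in> Obj C. \<forall>c \<in> Obj C.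
        \<forall>f \<in> Hom C a b. \<forall>f' \<in> Hom C a b. \<forall>g \<in> Hom C b c. \<forall>g' \<in> Hom C b c.
          g \<cdot>\<^bsub>C\<^esub> padd f f' = padd (g \<cdot>\<^bsub>C\<^esub> f) (g \<cdot>\<^bsub>C\<^esub> f') \<and>
          padd g g' \<cdot>\<^bsub>C\<^esub> f = padd (g \<cdot>\<^bsub>C\<^esub> f) (g' \<cdot>\<^bsub>C\<^esub> f))"

text \<open>The addition of an abelian category is determined by the underlying category, so it is not
  kept as a separate piece of data.\<close>

definition abelian :: "('o, 'm) cat \<Rightarrow> bool" where
  "abelian C \<longleftrightarrow> (\<exists>padd pzero. preadditive C padd pzero) \<and>
     (\<exists>z. zero_object C z) \<and>
     (\<forall>a \<in> Obj C. \<forall>b \<in> Obj C. \<exists>P p. is_product C (UNIV :: bool set) (\<lambda>i. if i then a else b) P p) \<and>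
     (\<forall>f \<in> Arr C. \<exists>k. is_kernel C f k) \<and>
     (\<forall>f \<in> Arr C. \<exists>q. is_cokernel C f q) \<and>
     (\<forall>f. is_mono C f \<longrightarrow> (\<exists>g. is_kernel C g f)) \<and>
     (\<forall>f. is_epi C f \<longrightarrow> (\<exists>g. is_cokernel C g f))"

definition has_small_coproducts :: "'u rel \<Rightarrow> ('o, 'm) cat \<Rightarrow> bool" where
  "has_small_coproducts \<kappa> C \<longleftrightarrow>
     (\<forall>(I :: 'u set) A. small \<kappa> I \<and> A ` I \<subseteq> Obj C \<longrightarrow> (\<exists>S s. is_coproduct C I A S s))"

text \<open>Small filtered colimits exist, and the passage from diagrams to their colimits takes
  (pointwise) short exact sequences to short exact sequences.\<close>

definition exact_filtered_colimits :: "'u rel \<Rightarrow> ('o, 'm) cat \<Rightarrow> bool" where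
  "exact_filtered_colimits \<kappa> C \<longleftrightarrow>
     (\<forall>J :: ('u, 'u) cat. category J \<and> filtered J \<and> small \<kappa> (Obj J) \<and> small \<kappa> (Arr J) \<longrightarrow>
        (\<forall>F. is_functor J C F \<longrightarrow> (\<exists>L c. is_colimit J C F L c)) \<and>
        (\<forall>F G H \<alpha> \<beta> K k L l M m f g.
           is_functor J C F \<and> is_functor J C G \<and> is_functor J C H \<and>
           is_nat_trans J C F G \<alpha> \<and> is_nat_trans J C G H \<beta> \<and>
           (\<forall>j \<in> Obj J. short_exact C (\<alpha> j) (\<beta> j)) \<and>
           is_colimit J C F K k \<and> is_colimit J C G L l \<and> is_colimit J C H M m \<and>
           f \<in> Hom C K L \<and> (\<forall>j \<in> Obj J. f \<cdot>\<^bsub>C\<^esub> k j = l j \<cdot>\<^bsub>C\<^esub> \<alpha> j) \<and>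
           g \<in> Hom C L M \<and> (\<forall>j \<in> Obj J. g \<cdot>\<^bsub>C\<^esub> l j = m j \<cdot>\<^bsub>C\<^esub> \<beta> j)
           \<longrightarrow> short_exact C f g))"

text \<open>Condition (AB4*): small products exist and are exact.\<close>

definition exact_products :: "'u rel \<Rightarrow> ('o, 'm) cat \<Rightarrow> bool" where
  "exact_products \<kappa> C \<longleftrightarrow>
     (\<forall>(I :: 'u set) A. small \<kappa> I \<and> A ` I \<subseteq> Obj C \<longrightarrow> (\<exists>P p. is_product C I A P p)) \<and>
     (\<forall>(I :: 'u set) A B D \<alpha> \<beta> P p Q q R r f g.
        small \<kappa> I \<and>
        (\<forall>i \<in> I. \<alpha> i \<in> Hom C (A i) (B i) \<and> \<beta> i \<in> Hom C (B i) (D i) \<and>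
                short_exact C (\<alpha> i) (\<beta> i)) \<and>
        is_product C I A P p \<and> is_product C I B Q q \<and> is_product C I D R r \<and>
        f \<in> Hom C P Q \<and> (\<forall>i \<in> I. q i \<cdot>\<^bsub>C\<^esub> f = \<alpha> i \<cdot>\<^bsub>C\<^esub> p i) \<and>
        g \<in> Hom C Q R \<and> (\<forall>i \<in> I. r i \<cdot>\<^bsub>C\<^esub> g = \<beta> i \<cdot>\<^bsub>C\<^esub> q i)
        \<longrightarrow> short_exact C f g)"

definition is_generator :: "('o, 'm) cat \<Rightarrow> 'o \<Rightarrow> bool" where
  "is_generator C G \<longleftrightarrow> G \<in> Obj C \<and>
     (\<forall>a \<in> Obj C. \<forall>b \<in> Obj C. \<forall>f \<in> Hom C a b. \<forall>g \<in> Hom C a b.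
        f \<noteq> g \<longrightarrow> (\<exists>u \<in> Hom C G a. f \<cdot>\<^bsub>C\<^esub> u \<noteq> g \<cdot>\<^bsub>C\<^esub> u))"

definition grothendieck :: "'u rel \<Rightarrow> ('o, 'm) cat \<Rightarrow> bool" where
  "grothendieck \<kappa> C \<longleftrightarrow> abelian C \<and>
     (\<forall>a \<in> Obj C. \<forall>b \<in> Obj C. small \<kappa> (Hom C a b)) \<and>
     has_small_coproducts \<kappa> C \<and> exact_filtered_colimits \<kappa> C \<and> (\<exists>G. is_generator C G)"


section \<open>Full subcategories\<close>

text \<open>A full subcategory is given by its set of objects.\<close>

definition weakly_closed :: "'u rel \<Rightarrow> ('o, 'm) cat \<Rightarrow> 'o set \<Rightarrow> bool" where
  "weakly_closed \<kappa> C Z \<longleftrightarrow> Z \<subseteq> Obj C \<and>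
     (\<forall>f. is_mono C f \<and> Cod C f \<in> Z \<longrightarrow> Dom C f \<in> Z) \<and>
     (\<forall>f. is_epi C f \<and> Dom C f \<in> Z \<longrightarrow> Cod C f \<in> Z) \<and>
     (\<forall>(I :: 'u set) A S s. small \<kappa> I \<and> A ` I \<subseteq> Z \<and> is_coproduct C I A S s \<longrightarrow> S \<in> Z)"

definition localizing :: "'u rel \<Rightarrow> ('o, 'm) cat \<Rightarrow> 'o set \<Rightarrow> bool" where
  "localizing \<kappa> C Z \<longleftrightarrow> weakly_closed \<kappa> C Z \<and>
     (\<forall>f g. short_exact C f g \<and> Dom C f \<in> Z \<and> Cod C g \<in> Z \<longrightarrow> Cod C f \<in> Z)"

definition closed_subcat :: "'u rel \<Rightarrow> ('o, 'm) cat \<Rightarrow> 'o set \<Rightarrow> bool" where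
  "closed_subcat \<kappa> C Z \<longleftrightarrow> weakly_closed \<kappa> C Z \<and>
     (\<forall>(I :: 'u set) A P p. small \<kappa> I \<and> A ` I \<subseteq> Z \<and> is_product C I A P p \<longrightarrow> P \<in> Z)"

definition generated :: "'u rel \<Rightarrow> ('o, 'm) cat \<Rightarrow> 'o set \<Rightarrow> 'o set" where
  "generated \<kappa> C E =
     {N. \<exists>(I :: 'u set) A S s e. small \<kappa> I \<and> A ` I \<subseteq> E \<and> is_coproduct C I A S s \<and>
           e \<in> Hom C S N \<and> is_epi C e}"

text \<open>\<open>t\<close> is the inclusion of \<open>\<tau>(M)\<close>, the largest subobject of \<open>M\<close> lying in \<open>Y\<close>.\<close>

definition torsion_part :: "('o, 'm) cat \<Rightarrow> 'o set \<Rightarrow> 'o \<Rightarrow> 'm \<Rightarrow> bool" where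
  "torsion_part C Y M t \<longleftrightarrow>
     is_mono C t \<and> Cod C t = M \<and> Dom C t \<in> Y \<and>
     (\<forall>s. is_mono C s \<and> Cod C s = M \<and> Dom C s \<in> Y \<longrightarrow>
        (\<exists>h \<in> Hom C (Dom C s) (Dom C t). t \<cdot>\<^bsub>C\<^esub> h = s))"

definition torsionfree :: "('o, 'm) cat \<Rightarrow> 'o set \<Rightarrow> 'o \<Rightarrow> bool" where
  "torsionfree C Y M \<longleftrightarrow> M \<in> Obj C \<and> (\<exists>t. torsion_part C Y M t \<and> zero_object C (Dom C t))"

definition torsionfree_generated :: "'u rel \<Rightarrow> ('o, 'm) cat \<Rightarrow> 'o set \<Rightarrow> 'o set \<Rightarrow> bool" where
  "torsionfree_generated \<kappa> C Y Z \<longleftrightarrow> generated \<kappa> C {M \<in> Z. torsionfree C Y M} = Z"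


section \<open>The Gabriel quotient\<close>

definition dense_mono :: "('o, 'm) cat \<Rightarrow> 'o set \<Rightarrow> 'm \<Rightarrow> bool" where
  "dense_mono C Y i \<longleftrightarrow> is_mono C i \<and> (\<exists>q. is_cokernel C i q \<and> Cod C q \<in> Y)"

definition torsion_epi :: "('o, 'm) cat \<Rightarrow> 'o set \<Rightarrow> 'm \<Rightarrow> bool" where
  "torsion_epi C Y p \<longleftrightarrow> is_epi C p \<and> (\<exists>k. is_kernel C p k \<and> Dom C k \<in> Y)"

text \<open>
  By Gabriel's definition, \<open>X/Y\<close> has the objects of \<open>X\<close>, and its morphisms \<open>M \<rightarrow> N\<close> are the
  elements of the filtered colimit of the sets \<open>Hom(M', N/N')\<close>, where \<open>M'\<close> runs over the subobjects
  of \<open>M\<close> with \<open>M/M'\<close> in \<open>Y\<close>, and \<open>N'\<close> over the subobjects of \<open>N\<close> lying in \<open>Y\<close>.  Below, \<open>i\<close> is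
  the inclusion of \<open>M'\<close> in \<open>M\<close> and \<open>p\<close> the projection of \<open>N\<close> onto \<open>N/N'\<close>; a triple
  \<open>(i, p, f)\<close> with \<open>f : M' \<rightarrow> N/N'\<close> is a member of one of the sets of this directed system.
\<close>

definition gabriel_triples ::
    "('o, 'm) cat \<Rightarrow> 'o set \<Rightarrow> 'o \<Rightarrow> 'o \<Rightarrow> ('m \<times> 'm \<times> 'm) set" where
  "gabriel_triples C Y M N =
     {(i, p, f). dense_mono C Y i \<and> Cod C i = M \<and> torsion_epi C Y p \<and> Dom C p = N \<and>
        f \<in> Hom C (Dom C i) (Cod C p)}"

text \<open>Two triples are identified in the colimit iff they agree after passing to a smaller \<open>M'\<close>
  (the domain of \<open>i \<cdot> a = i' \<cdot> a'\<close>) and a larger \<open>N'\<close> (the kernel of \<open>b \<cdot> p = b' \<cdot> p'\<close>).\<close>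

definition gabriel_equiv ::
    "('o, 'm) cat \<Rightarrow> 'o set \<Rightarrow> 'm \<times> 'm \<times> 'm \<Rightarrow> 'm \<times> 'm \<times> 'm \<Rightarrow> bool" where
  "gabriel_equiv C Y = (\<lambda>(i, p, f) (i', p', f').
     \<exists>M'' N''. \<exists>a \<in> Hom C M'' (Dom C i). \<exists>a' \<in> Hom C M'' (Dom C i').
       \<exists>b \<in> Hom C (Cod C p) N''. \<exists>b' \<in> Hom C (Cod C p') N''.
         i \<cdot>\<^bsub>C\<^esub> a = i' \<cdot>\<^bsub>C\<^esub> a' \<and> dense_mono C Y (i \<cdot>\<^bsub>C\<^esub> a) \<and>
         b \<cdot>\<^bsub>C\<^esub> p = b' \<cdot>\<^bsub>C\<^esub> p' \<and> torsion_epi C Y (b \<cdot>\<^bsub>C\<^esub> p) \<and>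
         b \<cdot>\<^bsub>C\<^esub> (f \<cdot>\<^bsub>C\<^esub> a) = b' \<cdot>\<^bsub>C\<^esub> (f' \<cdot>\<^bsub>C\<^esub> a'))"

text \<open>
  The category \<open>Q\<close> with the functor \<open>\<pi>\<close> is (a copy of) \<open>X/Y\<close> with its quotient functor: \<open>\<pi>\<close> is the
  identity on objects, and every \<open>Hom Q M N\<close> is the above colimit, the class of \<open>(i, p, f)\<close> being
  the morphism \<open>(\<pi> p)\<^sup>-\<^sup>1 \<cdot> \<pi> f \<cdot> (\<pi> i)\<^sup>-\<^sup>1\<close>, i.e. the only \<open>h\<close> with \<open>\<pi> p \<cdot> h \<cdot> \<pi> i = \<pi> f\<close>.  As the
  identification of \<open>Hom Q M N\<close> with the colimit is expressed by means of \<open>\<pi>\<close>, functoriality of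
  \<open>\<pi>\<close> forces the composition of \<open>Q\<close> to be Gabriel's.
\<close>

definition represents ::
    "('o, 'n) cat \<Rightarrow> ('o, 'm, 'o, 'n) ftor \<Rightarrow> 'm \<times> 'm \<times> 'm \<Rightarrow> 'n \<Rightarrow> bool" where
  "represents Q \<pi> = (\<lambda>(i, p, f) h. amap \<pi> p \<cdot>\<^bsub>Q\<^esub> (h \<cdot>\<^bsub>Q\<^esub> amap \<pi> i) = amap \<pi> f)"

definition gabriel_quotient ::
    "('o, 'm) cat \<Rightarrow> 'o set \<Rightarrow> ('o, 'n) cat \<Rightarrow> ('o, 'm, 'o, 'n) ftor \<Rightarrow> bool" where
  "gabriel_quotient X Y Q \<pi> \<longleftrightarrow>
     category Q \<and> is_functor X Q \<pi> \<and>
     Obj Q = Obj X \<and> (\<forall>M \<in> Obj X. omap \<pi> M = M) \<and>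
     (\<forall>i. dense_mono X Y i \<longrightarrow> is_iso Q (amap \<pi> i)) \<and>
     (\<forall>p. torsion_epi X Y p \<longrightarrow> is_iso Q (amap \<pi> p)) \<and>
     (\<forall>M \<in> Obj X. \<forall>N \<in> Obj X.
        (\<forall>h \<in> Hom Q M N. \<exists>t \<in> gabriel_triples X Y M N. represents Q \<pi> t h) \<and>
        (\<forall>h \<in> Hom Q M N. \<forall>t \<in> gabriel_triples X Y M N. \<forall>t' \<in> gabriel_triples X Y M N.
           represents Q \<pi> t h \<and> represents Q \<pi> t' h \<longrightarrow> gabriel_equiv X Y t t'))"


section \<open>Passing between subcategories of \<open>X\<close> and of \<open>X/Y\<close>\<close>

definition essentially_stable ::
    "('o, 'm, 'p, 'n) ftor \<Rightarrow> ('p, 'n, 'o, 'm) ftor \<Rightarrow> 'o set \<Rightarrow> bool" where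
  "essentially_stable \<pi> \<omega> Z \<longleftrightarrow> (\<forall>M \<in> Z. omap \<omega> (omap \<pi> M) \<in> Z)"

definition Y_closed ::
    "'u rel \<Rightarrow> ('o, 'm) cat \<Rightarrow> 'o set \<Rightarrow> ('o, 'm, 'p, 'n) ftor \<Rightarrow> ('p, 'n, 'o, 'm) ftor
       \<Rightarrow> 'o set \<Rightarrow> bool" where
  "Y_closed \<kappa> X Y \<pi> \<omega> Z \<longleftrightarrow>
     closed_subcat \<kappa> X Z \<and> torsionfree_generated \<kappa> X Y Z \<and> essentially_stable \<pi> \<omega> Z"

text \<open>The image \<open>\<pi>(Z)\<close>, closed up under isomorphism in the target category.\<close>

definition image_subcat ::
    "('p, 'n) cat \<Rightarrow> ('o, 'm, 'p, 'n) ftor \<Rightarrow> 'o set \<Rightarrow> 'p set" where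
  "image_subcat Q \<pi> Z = {N \<in> Obj Q. \<exists>M \<in> Z. isomorphic Q N (omap \<pi> M)}"

definition lift_subcat ::
    "'u rel \<Rightarrow> ('o, 'm) cat \<Rightarrow> 'o set \<Rightarrow> ('o, 'm, 'p, 'n) ftor \<Rightarrow> 'p set \<Rightarrow> 'o set" where
  "lift_subcat \<kappa> X Y \<pi> W = generated \<kappa> X {M \<in> Obj X. torsionfree X Y M \<and> omap \<pi> M \<in> W}"

end

theory Submission
  imports Defs
begin

text \<open>
  A closed subcategory of \<open>X/Y\<close> is controlled by \<open>\<omega>\<close>: for essentially stable \<open>Z\<close>, an object \<open>N\<close>
  of \<open>X/Y\<close> lies in \<open>\<pi>(Z)\<close> iff \<open>\<omega> N\<close> lies in \<open>Z\<close>.  As \<open>\<omega>\<close> preserves monomorphisms and products,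
  \<open>\<pi>\<close> preserves coproducts and \<open>\<pi>\<omega> \<cong> 1\<close>, the closure properties of \<open>\<pi>(Z)\<close> follow; for a quotient
  of \<open>N\<close> one takes the image of \<open>\<omega> N\<close>.  Conversely, let \<open>E\<close> be the class of torsionfree \<open>M\<close> with
  \<open>\<pi> M\<close> in a closed subcategory of \<open>X/Y\<close>.  It is closed under subobjects, under products, because
  \<open>\<Prod> M\<^sub>i\<close> embeds into \<open>\<Prod> \<omega>\<pi> M\<^sub>i\<close>, which is the product of the \<open>\<pi> M\<^sub>i\<close> in \<open>X/Y\<close>, and under
  coproducts, because \<open>\<Oplus> M\<^sub>i\<close> embeds into \<open>\<Prod> M\<^sub>i\<close> by exactness of filtered colimits and so is
  torsionfree.  Hence the subcategory generated by \<open>E\<close> consists of the quotients of single objects of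
  \<open>E\<close>, and it is closed under products since products of epimorphisms are epimorphisms.
\<close>

section \<open>Morphisms, products and zero morphisms\<close>

text \<open>\<open>Q\<close> is known only as a category whose hom-sets are classes of Gabriel
  triples. That it is abelian, or that \<pi> is exact, is never established; kernels and cokernels
  are formed in X alone. Two halves of the description of the hom-sets carry the argument. Every
  morphism comes from a triple: as \<omega> b is torsionfree and morphisms into it extend along
  dense subobjects, \<pi> is full on morphisms into \<omega> b, and this makes the counit
  invertible. Equal morphisms come from equivalent triples: so the source of a monomorphism, or the
  target of an epimorphism, that becomes zero under \<pi> lies in Y. This replaces exactness: it
  shows that the unit is mono on torsionfree objects, that \<pi> preserves monomorphisms into
  torsionfree objects, and that the image of \<omega> f is dense in its target when f is epi.
  Preservation of epimorphisms and coproducts by \<pi>, and of monomorphisms and products by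
  \<omega>, is formal. Products under \<pi> are the obstacle: \<pi> does not preserve them in
  general, so they are first formed of objects \<omega> A, where it does.\<close>

lemma ex1_unique: "\<exists>!x. P x \<Longrightarrow> P a \<Longrightarrow> P b \<Longrightarrow> a = b"
  by blast

context category
begin

lemma HomI: "f \<in> Arr C \<Longrightarrow> f \<in> Hom C (Dom C f) (Cod C f)"
  by (simp add: Hom_def)

lemma Hom_ArrD: "f \<in> Hom C a b \<Longrightarrow> f \<in> Arr C"
  and Hom_DomD: "f \<in> Hom C a b \<Longrightarrow> Dom C f = a"
  and Hom_CodD: "f \<in> Hom C a b \<Longrightarrow> Cod C f = b"
  by (auto simp: Hom_def)

lemmas HomD = Hom_ArrD Hom_DomD Hom_CodD

lemma Hom_Obj: "f \<in> Hom C a b \<Longrightarrow> a \<in> Obj C" "f \<in> Hom C a b \<Longrightarrow> b \<in> Obj C"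
  using Dom_in Cod_in by (auto simp: Hom_def)

section \<open>Monomorphisms, epimorphisms and isomorphisms\<close>

lemma mono_cancel:
  "\<lbrakk>is_mono C f; f \<in> Hom C b c; g \<in> Hom C a b; h \<in> Hom C a b; f \<cdot> g = f \<cdot> h\<rbrakk> \<Longrightarrow> g = h"
  using Hom_Obj(1)[of g a b] by (auto simp: is_mono_def HomD)

lemma epi_cancel:
  "\<lbrakk>is_epi C f; f \<in> Hom C a b; g \<in> Hom C b c; h \<in> Hom C b c; g \<cdot> f = h \<cdot> f\<rbrakk> \<Longrightarrow> g = h"
  using Hom_Obj(2)[of g b c] by (auto simp: is_epi_def HomD)

lemma monoI:
  assumes "f \<in> Hom C b c"
    and "\<And>a g h. \<lbrakk>g \<in> Hom C a b; h \<in> Hom C a b; f \<cdot> g = f \<cdot> h\<rbrakk> \<Longrightarrow> g = h"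
  shows "is_mono C f"
  using assms by (auto simp: is_mono_def HomD)

lemma epiI:
  assumes "f \<in> Hom C a b"
    and "\<And>c g h. \<lbrakk>g \<in> Hom C b c; h \<in> Hom C b c; g \<cdot> f = h \<cdot> f\<rbrakk> \<Longrightarrow> g = h"
  shows "is_epi C f"
  using assms by (auto simp: is_epi_def HomD)

lemma mono_Cmp:
  assumes "is_mono C f" "f \<in> Hom C a b" "is_mono C g" "g \<in> Hom C b c"
  shows "is_mono C (g \<cdot> f)"
proof (rule monoI)
  show "g \<cdot> f \<in> Hom C a c" using assms Cmp_in by blast
next
  fix d x y assume xy: "x \<in> Hom C d a" "y \<in> Hom C d a" "g \<cdot> f \<cdot> x = g \<cdot> f \<cdot> y"
  then have "g \<cdot> (f \<cdot> x) = g \<cdot> (f \<cdot> y)"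
    using Cmp_assoc[OF _ assms(2,4)] by simp
  then have "f \<cdot> x = f \<cdot> y"
    using mono_cancel[OF assms(3,4)] Cmp_in[OF _ assms(2)] xy by blast
  then show "x = y" using mono_cancel[OF assms(1,2)] xy by blast
qed

lemma epi_Cmp:
  assumes "is_epi C f" "f \<in> Hom C a b" "is_epi C g" "g \<in> Hom C b c"
  shows "is_epi C (g \<cdot> f)"
proof (rule epiI)
  show "g \<cdot> f \<in> Hom C a c" using assms Cmp_in by blast
next
  fix d x y assume xy: "x \<in> Hom C c d" "y \<in> Hom C c d" "x \<cdot> (g \<cdot> f) = y \<cdot> (g \<cdot> f)"
  then have "x \<cdot> g \<cdot> f = y \<cdot> g \<cdot> f"
    using Cmp_assoc[OF assms(2,4)] by simp
  then have "x \<cdot> g = y \<cdot> g"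
    using epi_cancel[OF assms(1,2)] Cmp_in[OF assms(4)] xy by blast
  then show "x = y" using epi_cancel[OF assms(3,4)] xy by blast
qed

lemma mono_factor:
  assumes "is_mono C (g \<cdot> f)" "f \<in> Hom C a b" "g \<in> Hom C b c"
  shows "is_mono C f"
proof (rule monoI[OF assms(2)])
  fix d x y assume xy: "x \<in> Hom C d a" "y \<in> Hom C d a" "f \<cdot> x = f \<cdot> y"
  then have "g \<cdot> f \<cdot> x = g \<cdot> f \<cdot> y" 
    using Cmp_assoc[OF _ assms(2,3)] by metis
  then show "x = y" using mono_cancel[OF assms(1) Cmp_in[OF assms(2,3)]] xy by blast
qed

lemma epi_factor:
  assumes "is_epi C (g \<cdot> f)" "f \<in> Hom C a b" "g \<in> Hom C b c"
  shows "is_epi C g"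
proof (rule epiI[OF assms(3)])
  fix d x y assume xy: "x \<in> Hom C c d" "y \<in> Hom C c d" "x \<cdot> g = y \<cdot> g"
  then have "x \<cdot> (g \<cdot> f) = y \<cdot> (g \<cdot> f)" 
    using Cmp_assoc[OF assms(2,3)] by metis
  then show "x = y" using epi_cancel[OF assms(1) Cmp_in[OF assms(2,3)]] xy by blast
qed

lemma isoI:
  "\<lbrakk>f \<in> Hom C a b; g \<in> Hom C b a; g \<cdot> f = Idt C a; f \<cdot> g = Idt C b\<rbrakk> \<Longrightarrow> is_iso C f"
  by (auto simp: is_iso_def HomD)

lemma isoE:
  assumes "is_iso C f" "f \<in> Hom C a b"
  obtains g where "g \<in> Hom C b a" "g \<cdot> f = Idt C a" "f \<cdot> g = Idt C b"
  using assms by (auto simp: is_iso_def HomD)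

lemma mono_Idt: "a \<in> Obj C \<Longrightarrow> is_mono C (Idt C a)"
  by (rule monoI[OF Idt_in]) (metis Idt_Cmp)+

lemma epi_Idt: "a \<in> Obj C \<Longrightarrow> is_epi C (Idt C a)"
  by (rule epiI[OF Idt_in]) (metis Cmp_Idt)+

lemma split_mono:
  "\<lbrakk>f \<in> Hom C a b; g \<in> Hom C b a; g \<cdot> f = Idt C a\<rbrakk> \<Longrightarrow> is_mono C f"
  using mono_factor[of g f a b a] mono_Idt[of a] Hom_Obj(1)[of f a b] by simp

lemma split_epi:
  "\<lbrakk>f \<in> Hom C a b; g \<in> Hom C b a; f \<cdot> g = Idt C b\<rbrakk> \<Longrightarrow> is_epi C f"
  using epi_factor[of f g b a b] epi_Idt[of b] Hom_Obj(2)[of f a b] by simp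

lemma iso_mono: "is_iso C f \<Longrightarrow> is_mono C f"
  using split_mono[OF HomI] by (auto simp: is_iso_def)

lemma iso_epi: "is_iso C f \<Longrightarrow> is_epi C f"
  using split_epi[OF HomI] by (auto simp: is_iso_def)

text \<open>From f g = 1 follows f (g f) = f, and the monomorphism f can be cancelled on the
  left.\<close>

lemma mono_split_epi_iso:
  assumes "is_mono C f" "f \<in> Hom C a b" "g \<in> Hom C b a" "f \<cdot> g = Idt C b"
  shows "is_iso C f"
proof (rule isoI[OF assms(2,3) _ assms(4)])
  have "f \<cdot> (g \<cdot> f) = f \<cdot> Idt C a"
    using Cmp_assoc[OF assms(2,3,2)] assms(4) Idt_Cmp[OF assms(2)] Cmp_Idt[OF assms(2)] by simp
  then show "g \<cdot> f = Idt C a"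
    using mono_cancel[OF assms(1,2) Cmp_in[OF assms(2,3)]] Idt_in Hom_Obj(1)[OF assms(2)] by blast
qed

lemma iso_Cmp:
  assumes "is_iso C f" "f \<in> Hom C a b" "is_iso C g" "g \<in> Hom C b c"
  shows "is_iso C (g \<cdot> f)"
proof -
  obtain f' where f': "f' \<in> Hom C b a" "f' \<cdot> f = Idt C a" "f \<cdot> f' = Idt C b"
    using assms(1,2) by (rule isoE)
  obtain g' where g': "g' \<in> Hom C c b" "g' \<cdot> g = Idt C b" "g \<cdot> g' = Idt C c"
    using assms(3,4) by (rule isoE)
  have gf: "g \<cdot> f \<in> Hom C a c" using assms Cmp_in by blast
  have "f' \<cdot> g' \<in> Hom C c a" using f' g' Cmp_in by blast
  have "g \<cdot> f \<cdot> (f' \<cdot> g') = g \<cdot> (f \<cdot> (f' \<cdot> g'))"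
    using Cmp_assoc[OF \<open>f' \<cdot> g' \<in> _\<close> assms(2,4)] by simp
  also have "f \<cdot> (f' \<cdot> g') = g'"
    using Cmp_assoc[OF g'(1) f'(1) assms(2)] f'(3) Idt_Cmp[OF g'(1)] by simp
  finally have 1: "g \<cdot> f \<cdot> (f' \<cdot> g') = Idt C c" using g' by simp
  show ?thesis
    by (rule mono_split_epi_iso[OF mono_Cmp gf \<open>f' \<cdot> g' \<in> _\<close> 1]) (use assms iso_mono in blast)+
qed

lemma isomorphic_sym:
  assumes "isomorphic C a b" shows "isomorphic C b a"
proof -
  obtain f where f: "f \<in> Hom C a b" "is_iso C f" using assms by (auto simp: isomorphic_def)
  obtain g where g: "g \<in> Hom C b a" "g \<cdot> f = Idt C a" "f \<cdot> g = Idt C b"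
    using f(2,1) by (rule isoE)
  then show ?thesis using isoI[OF g(1) f(1)] by (auto simp: isomorphic_def)
qed

lemma isomorphic_trans: "isomorphic C a b \<Longrightarrow> isomorphic C b c \<Longrightarrow> isomorphic C a c"
  unfolding isomorphic_def using Cmp_in[of _ a b _ c] iso_Cmp[of _ a b _ c] by blast

section \<open>Universal properties of products and coproducts\<close>

lemma coproduct_ex1:
  assumes "is_coproduct C I A S s" "T \<in> Obj C" "\<And>i. i \<in> I \<Longrightarrow> g i \<in> Hom C (A i) T"
  obtains h where "h \<in> Hom C S T" "\<And>i. i \<in> I \<Longrightarrow> h \<cdot> s i = g i"
  using assms unfolding is_coproduct_def by metis

lemma product_ex1:
  assumes "is_product C I A P p" "T \<in> Obj C" "\<And>i. i \<in> I \<Longrightarrow> g i \<in> Hom C T (A i)"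
  obtains h where "h \<in> Hom C T P" "\<And>i. i \<in> I \<Longrightarrow> p i \<cdot> h = g i"
  using assms unfolding is_product_def by metis

lemma coproduct_in: "is_coproduct C I A S s \<Longrightarrow> i \<in> I \<Longrightarrow> s i \<in> Hom C (A i) S"
  by (simp add: is_coproduct_def)

lemma product_in: "is_product C I A P p \<Longrightarrow> i \<in> I \<Longrightarrow> p i \<in> Hom C P (A i)"
  by (simp add: is_product_def)

lemma coproduct_unique:
  assumes cp: "is_coproduct C I A S s" and g: "g \<in> Hom C S T" and h: "h \<in> Hom C S T"
    and eq: "\<And>i. i \<in> I \<Longrightarrow> g \<cdot> s i = h \<cdot> s i"
  shows "g = h"
proof -
  have "\<forall>i\<in>I. g \<cdot> s i \<in> Hom C (A i) T"
    using cp g Cmp_in unfolding is_coproduct_def by blast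
  then have "\<exists>!k. k \<in> Hom C S T \<and> (\<forall>i\<in>I. k \<cdot> s i = g \<cdot> s i)"
    using cp[unfolded is_coproduct_def, THEN conjunct2, THEN conjunct2,
        rule_format, OF Hom_Obj(2)[OF g], of "\<lambda>i. g \<cdot> s i"] by blast
  then show ?thesis by (rule ex1_unique) (use g h eq in auto)
qed

lemma product_unique:
  assumes cp: "is_product C I A P p" and g: "g \<in> Hom C T P" and h: "h \<in> Hom C T P"
    and eq: "\<And>i. i \<in> I \<Longrightarrow> p i \<cdot> g = p i \<cdot> h"
  shows "g = h"
proof -
  have "\<forall>i\<in>I. p i \<cdot> g \<in> Hom C T (A i)"
    using cp g Cmp_in unfolding is_product_def by blast
  then have "\<exists>!k. k \<in> Hom C T P \<and> (\<forall>i\<in>I. p i \<cdot> k = p i \<cdot> g)"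
    using cp[unfolded is_product_def, THEN conjunct2, THEN conjunct2,
        rule_format, OF Hom_Obj(1)[OF g], of "\<lambda>i. p i \<cdot> g"] by blast
  then show ?thesis by (rule ex1_unique) (use g h eq in auto)
qed

lemma is_coproductI:
  assumes "S \<in> Obj C" "\<And>i. i \<in> I \<Longrightarrow> s i \<in> Hom C (A i) S"
    and "\<And>T g. \<lbrakk>T \<in> Obj C; \<And>i. i \<in> I \<Longrightarrow> g i \<in> Hom C (A i) T\<rbrakk>
           \<Longrightarrow> \<exists>h\<in>Hom C S T. \<forall>i\<in>I. h \<cdot> s i = g i"
    and "\<And>T g h. \<lbrakk>g \<in> Hom C S T; h \<in> Hom C S T; \<And>i. i \<in> I \<Longrightarrow> g \<cdot> s i = h \<cdot> s i\<rbrakk>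
           \<Longrightarrow> g = h"
  shows "is_coproduct C I A S s"
  unfolding is_coproduct_def using assms(1,2)
proof (intro conjI ballI allI impI)
  fix T g assume T: "T \<in> Obj C" and g: "\<forall>i\<in>I. g i \<in> Hom C (A i) T"
  obtain h where h: "h \<in> Hom C S T" "\<forall>i\<in>I. h \<cdot> s i = g i" using assms(3)[OF T] g by blast
  show "\<exists>!h. h \<in> Hom C S T \<and> (\<forall>i\<in>I. h \<cdot> s i = g i)"
  proof (rule ex1I[of _ h])
    fix k assume "k \<in> Hom C S T \<and> (\<forall>i\<in>I. k \<cdot> s i = g i)"
    then show "k = h" using h by (intro assms(4)[of k T h]) auto
  qed (use h in blast)
qed auto

lemma is_productI:
  assumes "P \<in> Obj C" "\<And>i. i \<in> I \<Longrightarrow> p i \<in> Hom C P (A i)"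
    and "\<And>T g. \<lbrakk>T \<in> Obj C; \<And>i. i \<in> I \<Longrightarrow> g i \<in> Hom C T (A i)\<rbrakk>
           \<Longrightarrow> \<exists>h\<in>Hom C T P. \<forall>i\<in>I. p i \<cdot> h = g i"
    and "\<And>T g h. \<lbrakk>g \<in> Hom C T P; h \<in> Hom C T P; \<And>i. i \<in> I \<Longrightarrow> p i \<cdot> g = p i \<cdot> h\<rbrakk>
           \<Longrightarrow> g = h"
  shows "is_product C I A P p"
  unfolding is_product_def using assms(1,2)
proof (intro conjI ballI allI impI)
  fix T g assume T: "T \<in> Obj C" and g: "\<forall>i\<in>I. g i \<in> Hom C T (A i)"
  obtain h where h: "h \<in> Hom C T P" "\<forall>i\<in>I. p i \<cdot> h = g i" using assms(3)[OF T] g by blast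
  show "\<exists>!h. h \<in> Hom C T P \<and> (\<forall>i\<in>I. p i \<cdot> h = g i)"
  proof (rule ex1I[of _ h])
    fix k assume "k \<in> Hom C T P \<and> (\<forall>i\<in>I. p i \<cdot> k = g i)"
    then show "k = h" using h by (intro assms(4)[of k T h]) auto
  qed (use h in blast)
qed auto

lemma coproduct_iso:
  assumes S: "is_coproduct C I A S s" and S': "is_coproduct C I A S' s'"
  shows "isomorphic C S S'"
proof -
  have o: "S \<in> Obj C" "S' \<in> Obj C" using S S' by (auto simp: is_coproduct_def)
  obtain f where f: "f \<in> Hom C S S'" "\<And>i. i \<in> I \<Longrightarrow> f \<cdot> s i = s' i"
    by (rule coproduct_ex1[OF S o(2), of s']) (use coproduct_in[OF S'] in auto)
  obtain g where g: "g \<in> Hom C S' S" "\<And>i. i \<in> I \<Longrightarrow> g \<cdot> s' i = s i"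
    by (rule coproduct_ex1[OF S' o(1), of s]) (use coproduct_in[OF S] in auto)
  have "g \<cdot> f = Idt C S"
  proof (rule coproduct_unique[OF S])
    fix i assume i: "i \<in> I"
    show "g \<cdot> f \<cdot> s i = Idt C S \<cdot> s i"
      using Cmp_assoc[OF coproduct_in[OF S i] f(1) g(1)] f(2)[OF i] g(2)[OF i]
        Idt_Cmp[OF coproduct_in[OF S i]] by simp
  qed (use f g o Cmp_in Idt_in in blast)+
  moreover have "f \<cdot> g = Idt C S'"
  proof (rule coproduct_unique[OF S'])
    fix i assume i: "i \<in> I"
    show "f \<cdot> g \<cdot> s' i = Idt C S' \<cdot> s' i"
      using Cmp_assoc[OF coproduct_in[OF S' i] g(1) f(1)] f(2)[OF i] g(2)[OF i]
        Idt_Cmp[OF coproduct_in[OF S' i]] by simp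
  qed (use f g o Cmp_in Idt_in in blast)+
  ultimately show ?thesis using isoI[OF f(1) g(1)] f(1) by (auto simp: isomorphic_def)
qed

text \<open>Lets a coproduct of objects A i in X/Y be read as one of the objects \<omega> (A i),
  with the counits as e i; those also have a coproduct coming from X.\<close>

lemma coproduct_change_iso:
  assumes S: "is_coproduct C I A S s"
    and e: "\<And>i. i \<in> I \<Longrightarrow> e i \<in> Hom C (B i) (A i) \<and> is_iso C (e i)"
  shows "is_coproduct C I B S (\<lambda>i. s i \<cdot> e i)"
proof (rule is_coproductI)
  show "S \<in> Obj C" using S by (simp add: is_coproduct_def)
  show "s i \<cdot> e i \<in> Hom C (B i) S" if "i \<in> I" for i
    using coproduct_in[OF S that] e[OF that] Cmp_in by blast
next
  fix T g assume T: "T \<in> Obj C" and g: "\<And>i. i \<in> I \<Longrightarrow> g i \<in> Hom C (B i) T"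
  have "\<exists>e'. \<forall>i\<in>I. e' i \<in> Hom C (A i) (B i) \<and> e' i \<cdot> e i = Idt C (B i)"
    by (rule bchoice) (use e isoE in blast)
  then obtain e' where e': "\<And>i. i \<in> I \<Longrightarrow> e' i \<in> Hom C (A i) (B i)"
      "\<And>i. i \<in> I \<Longrightarrow> e' i \<cdot> e i = Idt C (B i)" by blast
  obtain h where h: "h \<in> Hom C S T" "\<And>i. i \<in> I \<Longrightarrow> h \<cdot> s i = g i \<cdot> e' i"
    by (rule coproduct_ex1[OF S T, of "\<lambda>i. g i \<cdot> e' i"]) (use g e' Cmp_in in blast)+
  have "h \<cdot> (s i \<cdot> e i) = g i" if i: "i \<in> I" for i
    using Cmp_assoc[OF conjunct1[OF e[OF i]] coproduct_in[OF S i] h(1)] h(2)[OF i]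
      Cmp_assoc[OF conjunct1[OF e[OF i]] e'(1)[OF i] g[OF i]] e'(2)[OF i] Cmp_Idt[OF g[OF i]]
    by simp
  then show "\<exists>h\<in>Hom C S T. \<forall>i\<in>I. h \<cdot> (s i \<cdot> e i) = g i" using h(1) by blast
next
  fix T g h assume g: "g \<in> Hom C S T" and h: "h \<in> Hom C S T"
    and eq: "\<And>i. i \<in> I \<Longrightarrow> g \<cdot> (s i \<cdot> e i) = h \<cdot> (s i \<cdot> e i)"
  show "g = h"
  proof (rule coproduct_unique[OF S g h])
    fix i assume i: "i \<in> I"
    note s = coproduct_in[OF S i] and ei = conjunct1[OF e[OF i]]
    have "g \<cdot> s i \<cdot> e i = h \<cdot> s i \<cdot> e i"
      using Cmp_assoc[OF ei s g] Cmp_assoc[OF ei s h] eq[OF i] by simp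
    then show "g \<cdot> s i = h \<cdot> s i"
      using epi_cancel[OF iso_epi ei] e[OF i] Cmp_in[OF s g] Cmp_in[OF s h] by blast
  qed
qed

text \<open>Only the universal property enters: morphisms that agree after composition with h agree
  on each summand after the epimorphism e i. The counterpart for products is not formal; see
  \<open>product_map_epi\<close>.\<close>

lemma coproduct_map_epi:
  assumes S: "is_coproduct C I A S s" and T: "is_coproduct C I B T t"
    and e: "\<And>i. i \<in> I \<Longrightarrow> e i \<in> Hom C (A i) (B i) \<and> is_epi C (e i)"
  obtains h where "h \<in> Hom C S T" "is_epi C h"
proof -
  have "T \<in> Obj C" using T by (simp add: is_coproduct_def)
  then obtain h where h: "h \<in> Hom C S T" "\<And>i. i \<in> I \<Longrightarrow> h \<cdot> s i = t i \<cdot> e i"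
    by (rule coproduct_ex1[OF S, of _ "\<lambda>i. t i \<cdot> e i"])
      (use e coproduct_in[OF T] Cmp_in in blast)+
  have "is_epi C h"
  proof (rule epiI[OF h(1)])
    fix U x y assume x: "x \<in> Hom C T U" and y: "y \<in> Hom C T U" and xy: "x \<cdot> h = y \<cdot> h"
    show "x = y"
    proof (rule coproduct_unique[OF T x y])
      fix i assume i: "i \<in> I"
      note s = coproduct_in[OF S i] and t = coproduct_in[OF T i] and ei = conjunct1[OF e[OF i]]
      have "x \<cdot> t i \<cdot> e i = y \<cdot> t i \<cdot> e i"
        using Cmp_assoc[OF ei t x] Cmp_assoc[OF ei t y] Cmp_assoc[OF s h(1) x]
          Cmp_assoc[OF s h(1) y] h(2)[OF i] xy by simp
      then show "x \<cdot> t i = y \<cdot> t i"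
        using epi_cancel[OF _ ei] e[OF i] Cmp_in[OF t x] Cmp_in[OF t y] by blast
    qed
  qed
  with h(1) show ?thesis by (rule that)
qed

section \<open>Zero objects and zero morphisms\<close>

lemma zero_object_Obj: "zero_object C z \<Longrightarrow> z \<in> Obj C"
  by (simp add: zero_object_def)

lemma zero_objectD:
  assumes "zero_object C z" "a \<in> Obj C"
  shows "\<exists>f. f \<in> Hom C a z" "\<exists>f. f \<in> Hom C z a"
    and "\<And>f g. \<lbrakk>f \<in> Hom C a z; g \<in> Hom C a z\<rbrakk> \<Longrightarrow> f = g"
    and "\<And>f g. \<lbrakk>f \<in> Hom C z a; g \<in> Hom C z a\<rbrakk> \<Longrightarrow> f = g"
  using assms unfolding zero_object_def by blast+

lemma zero_morE:
  assumes "zero_mor C f" "f \<in> Hom C a b"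
  obtains z u v where "zero_object C z" "u \<in> Hom C a z" "v \<in> Hom C z b" "f = v \<cdot> u"
  using assms by (auto simp: zero_mor_def HomD)

lemma zero_morI:
  assumes "zero_object C z" "u \<in> Hom C a z" "v \<in> Hom C z b"
  shows "zero_mor C (v \<cdot> u)"
  using assms Cmp_in[OF assms(2,3)] unfolding zero_mor_def by (auto simp: HomD)

text \<open>Each zero morphism may factor through a zero object of its own; the two factorizations
  are compared through a morphism w between these zero objects.\<close>

lemma zero_mor_unique:
  assumes "zero_mor C f" "f \<in> Hom C a b" "zero_mor C g" "g \<in> Hom C a b"
  shows "f = g"
proof -
  obtain z u v where 1: "zero_object C z" "u \<in> Hom C a z" "v \<in> Hom C z b" "f = v \<cdot> u"
    using assms(1,2) by (rule zero_morE)
  obtain z' u' v' where 2: "zero_object C z'" "u' \<in> Hom C a z'" "v' \<in> Hom C z' b" "g = v' \<cdot> u'"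
    using assms(3,4) by (rule zero_morE)
  obtain w where w: "w \<in> Hom C z z'"
    using zero_objectD(1)[OF 2(1)] zero_object_Obj 1(1) by blast
  have "w \<cdot> u = u'"
    using zero_objectD(3)[OF 2(1) _ Cmp_in[OF 1(2) w] 2(2)] Hom_Obj 1(2) by blast
  moreover have "v' \<cdot> w = v"
    using zero_objectD(4)[OF 1(1) _ Cmp_in[OF w 2(3)] 1(3)] Hom_Obj 1(3) by blast
  ultimately show ?thesis using 1 2 Cmp_assoc[OF 1(2) w 2(3)] by simp
qed

lemma zero_Cmp_right:
  assumes "zero_mor C f" "f \<in> Hom C a b" "g \<in> Hom C b c"
  shows "zero_mor C (g \<cdot> f)"
proof -
  obtain z u v where 1: "zero_object C z" "u \<in> Hom C a z" "v \<in> Hom C z b" "f = v \<cdot> u"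
    using assms(1,2) by (rule zero_morE)
  then have "g \<cdot> f = (g \<cdot> v) \<cdot> u" using Cmp_assoc assms(3) by blast
  then show ?thesis using zero_morI[OF 1(1,2) Cmp_in[OF 1(3) assms(3)]] by simp
qed

lemma zero_Cmp_left:
  assumes "zero_mor C g" "f \<in> Hom C a b" "g \<in> Hom C b c"
  shows "zero_mor C (g \<cdot> f)"
proof -
  obtain z u v where 1: "zero_object C z" "u \<in> Hom C b z" "v \<in> Hom C z c" "g = v \<cdot> u"
    using assms(1,3) by (rule zero_morE)
  then have "g \<cdot> f = v \<cdot> (u \<cdot> f)" using Cmp_assoc[OF assms(2)] by metis
  then show ?thesis using zero_morI[OF 1(1) Cmp_in[OF assms(2) 1(2)] 1(3)] by simp
qed

lemma zero_mor_to_zero: "zero_object C z \<Longrightarrow> f \<in> Hom C a z \<Longrightarrow> zero_mor C f"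
  using zero_morI[of z f a "Idt C z" z] Idt_in[of z] Idt_Cmp[of f a z] by (simp add: zero_object_Obj)

lemma zero_mor_from_zero: "zero_object C z \<Longrightarrow> f \<in> Hom C z a \<Longrightarrow> zero_mor C f"
  using zero_morI[of z "Idt C z" z f a] Idt_in[of z] Cmp_Idt[of f z a] by (simp add: zero_object_Obj)

text \<open>Every morphism to or from a is a composite with the identity, hence zero, and parallel
  zero morphisms coincide.\<close>

lemma zero_object_if_zero_Idt:
  assumes "a \<in> Obj C" "zero_mor C (Idt C a)"
  shows "zero_object C a"
proof -
  have ia: "Idt C a \<in> Hom C a a" by (rule Idt_in) fact
  obtain z u v where z: "zero_object C z" and uv: "u \<in> Hom C a z" "v \<in> Hom C z a"
    using zero_morE[OF assms(2) ia] by blast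
  have "f = g" if "f \<in> Hom C b a" "g \<in> Hom C b a" for f g b
    using zero_mor_unique[OF _ that(1) _ that(2)] zero_Cmp_left[OF assms(2) _ ia] Idt_Cmp that
    by metis
  moreover have "f = g" if "f \<in> Hom C a b" "g \<in> Hom C a b" for f g b
    using zero_mor_unique[OF _ that(1) _ that(2)] zero_Cmp_right[OF assms(2) ia] Cmp_Idt that
    by metis
  moreover have "\<exists>f. f \<in> Hom C b a" "\<exists>f. f \<in> Hom C a b" if "b \<in> Obj C" for b
    using zero_objectD(1,2)[OF z that] Cmp_in uv by blast+
  ultimately show ?thesis using assms(1) unfolding zero_object_def by blast
qed

section \<open>Kernels and cokernels\<close>

lemma kernelD:
  assumes "is_kernel C f k" "f \<in> Hom C b c"
  shows "k \<in> Hom C (Dom C k) b" "zero_mor C (f \<cdot> k)" "is_mono C k"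
    and "\<And>a g. \<lbrakk>g \<in> Hom C a b; zero_mor C (f \<cdot> g)\<rbrakk> \<Longrightarrow> \<exists>h\<in>Hom C a (Dom C k). k \<cdot> h = g"
proof -
  have df: "Dom C f = b" using assms(2) by (simp add: HomD)
  show k: "k \<in> Hom C (Dom C k) b" and z: "zero_mor C (f \<cdot> k)"
    using assms(1) df by (auto simp: is_kernel_def Hom_def)
  have ex1: "\<exists>!h. h \<in> Hom C a (Dom C k) \<and> k \<cdot> h = g"
    if "g \<in> Hom C a b" "zero_mor C (f \<cdot> g)" for a g
    using assms(1)[unfolded is_kernel_def, THEN conjunct2, THEN conjunct2, THEN conjunct2,
        THEN conjunct2, rule_format, of g] df that(2) HomD[OF that(1)] by simp
  then show "\<exists>h\<in>Hom C a (Dom C k). k \<cdot> h = g"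
    if "g \<in> Hom C a b" "zero_mor C (f \<cdot> g)" for a g
    using ex1_implies_ex[OF ex1[OF that]] by auto
  show "is_mono C k"
  proof (rule monoI[OF k])
    fix a g h assume g: "g \<in> Hom C a (Dom C k)" and h: "h \<in> Hom C a (Dom C k)"
      and eq: "k \<cdot> g = k \<cdot> h"
    have "zero_mor C (f \<cdot> (k \<cdot> h))"
      using zero_Cmp_left[OF z h Cmp_in[OF k assms(2)]] Cmp_assoc[OF h k assms(2)] by simp
    from ex1[OF Cmp_in[OF h k] this] show "g = h" by (rule ex1_unique) (use g h eq in auto)
  qed
qed

lemma cokernelD:
  assumes "is_cokernel C f q" "f \<in> Hom C a b"
  shows "q \<in> Hom C b (Cod C q)" "zero_mor C (q \<cdot> f)" "is_epi C q"
    and "\<And>c g. \<lbrakk>g \<in> Hom C b c; zero_mor C (g \<cdot> f)\<rbrakk> \<Longrightarrow> \<exists>h\<in>Hom C (Cod C q) c. h \<cdot> q = g"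
proof -
  have df: "Cod C f = b" using assms(2) by (simp add: HomD)
  show k: "q \<in> Hom C b (Cod C q)" and z: "zero_mor C (q \<cdot> f)"
    using assms(1) df by (auto simp: is_cokernel_def Hom_def)
  have ex1: "\<exists>!h. h \<in> Hom C (Cod C q) c \<and> h \<cdot> q = g"
    if "g \<in> Hom C b c" "zero_mor C (g \<cdot> f)" for c g
    using assms(1)[unfolded is_cokernel_def, THEN conjunct2, THEN conjunct2, THEN conjunct2,
        THEN conjunct2, rule_format, of g] df that(2) HomD[OF that(1)] by simp
  then show "\<exists>h\<in>Hom C (Cod C q) c. h \<cdot> q = g"
    if "g \<in> Hom C b c" "zero_mor C (g \<cdot> f)" for c g
    using ex1_implies_ex[OF ex1[OF that]] by auto
  show "is_epi C q"
  proof (rule epiI[OF k])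
    fix c g h assume g: "g \<in> Hom C (Cod C q) c" and h: "h \<in> Hom C (Cod C q) c"
      and eq: "g \<cdot> q = h \<cdot> q"
    have "zero_mor C (h \<cdot> q \<cdot> f)"
      using zero_Cmp_right[OF z Cmp_in[OF assms(2) k] h] Cmp_assoc[OF assms(2) k h] by simp
    from ex1[OF Cmp_in[OF k h] this] show "g = h" by (rule ex1_unique) (use g h eq in auto)
  qed
qed

text \<open>Uniqueness of the factorization is traded for k being mono, which is mostly known
  beforehand.\<close>

lemma is_kernelI:
  assumes f: "f \<in> Hom C b c" and k: "k \<in> Hom C a b" and z: "zero_mor C (f \<cdot> k)"
    and m: "is_mono C k"
    and ex: "\<And>d g. \<lbrakk>g \<in> Hom C d b; zero_mor C (f \<cdot> g)\<rbrakk> \<Longrightarrow> \<exists>h\<in>Hom C d a. k \<cdot> h = g"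
  shows "is_kernel C f k"
proof -
  have "\<exists>!h. h \<in> Hom C (Dom C g) a \<and> k \<cdot> h = g"
    if "g \<in> Arr C" "Cod C g = b" "zero_mor C (f \<cdot> g)" for g
  proof -
    have "g \<in> Hom C (Dom C g) b" using that by (auto simp: Hom_def)
    from ex[OF this that(3)] show ?thesis using mono_cancel[OF m k] by metis
  qed
  then show ?thesis using assms by (auto simp: is_kernel_def HomD)
qed

lemma is_cokernelI:
  assumes f: "f \<in> Hom C a b" and k: "q \<in> Hom C b c" and z: "zero_mor C (q \<cdot> f)"
    and m: "is_epi C q"
    and ex: "\<And>d g. \<lbrakk>g \<in> Hom C b d; zero_mor C (g \<cdot> f)\<rbrakk> \<Longrightarrow> \<exists>h\<in>Hom C c d. h \<cdot> q = g"
  shows "is_cokernel C f q"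
proof -
  have "\<exists>!h. h \<in> Hom C c (Cod C g) \<and> h \<cdot> q = g"
    if "g \<in> Arr C" "Dom C g = b" "zero_mor C (g \<cdot> f)" for g
  proof -
    have "g \<in> Hom C b (Cod C g)" using that by (auto simp: Hom_def)
    from ex[OF this that(3)] show ?thesis using epi_cancel[OF m k] by metis
  qed
  then show ?thesis using assms by (auto simp: is_cokernel_def HomD)
qed

end

section \<open>Abelian categories\<close>

locale abelian_category = category C for C :: "('o, 'm) cat" (structure) +
  assumes abelian: "abelian C"
begin

section \<open>Additive structure, and cancellation tested on zero morphisms\<close>

lemma ex_zero_object: "\<exists>z. zero_object C z"
  using abelian by (simp add: abelian_def)

lemma ex_zero_mor:
  assumes "a \<in> Obj C" "b \<in> Obj C"
  obtains f where "f \<in> Hom C a b" "zero_mor C f"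
proof -
  obtain z where z: "zero_object C z" using ex_zero_object by blast
  obtain u v where "u \<in> Hom C a z" "v \<in> Hom C z b"
    using zero_objectD(1,2)[OF z] assms by blast
  then show ?thesis using that zero_morI[OF z] Cmp_in by blast
qed

text \<open>The addition is hidden behind an existential quantifier and is unpacked here once. The
  last clause ties its neutral elements to zero objects: for v from a zero object z to b, the
  composite of v with the neutral element of Hom(a, z) equals its own double, so it is the neutral
  element of Hom(a, b), which therefore factors through z.\<close>

lemma padd_cases:
  obtains padd pzero where
    "\<And>a b. \<lbrakk>a \<in> Obj C; b \<in> Obj C\<rbrakk> \<Longrightarrow> comm_group \<lparr>carrier = Hom C a b, mult = padd, one = pzero a b\<rparr>"
    "\<And>a b c f f' g. \<lbrakk>f \<in> Hom C a b; f' \<in> Hom C a b; g \<in> Hom C b c\<rbrakk>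
       \<Longrightarrow> g \<cdot> padd f f' = padd (g \<cdot> f) (g \<cdot> f')"
    "\<And>a b c f g g'. \<lbrakk>f \<in> Hom C a b; g \<in> Hom C b c; g' \<in> Hom C b c\<rbrakk>
       \<Longrightarrow> padd g g' \<cdot> f = padd (g \<cdot> f) (g' \<cdot> f)"
    "\<And>a b. \<lbrakk>a \<in> Obj C; b \<in> Obj C\<rbrakk> \<Longrightarrow> zero_mor C (pzero a b)"
proof -
  obtain padd pzero where p: "preadditive C padd pzero" using abelian by (auto simp: abelian_def)
  have 1: "comm_group \<lparr>carrier = Hom C a b, mult = padd, one = pzero a b\<rparr>"
    if "a \<in> Obj C" "b \<in> Obj C" for a b
    using p that by (simp add: preadditive_def)
  have bil: "g \<cdot> padd f f' = padd (g \<cdot> f) (g \<cdot> f') \<and> padd g g' \<cdot> f = padd (g \<cdot> f) (g' \<cdot> f)"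
    if "f \<in> Hom C a b" "f' \<in> Hom C a b" "g \<in> Hom C b c" "g' \<in> Hom C b c" for a b c f f' g g'
    using p that Hom_Obj[OF that(1)] Hom_Obj[OF that(3)] unfolding preadditive_def by blast
  have 2: "g \<cdot> padd f f' = padd (g \<cdot> f) (g \<cdot> f')"
    if "f \<in> Hom C a b" "f' \<in> Hom C a b" "g \<in> Hom C b c" for a b c f f' g
    using bil[OF that that(3)] by simp
  have 3: "padd g g' \<cdot> f = padd (g \<cdot> f) (g' \<cdot> f)"
    if "f \<in> Hom C a b" "g \<in> Hom C b c" "g' \<in> Hom C b c" for a b c f g g'
    using bil[OF that(1,1,2,3)] by simp
  have 4: "zero_mor C (pzero a b)" if ab: "a \<in> Obj C" "b \<in> Obj C" for a b
  proof -
    obtain z where z: "zero_object C z" using ex_zero_object by blast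
    have zo: "z \<in> Obj C" by (rule zero_object_Obj[OF z])
    interpret G: comm_group "\<lparr>carrier = Hom C a b, mult = padd, one = pzero a b\<rparr>" by (rule 1[OF ab])
    interpret H: comm_group "\<lparr>carrier = Hom C a z, mult = padd, one = pzero a z\<rparr>"
      by (rule 1[OF ab(1) zo])
    obtain v where v: "v \<in> Hom C z b" using zero_objectD(2)[OF z ab(2)] by blast
    have h: "pzero a z \<in> Hom C a z" using H.one_closed by simp
    then have vh: "v \<cdot> pzero a z \<in> Hom C a b" using v Cmp_in by blast
    have "padd (pzero a z) (pzero a z) = pzero a z" using H.r_one[of "pzero a z"] h by simp
    then have "padd (v \<cdot> pzero a z) (v \<cdot> pzero a z) = v \<cdot> pzero a z" using 2[OF h h v] by simp
    then have "v \<cdot> pzero a z = pzero a b"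
      using G.l_cancel_one[of "v \<cdot> pzero a z" "v \<cdot> pzero a z"] vh by simp
    then show ?thesis using zero_morI[OF z h v] by simp
  qed
  show thesis by (rule that[of padd pzero]) (fact 1 2 3 4)+
qed

text \<open>The morphism d is g - h. It is described only by when its composites vanish, so that
  later proofs need no group operations.\<close>

lemma difference:
  assumes g: "g \<in> Hom C a b" and h: "h \<in> Hom C a b"
  obtains d where "d \<in> Hom C a b" "zero_mor C d \<longleftrightarrow> g = h"
    "\<And>c f. f \<in> Hom C b c \<Longrightarrow> zero_mor C (f \<cdot> d) \<longleftrightarrow> f \<cdot> g = f \<cdot> h"
    "\<And>c f. f \<in> Hom C c a \<Longrightarrow> zero_mor C (d \<cdot> f) \<longleftrightarrow> g \<cdot> f = h \<cdot> f"
proof (rule padd_cases)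
  fix padd pzero
  assume grp: "\<And>a b. \<lbrakk>a \<in> Obj C; b \<in> Obj C\<rbrakk>
        \<Longrightarrow> comm_group \<lparr>carrier = Hom C a b, mult = padd, one = pzero a b\<rparr>"
    and dl: "\<And>a b c f f' g. \<lbrakk>f \<in> Hom C a b; f' \<in> Hom C a b; g \<in> Hom C b c\<rbrakk>
       \<Longrightarrow> g \<cdot> padd f f' = padd (g \<cdot> f) (g \<cdot> f')"
    and dr: "\<And>a b c f g g'. \<lbrakk>f \<in> Hom C a b; g \<in> Hom C b c; g' \<in> Hom C b c\<rbrakk>
       \<Longrightarrow> padd g g' \<cdot> f = padd (g \<cdot> f) (g' \<cdot> f)"
    and z: "\<And>a b. \<lbrakk>a \<in> Obj C; b \<in> Obj C\<rbrakk> \<Longrightarrow> zero_mor C (pzero a b)"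
  have pz: "zero_mor C x \<longleftrightarrow> x = pzero a b" if x: "x \<in> Hom C a b" for x a b
  proof -
    have "pzero a b \<in> Hom C a b"
      using comm_group.axioms(1)[OF grp[OF Hom_Obj[OF x]]] comm_monoid.axioms(1) monoid.one_closed
      by fastforce
    then show ?thesis using zero_mor_unique[OF _ x z] z[OF Hom_Obj[OF x]] Hom_Obj[OF x] by blast
  qed
  \<comment> \<open>An additive inverse y' of y is described by y + y' being a zero morphism. This
    form is stable under composition, so it applies to g - h and to its composites on either
    side.\<close>
  have core: "zero_mor C (padd x y') \<longleftrightarrow> x = y"
    if x: "x \<in> Hom C a b" and y: "y \<in> Hom C a b" and y': "y' \<in> Hom C a b"
      and zz: "zero_mor C (padd y y')" for x y y' a b
  proof -
    interpret G: comm_group "\<lparr>carrier = Hom C a b, mult = padd, one = pzero a b\<rparr>"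
      by (rule grp[OF Hom_Obj[OF x]])
    have "padd x y' \<in> Hom C a b" "padd y y' \<in> Hom C a b"
      using G.m_closed x y y' by simp_all
    then show ?thesis using pz zz G.right_cancel[of y' x y] x y y' by simp
  qed
  interpret G: comm_group "\<lparr>carrier = Hom C a b, mult = padd, one = pzero a b\<rparr>"
    by (rule grp[OF Hom_Obj[OF g]])
  define h' where "h' = inv\<^bsub>\<lparr>carrier = Hom C a b, mult = padd, one = pzero a b\<rparr>\<^esub> h"
  have h': "h' \<in> Hom C a b" using G.inv_closed[of h] h by (simp add: h'_def)
  have hh: "zero_mor C (padd h h')" using G.r_inv[of h] h z[OF Hom_Obj[OF g]] by (simp add: h'_def)
  have hhin: "padd h h' \<in> Hom C a b" using G.m_closed h h' by simp
  show thesis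
  proof (rule that[of "padd g h'"])
    show "padd g h' \<in> Hom C a b" using G.m_closed g h' by simp
    show "zero_mor C (padd g h') \<longleftrightarrow> g = h" by (rule core[OF g h h' hh])
    show "zero_mor C (f \<cdot> padd g h') \<longleftrightarrow> f \<cdot> g = f \<cdot> h" if f: "f \<in> Hom C b c" for c f
      using core[OF Cmp_in[OF g f] Cmp_in[OF h f] Cmp_in[OF h' f]] dl[OF g h' f] dl[OF h h' f]
        zero_Cmp_right[OF hh hhin f] by simp
    show "zero_mor C (padd g h' \<cdot> f) \<longleftrightarrow> g \<cdot> f = h \<cdot> f" if f: "f \<in> Hom C c a" for c f
      using core[OF Cmp_in[OF f g] Cmp_in[OF f h] Cmp_in[OF f h']] dr[OF f g h'] dr[OF f h h']
        zero_Cmp_left[OF hh f hhin] by simp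
  qed
qed

text \<open>The sum g + h, described only where one of the summands vanishes; this is all that is
  needed to add up projections onto different summands of a coproduct.\<close>

lemma addition:
  assumes g: "g \<in> Hom C a b" and h: "h \<in> Hom C a b"
  obtains d where "d \<in> Hom C a b"
    "\<And>c f. \<lbrakk>f \<in> Hom C c a; zero_mor C (h \<cdot> f)\<rbrakk> \<Longrightarrow> d \<cdot> f = g \<cdot> f"
    "\<And>c f. \<lbrakk>f \<in> Hom C c a; zero_mor C (g \<cdot> f)\<rbrakk> \<Longrightarrow> d \<cdot> f = h \<cdot> f"
proof (rule padd_cases)
  fix padd pzero
  assume grp: "\<And>a b. \<lbrakk>a \<in> Obj C; b \<in> Obj C\<rbrakk>
        \<Longrightarrow> comm_group \<lparr>carrier = Hom C a b, mult = padd, one = pzero a b\<rparr>"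
    and dr: "\<And>a b c f g g'. \<lbrakk>f \<in> Hom C a b; g \<in> Hom C b c; g' \<in> Hom C b c\<rbrakk>
       \<Longrightarrow> padd g g' \<cdot> f = padd (g \<cdot> f) (g' \<cdot> f)"
    and z: "\<And>a b. \<lbrakk>a \<in> Obj C; b \<in> Obj C\<rbrakk> \<Longrightarrow> zero_mor C (pzero a b)"
  have neutral: "padd x y = x \<and> padd y x = x"
    if x: "x \<in> Hom C a b" and y: "y \<in> Hom C a b" and zy: "zero_mor C y" for x y a b
  proof -
    interpret G: comm_group "\<lparr>carrier = Hom C a b, mult = padd, one = pzero a b\<rparr>"
      by (rule grp[OF Hom_Obj[OF x]])
    have "y = pzero a b"
      using zero_mor_unique[OF zy y z[OF Hom_Obj[OF x]]] G.one_closed by simp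
    then show ?thesis using G.r_one[of x] G.l_one[of x] x by simp
  qed
  interpret G: comm_group "\<lparr>carrier = Hom C a b, mult = padd, one = pzero a b\<rparr>"
    by (rule grp[OF Hom_Obj[OF g]])
  show thesis
  proof (rule that[of "padd g h"])
    show "padd g h \<in> Hom C a b" using G.m_closed g h by simp
    show "padd g h \<cdot> f = g \<cdot> f" if f: "f \<in> Hom C c a" and z: "zero_mor C (h \<cdot> f)" for c f
      using dr[OF f g h] neutral[OF Cmp_in[OF f g] Cmp_in[OF f h] z] by simp
    show "padd g h \<cdot> f = h \<cdot> f" if f: "f \<in> Hom C c a" and z: "zero_mor C (g \<cdot> f)" for c f
      using dr[OF f g h] neutral[OF Cmp_in[OF f h] Cmp_in[OF f g] z] by simp
  qed
qed

lemma mono_zeroI: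
  assumes f: "f \<in> Hom C b c"
    and z: "\<And>a g. \<lbrakk>g \<in> Hom C a b; zero_mor C (f \<cdot> g)\<rbrakk> \<Longrightarrow> zero_mor C g"
  shows "is_mono C f"
proof (rule monoI[OF f])
  fix a g h assume g: "g \<in> Hom C a b" and h: "h \<in> Hom C a b" and eq: "f \<cdot> g = f \<cdot> h"
  obtain d where d: "d \<in> Hom C a b" "zero_mor C d \<longleftrightarrow> g = h"
    "\<And>c f. f \<in> Hom C b c \<Longrightarrow> zero_mor C (f \<cdot> d) \<longleftrightarrow> f \<cdot> g = f \<cdot> h"
    using difference[OF g h] by metis
  then show "g = h" using z[OF d(1)] d(3)[OF f] eq by simp
qed

lemma epi_zeroI:
  assumes f: "f \<in> Hom C a b"
    and z: "\<And>c g. \<lbrakk>g \<in> Hom C b c; zero_mor C (g \<cdot> f)\<rbrakk> \<Longrightarrow> zero_mor C g"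
  shows "is_epi C f"
proof (rule epiI[OF f])
  fix c g h assume g: "g \<in> Hom C b c" and h: "h \<in> Hom C b c" and eq: "g \<cdot> f = h \<cdot> f"
  obtain d where d: "d \<in> Hom C b c" "zero_mor C d \<longleftrightarrow> g = h"
    "\<And>c f. f \<in> Hom C c b \<Longrightarrow> zero_mor C (d \<cdot> f) \<longleftrightarrow> g \<cdot> f = h \<cdot> f"
    using difference[OF g h] by metis
  then show "g = h" using z[OF d(1)] d(3)[OF f] eq by simp
qed

lemma mono_zeroD:
  assumes "is_mono C f" "f \<in> Hom C b c" "g \<in> Hom C a b" "zero_mor C (f \<cdot> g)"
  shows "zero_mor C g"
proof -
  obtain z where z: "z \<in> Hom C a b" "zero_mor C z"
    using ex_zero_mor Hom_Obj[OF assms(3)] by blast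
  have "f \<cdot> g = f \<cdot> z"
    using zero_mor_unique[OF assms(4) Cmp_in[OF assms(3,2)] zero_Cmp_right[OF z(2,1) assms(2)]]
      Cmp_in[OF z(1) assms(2)] by simp
  then show ?thesis using mono_cancel[OF assms(1,2,3) z(1)] z(2) by simp
qed

lemma epi_zeroD:
  assumes "is_epi C f" "f \<in> Hom C a b" "g \<in> Hom C b c" "zero_mor C (g \<cdot> f)"
  shows "zero_mor C g"
proof -
  obtain z where z: "z \<in> Hom C b c" "zero_mor C z"
    using ex_zero_mor Hom_Obj[OF assms(3)] by blast
  have "g \<cdot> f = z \<cdot> f"
    using zero_mor_unique[OF assms(4) Cmp_in[OF assms(2,3)] zero_Cmp_left[OF z(2) assms(2) z(1)]]
      Cmp_in[OF assms(2) z(1)] by simp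
  then show ?thesis using epi_cancel[OF assms(1,2,3) z(1)] z(2) by simp
qed

section \<open>Kernel-cokernel duality, images and preimages\<close>

lemma kernelE:
  assumes "f \<in> Hom C b c"
  obtains k where "is_kernel C f k"
proof -
  have "\<exists>k. is_kernel C f k" using abelian Hom_ArrD[OF assms] unfolding abelian_def by blast
  then show ?thesis using that by blast
qed

lemma cokernelE:
  assumes "f \<in> Hom C a b"
  obtains q where "is_cokernel C f q"
proof -
  have "\<exists>q. is_cokernel C f q" using abelian Hom_ArrD[OF assms] unfolding abelian_def by blast
  then show ?thesis using that by blast
qed

text \<open>In an abelian category m is the kernel of some g. As g kills m it factors through q, so
  whatever q kills is killed by g and factors through m.\<close>

lemma mono_kernel_cokernel:
  assumes m: "is_mono C m" and mh: "m \<in> Hom C a b" and q: "is_cokernel C m q"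
  shows "is_kernel C q m"
proof -
  obtain g where g: "is_kernel C g m" using abelian m by (auto simp: abelian_def)
  have gh: "g \<in> Hom C b (Cod C g)" using g mh by (auto simp: is_kernel_def Hom_def)
  note qD = cokernelD[OF q mh] and gD = kernelD[OF g gh]
  obtain w where w: "w \<in> Hom C (Cod C q) (Cod C g)" "w \<cdot> q = g"
    using qD(4)[OF gh gD(2)] by blast
  show ?thesis
  proof (rule is_kernelI[OF qD(1) mh qD(2) m])
    fix d x assume x: "x \<in> Hom C d b" and z: "zero_mor C (q \<cdot> x)"
    have "zero_mor C (g \<cdot> x)"
      using zero_Cmp_right[OF z Cmp_in[OF x qD(1)] w(1)] Cmp_assoc[OF x qD(1) w(1)] w(2) by simp
    from gD(4)[OF x this] show "\<exists>h\<in>Hom C d a. m \<cdot> h = x" using mh by (simp add: HomD)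
  qed
qed

lemma epi_cokernel_kernel:
  assumes e: "is_epi C e" and eh: "e \<in> Hom C a b" and k: "is_kernel C e k"
  shows "is_cokernel C k e"
proof -
  obtain g where g: "is_cokernel C g e" using abelian e by (auto simp: abelian_def)
  have gh: "g \<in> Hom C (Dom C g) a" using g eh by (auto simp: is_cokernel_def Hom_def)
  note kD = kernelD[OF k eh] and gD = cokernelD[OF g gh]
  obtain w where w: "w \<in> Hom C (Dom C g) (Dom C k)" "k \<cdot> w = g"
    using kD(4)[OF gh gD(2)] by blast
  show ?thesis
  proof (rule is_cokernelI[OF kD(1) eh kD(2) e])
    fix d x assume x: "x \<in> Hom C a d" and z: "zero_mor C (x \<cdot> k)"
    have "zero_mor C (x \<cdot> g)"
      using zero_Cmp_left[OF z w(1) Cmp_in[OF kD(1) x]] Cmp_assoc[OF w(1) kD(1) x] w(2) by simp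
    from gD(4)[OF x this] show "\<exists>h\<in>Hom C b d. h \<cdot> e = x" using eh by (simp add: HomD)
  qed
qed

text \<open>The cokernel q of an epimorphism f is zero, so the identity of b factors through the
  kernel of q, which is f.\<close>

lemma mono_epi_iso:
  assumes m: "is_mono C f" and e: "is_epi C f" and f: "f \<in> Hom C a b"
  shows "is_iso C f"
proof -
  obtain q where q: "is_cokernel C f q" using cokernelE[OF f] by blast
  note qD = cokernelD[OF q f]
  note k = kernelD[OF mono_kernel_cokernel[OF m f q] qD(1)]
  have b: "b \<in> Obj C" using Hom_Obj f by blast
  have "zero_mor C q" by (rule epi_zeroD[OF e f qD(1,2)])
  then have "zero_mor C (q \<cdot> Idt C b)" using Cmp_Idt[OF qD(1)] by simp
  from k(4)[OF Idt_in[OF b] this] obtain h where "h \<in> Hom C b a" "f \<cdot> h = Idt C b"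
    using f by (auto simp: HomD)
  then show ?thesis using mono_split_epi_iso[OF m f] by blast
qed

text \<open>The image is the kernel of the cokernel of f; the work lies in showing that the
  corestriction e is epi.\<close>

lemma image_factorization:
  assumes f: "f \<in> Hom C a b"
  obtains c m e where "m \<in> Hom C c b" "is_mono C m" "e \<in> Hom C a c" "is_epi C e" "m \<cdot> e = f"
proof -
  obtain q where q: "is_cokernel C f q" using cokernelE[OF f] by blast
  note qD = cokernelD[OF q f]
  obtain m where k: "is_kernel C q m" using kernelE[OF qD(1)] by blast
  define c where "c = Dom C m"
  note m = kernelD[OF k qD(1), folded c_def]
  obtain e where e: "e \<in> Hom C a c" "m \<cdot> e = f" using m(4)[OF f qD(2)] by blast
  \<comment> \<open>A morphism that kills f factors through the cokernel q, and q kills m.\<close>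
  have gm: "zero_mor C (g \<cdot> m)" if g: "g \<in> Hom C b d" and z: "zero_mor C (g \<cdot> f)" for d g
  proof -
    obtain w where w: "w \<in> Hom C (Cod C q) d" "w \<cdot> q = g" using qD(4)[OF g z] by blast
    show ?thesis
      using zero_Cmp_right[OF m(2) Cmp_in[OF m(1) qD(1)] w(1)] Cmp_assoc[OF m(1) qD(1) w(1)] w(2)
      by simp
  qed
  have epi: "is_epi C e"
  proof (rule epi_zeroI[OF e(1)])
    \<comment> \<open>If g kills e, then e factors through the kernel k of g, and f through the
      subobject m k. The cokernel u of m k kills f, hence m, so m factors through m k. Thus k is a
      split epimorphism, and g is zero because g k is.\<close>
    fix d g assume g: "g \<in> Hom C c d" and z: "zero_mor C (g \<cdot> e)"
    obtain k where k: "is_kernel C g k" using kernelE[OF g] by blast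
    note kD = kernelD[OF k g]
    obtain e' where e': "e' \<in> Hom C a (Dom C k)" "k \<cdot> e' = e" using kD(4)[OF e(1) z] by blast
    have mk: "m \<cdot> k \<in> Hom C (Dom C k) b" by (rule Cmp_in[OF kD(1) m(1)])
    have mkm: "is_mono C (m \<cdot> k)" by (rule mono_Cmp[OF kD(3,1) m(3,1)])
    obtain u where u: "is_cokernel C (m \<cdot> k) u" using cokernelE[OF mk] by blast
    note uD = cokernelD[OF u mk] 
    note mku = kernelD(4)[OF mono_kernel_cokernel[OF mkm mk u] uD(1)]
    have "m \<cdot> k \<cdot> e' = f" using Cmp_assoc[OF e'(1) kD(1) m(1)] e'(2) e(2) by simp
    then have "zero_mor C (u \<cdot> f)"
      using zero_Cmp_left[OF uD(2) e'(1) Cmp_in[OF mk uD(1)]] Cmp_assoc[OF e'(1) mk uD(1)] by simp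
    then have "zero_mor C (u \<cdot> m)" by (rule gm[OF uD(1)])
    from mku[OF m(1) this] obtain w where w: "w \<in> Hom C c (Dom C k)" "m \<cdot> k \<cdot> w = m"
      using mk by (auto simp: HomD)
    have c: "c \<in> Obj C" using Hom_Obj m(1) by blast
    have "m \<cdot> (k \<cdot> w) = m \<cdot> Idt C c"
      using Cmp_assoc[OF w(1) kD(1) m(1)] w(2) Cmp_Idt[OF m(1)] by simp
    then have kw: "k \<cdot> w = Idt C c"
      using mono_cancel[OF m(3,1) Cmp_in[OF w(1) kD(1)] Idt_in[OF c]] by simp
    have "g = g \<cdot> k \<cdot> w" using Cmp_assoc[OF w(1) kD(1) g] kw Cmp_Idt[OF g] by simp
    then show "zero_mor C g" using zero_Cmp_left[OF kD(2) w(1) Cmp_in[OF kD(1) g]] by simp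
  qed
  show thesis by (rule that[OF m(1,3) e(1) epi e(2)])
qed

text \<open>The preimage of the subobject n under e is the kernel of q e, with q the cokernel of n.
  It serves to cover a subobject of a quotient of s by a subobject of s.\<close>

lemma preimage:
  assumes n: "n \<in> Hom C b c" "is_mono C n" and e: "e \<in> Hom C s c" "is_epi C e"
  obtains a k e' where "k \<in> Hom C a s" "is_mono C k" "e' \<in> Hom C a b" "is_epi C e'"
    "n \<cdot> e' = e \<cdot> k"
proof -
  obtain q where q: "is_cokernel C n q" using cokernelE[OF n(1)] by blast
  note qD = cokernelD[OF q n(1)]
  note nk = kernelD(4)[OF mono_kernel_cokernel[OF n(2,1) q] qD(1)]
  have qe: "q \<cdot> e \<in> Hom C s (Cod C q)" by (rule Cmp_in[OF e(1) qD(1)])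
  have qee: "is_epi C (q \<cdot> e)" by (rule epi_Cmp[OF e(2,1) qD(3,1)])
  obtain k where k: "is_kernel C (q \<cdot> e) k" using kernelE[OF qe] by blast
  note kD = kernelD[OF k qe]
  note qek = cokernelD(4)[OF epi_cokernel_kernel[OF qee qe k] kD(1)]
  have ek: "e \<cdot> k \<in> Hom C (Dom C k) c" by (rule Cmp_in[OF kD(1) e(1)])
  have "zero_mor C (q \<cdot> (e \<cdot> k))" using kD(2) Cmp_assoc[OF kD(1) e(1) qD(1)] by simp
  from nk[OF ek this] obtain e' where e': "e' \<in> Hom C (Dom C k) b" "n \<cdot> e' = e \<cdot> k"
    using n by (auto simp: HomD)
  \<comment> \<open>If g kills e', then e' factors through the kernel l of g. With q' the cokernel
    of n l, the morphism q' e kills k, so it factors through q e, the cokernel of k. Cancelling e,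
    q' factors through q and kills n. Hence n factors through n l, which makes l a split epimorphism
    and g zero.\<close>
  have "is_epi C e'"
  proof (rule epi_zeroI[OF e'(1)])
    fix d g assume g: "g \<in> Hom C b d" and z: "zero_mor C (g \<cdot> e')"
    obtain l where l: "is_kernel C g l" using kernelE[OF g] by blast
    note lD = kernelD[OF l g]
    obtain e'' where e'': "e'' \<in> Hom C (Dom C k) (Dom C l)" "l \<cdot> e'' = e'"
      using lD(4)[OF e'(1) z] by blast
    have nl: "n \<cdot> l \<in> Hom C (Dom C l) c" by (rule Cmp_in[OF lD(1) n(1)])
    have nlm: "is_mono C (n \<cdot> l)" by (rule mono_Cmp[OF lD(3,1) n(2,1)])
    obtain q' where q': "is_cokernel C (n \<cdot> l) q'" using cokernelE[OF nl] by blast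
    note q'D = cokernelD[OF q' nl]
    note nlk = kernelD(4)[OF mono_kernel_cokernel[OF nlm nl q'] q'D(1)]
    have "q' \<cdot> e \<cdot> k = q' \<cdot> (n \<cdot> l) \<cdot> e''"
      using Cmp_assoc[OF kD(1) e(1) q'D(1)] e'(2) e''(2) Cmp_assoc[OF e''(1) lD(1) n(1)]
        Cmp_assoc[OF e''(1) nl q'D(1)] by simp
    then have "zero_mor C (q' \<cdot> e \<cdot> k)"
      using zero_Cmp_left[OF q'D(2) e''(1) Cmp_in[OF nl q'D(1)]] by simp
    from qek[OF Cmp_in[OF e(1) q'D(1)] this]
    obtain w where w: "w \<in> Hom C (Cod C q) (Cod C q')" "w \<cdot> (q \<cdot> e) = q' \<cdot> e"
      using qe by (auto simp: HomD)
    have "w \<cdot> q \<cdot> e = q' \<cdot> e" using Cmp_assoc[OF e(1) qD(1) w(1)] w(2) by simp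
    then have wq: "w \<cdot> q = q'"
      using epi_cancel[OF e(2,1) Cmp_in[OF qD(1) w(1)] q'D(1)] by simp
    have "zero_mor C (q' \<cdot> n)"
      using zero_Cmp_right[OF qD(2) Cmp_in[OF n(1) qD(1)] w(1)] Cmp_assoc[OF n(1) qD(1) w(1)] wq
      by simp
    from nlk[OF n(1) this] obtain v where v: "v \<in> Hom C b (Dom C l)" "n \<cdot> l \<cdot> v = n"
      using nl by (auto simp: HomD)
    have b: "b \<in> Obj C" using Hom_Obj n(1) by blast
    have "n \<cdot> (l \<cdot> v) = n \<cdot> Idt C b"
      using Cmp_assoc[OF v(1) lD(1) n(1)] v(2) Cmp_Idt[OF n(1)] by simp
    then have lv: "l \<cdot> v = Idt C b"
      using mono_cancel[OF n(2,1) Cmp_in[OF v(1) lD(1)] Idt_in[OF b]] by simp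
    have "g = g \<cdot> l \<cdot> v" using Cmp_assoc[OF v(1) lD(1) g] lv Cmp_Idt[OF g] by simp
    then show "zero_mor C g" using zero_Cmp_left[OF lD(2) v(1) Cmp_in[OF lD(1) g]] by simp
  qed
  then show ?thesis using that[OF kD(1,3) e'(1) _ e'(2)] by blast
qed

end

section \<open>Coproducts and products of small families\<close>

lemma small_subset: "small \<kappa> A \<Longrightarrow> B \<subseteq> A \<Longrightarrow> small \<kappa> B"
  unfolding small_def using card_of_mono1 ordLeq_ordLess_trans by blast

lemma small_image: "small \<kappa> A \<Longrightarrow> small \<kappa> (f ` A)"
  unfolding small_def using card_of_image ordLeq_ordLess_trans by blast

lemma universeD:
  fixes \<kappa> :: "'u rel"
  assumes "universe \<kappa>"
  shows "Card_order \<kappa>" "\<not> finite (Field \<kappa>)"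
    and "\<And>A :: 'u set. small \<kappa> A \<Longrightarrow> small \<kappa> (Pow A)"
  using assms by (auto simp: universe_def cinfinite_def small_def)

lemma small_finite:
  assumes \<kappa>: "universe \<kappa>" and A: "finite A"
  shows "small \<kappa> A"
proof -
  have "Well_order \<kappa>" using card_order_on_well_order_on[OF universeD(1)[OF \<kappa>]] .
  moreover have "finite (Field |A| )" unfolding Field_card_of by (rule A)
  ultimately show ?thesis
    unfolding small_def
    using finite_ordLess_infinite[OF card_of_Well_order _ _ universeD(2)[OF \<kappa>]] by blast
qed

lemma small_Times_self:
  assumes "universe \<kappa>" "small \<kappa> A"
  shows "small \<kappa> (A \<times> A)"
proof (cases "finite A")
  case True
  then show ?thesis by (intro small_finite[OF assms(1)] finite_SigmaI)
next
  case False
  show ?thesis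
    using ordIso_ordLess_trans[OF card_of_Times_same_infinite[OF False] assms(2)[unfolded small_def]]
    by (simp only: small_def)
qed

text \<open>Diagrams are indexed by elements of \<open>'u\<close>, so a small set of another type,
  such as a set of subsets of I, must be coded there first.\<close>

lemma small_inj:
  fixes \<kappa> :: "'u rel"
  assumes "universe \<kappa>" "small \<kappa> A"
  obtains e :: "'a \<Rightarrow> 'u" where "inj_on e A"
proof -
  have "|A| \<le>o \<kappa>" using assms(2) ordLess_imp_ordLeq by (simp add: small_def)
  then have "|A| \<le>o |Field \<kappa>|"
    using card_of_Field_ordIso[OF universeD(1)[OF assms(1)]] ordIso_symmetric ordLeq_ordIso_trans
    by blast
  then obtain e :: "'a \<Rightarrow> 'u" where "inj_on e A"
    unfolding card_of_ordLeq[symmetric] by blast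
  then show ?thesis by (rule that)
qed

text \<open>The arrows of an index category are elements of \<open>'u\<close> too; those of a
  preorder are pairs, which this injection codes.\<close>

lemma universe_pairing:
  fixes \<kappa> :: "'u rel"
  assumes "universe \<kappa>"
  obtains e :: "'u \<times> 'u \<Rightarrow> 'u" where "inj e"
proof -
  have "\<not> finite (UNIV :: 'u set)" using universeD(2)[OF assms] infinite_super[OF subset_UNIV] by blast
  then have "|(UNIV :: 'u set) \<times> (UNIV :: 'u set)| \<le>o |UNIV :: 'u set|"
    by (rule ordIso_imp_ordLeq[OF card_of_Times_same_infinite])
  then obtain e :: "'u \<times> 'u \<Rightarrow> 'u" where "inj_on e (UNIV \<times> UNIV)"
    unfolding card_of_ordLeq[symmetric] by blast
  then show ?thesis using that by simp
qed

text \<open>A preorder as a category whose arrows are coded as elements of the same type as its objects,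
  as in the definition of exactness of filtered colimits.\<close>

definition preorder_cat ::
    "('u \<times> 'u \<Rightarrow> 'u) \<Rightarrow> 'u set \<Rightarrow> ('u \<Rightarrow> 'u \<Rightarrow> bool) \<Rightarrow> ('u, 'u) cat" where
  "preorder_cat e D R = \<lparr>Obj = D, Arr = e ` {(x, y) \<in> D \<times> D. R x y},
     Dom = (\<lambda>a. fst (inv_into UNIV e a)), Cod = (\<lambda>a. snd (inv_into UNIV e a)),
     Idt = (\<lambda>x. e (x, x)), Cmp = (\<lambda>b a. e (fst (inv_into UNIV e a), snd (inv_into UNIV e b)))\<rparr>"

lemma preorder_cat_Hom:
  assumes "inj e"
  shows "a \<in> Hom (preorder_cat e D R) x y \<longleftrightarrow> x \<in> D \<and> y \<in> D \<and> R x y \<and> a = e (x, y)"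
  using assms by (auto simp: preorder_cat_def Hom_def)

lemma preorder_cat_Obj [simp]: "Obj (preorder_cat e D R) = D"
  by (simp add: preorder_cat_def)

lemma category_preorder_cat:
  assumes e: "inj e" and r: "\<And>x. x \<in> D \<Longrightarrow> R x x"
    and t: "\<And>x y z. \<lbrakk>x \<in> D; y \<in> D; z \<in> D; R x y; R y z\<rbrakk> \<Longrightarrow> R x z"
  shows "category (preorder_cat e D R)"
proof
  let ?J = "preorder_cat e D R"
  have cmp: "Cmp ?J (e (y, z)) (e (x, y')) = e (x, z)" for x y y' z
    using e by (simp add: preorder_cat_def)
  fix a b c d f g h
  show "f \<in> Arr ?J \<Longrightarrow> Dom ?J f \<in> Obj ?J" "f \<in> Arr ?J \<Longrightarrow> Cod ?J f \<in> Obj ?J"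
    using e by (auto simp: preorder_cat_def)
  show "a \<in> Obj ?J \<Longrightarrow> Idt ?J a \<in> Hom ?J a a"
    using r by (simp add: preorder_cat_Hom[OF e]) (simp add: preorder_cat_def)
  show "f \<in> Hom ?J a b \<Longrightarrow> g \<in> Hom ?J b c \<Longrightarrow> Cmp ?J g f \<in> Hom ?J a c"
    using t by (auto simp: preorder_cat_Hom[OF e] cmp)
  show "f \<in> Hom ?J a b \<Longrightarrow> Cmp ?J f (Idt ?J a) = f" "f \<in> Hom ?J a b \<Longrightarrow> Cmp ?J (Idt ?J b) f = f"
    using e by (auto simp: preorder_cat_Hom[OF e]) (simp_all add: preorder_cat_def)
  show "\<lbrakk>f \<in> Hom ?J a b; g \<in> Hom ?J b c; h \<in> Hom ?J c d\<rbrakk>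
      \<Longrightarrow> Cmp ?J h (Cmp ?J g f) = Cmp ?J (Cmp ?J h g) f"
    by (auto simp: preorder_cat_Hom[OF e] cmp)
qed

lemma filtered_preorder_cat:
  assumes e: "inj e" and ne: "D \<noteq> {}"
    and d: "\<And>x y. \<lbrakk>x \<in> D; y \<in> D\<rbrakk> \<Longrightarrow> \<exists>z\<in>D. R x z \<and> R y z"
    and r: "\<And>x. x \<in> D \<Longrightarrow> R x x"
  shows "filtered (preorder_cat e D R)"
  unfolding filtered_def
proof (intro conjI ballI)
  let ?J = "preorder_cat e D R"
  show "Obj ?J \<noteq> {}" using ne by simp
  fix x y assume xy: "x \<in> Obj ?J" "y \<in> Obj ?J"
  then obtain z where "z \<in> D" "R x z" "R y z" using d by auto
  then have "e (x, z) \<in> Hom ?J x z" "e (y, z) \<in> Hom ?J y z"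
    using xy by (simp_all add: preorder_cat_Hom[OF e])
  then show "\<exists>k\<in>Obj ?J. Hom ?J x k \<noteq> {} \<and> Hom ?J y k \<noteq> {}" using \<open>z \<in> D\<close> by auto
  fix u v assume "u \<in> Hom ?J x y" "v \<in> Hom ?J x y"
  then have "u = v" by (simp add: preorder_cat_Hom[OF e])
  moreover have "e (y, y) \<in> Hom ?J y y" using xy r by (simp add: preorder_cat_Hom[OF e])
  ultimately show "\<exists>k\<in>Obj ?J. \<exists>w\<in>Hom ?J y k. Cmp ?J w u = Cmp ?J w v" using xy by auto
qed

context category
begin

lemma is_colimitI:
  assumes "L \<in> Obj C" "\<And>j. j \<in> Obj J \<Longrightarrow> c j \<in> Hom C (omap F j) L"
    and "\<And>i j u. \<lbrakk>i \<in> Obj J; j \<in> Obj J; u \<in> Hom J i j\<rbrakk> \<Longrightarrow> c j \<cdot> amap F u = c i"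
    and "\<And>T g. \<lbrakk>T \<in> Obj C; \<And>j. j \<in> Obj J \<Longrightarrow> g j \<in> Hom C (omap F j) T;
             \<And>i j u. \<lbrakk>i \<in> Obj J; j \<in> Obj J; u \<in> Hom J i j\<rbrakk> \<Longrightarrow> g j \<cdot> amap F u = g i\<rbrakk>
           \<Longrightarrow> \<exists>h\<in>Hom C L T. \<forall>j\<in>Obj J. h \<cdot> c j = g j"
    and "\<And>T g h. \<lbrakk>g \<in> Hom C L T; h \<in> Hom C L T; \<And>j. j \<in> Obj J \<Longrightarrow> g \<cdot> c j = h \<cdot> c j\<rbrakk>
           \<Longrightarrow> g = h"
  shows "is_colimit J C F L c"
  unfolding is_colimit_def
proof (intro conjI ballI allI impI)
  fix T g
  assume T: "T \<in> Obj C" and g: "(\<forall>j\<in>Obj J. g j \<in> Hom C (omap F j) T) \<and>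
    (\<forall>i\<in>Obj J. \<forall>j\<in>Obj J. \<forall>u\<in>Hom J i j. g j \<cdot> amap F u = g i)"
  have "\<exists>h\<in>Hom C L T. \<forall>j\<in>Obj J. h \<cdot> c j = g j"
    by (rule assms(4)[OF T]) (use g in simp_all)
  then obtain h where h: "h \<in> Hom C L T" "\<forall>j\<in>Obj J. h \<cdot> c j = g j" by blast
  show "\<exists>!h. h \<in> Hom C L T \<and> (\<forall>j\<in>Obj J. h \<cdot> c j = g j)"
  proof (rule ex1I[of _ h])
    fix k assume "k \<in> Hom C L T \<and> (\<forall>j\<in>Obj J. k \<cdot> c j = g j)"
    then show "k = h" using h by (intro assms(5)[of k T h]) auto
  qed (use h in blast)
qed (rule assms(1-3); assumption)+

end

context abelian_category
begin

text \<open>Exactness is applied to the short exact sequences with constant middle term \<open>P\<close>.\<close>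

lemma filtered_colimit_mono:
  fixes \<kappa> :: "'u rel" and J :: "('u, 'u) cat"
  assumes ex: "exact_filtered_colimits \<kappa> C"
    and J: "category J" "filtered J" "small \<kappa> (Obj J)" "small \<kappa> (Arr J)"
    and F: "is_functor J C F" and P: "P \<in> Obj C"
    and \<alpha>: "\<And>j. j \<in> Obj J \<Longrightarrow> \<alpha> j \<in> Hom C (omap F j) P" "\<And>j. j \<in> Obj J \<Longrightarrow> is_mono C (\<alpha> j)"
      "\<And>i j u. \<lbrakk>i \<in> Obj J; j \<in> Obj J; u \<in> Hom J i j\<rbrakk> \<Longrightarrow> \<alpha> j \<cdot> amap F u = \<alpha> i"
    and L: "is_colimit J C F L c" and f: "f \<in> Hom C L P" "\<And>j. j \<in> Obj J \<Longrightarrow> f \<cdot> c j = \<alpha> j"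
  shows "is_mono C f"
proof -
  interpret J: category J by (rule J(1))
  have "\<forall>j\<in>Obj J. \<exists>q. is_cokernel C (\<alpha> j) q" using cokernelE[OF \<alpha>(1)] by blast
  then obtain \<beta> where \<beta>: "\<And>j. j \<in> Obj J \<Longrightarrow> is_cokernel C (\<alpha> j) (\<beta> j)" by metis
  note \<beta>D = cokernelD[OF \<beta> \<alpha>(1)]
  define Q where "Q j = Cod C (\<beta> j)" for j
  have \<beta>h: "\<beta> j \<in> Hom C P (Q j)" if "j \<in> Obj J" for j using \<beta>D(1)[OF that that] by (simp add: Q_def)
  \<comment> \<open>H u is the morphism induced on cokernels. It is determined because the \<beta> i
    are epi, which is also why H is functorial.\<close>
  define H where "H u = (SOME w. w \<in> Hom C (Q (Dom J u)) (Q (Cod J u)) \<and> 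
      w \<cdot> \<beta> (Dom J u) = \<beta> (Cod J u))" for u
  have H: "H u \<in> Hom C (Q i) (Q j) \<and> H u \<cdot> \<beta> i = \<beta> j"
    if ij: "i \<in> Obj J" "j \<in> Obj J" and u: "u \<in> Hom J i j" for i j u
  proof -
    have Fu: "amap F u \<in> Hom C (omap F i) (omap F j)" using F ij u by (simp add: is_functor_def)
    have "zero_mor C (\<beta> j \<cdot> \<alpha> i)"
      using zero_Cmp_left[OF \<beta>D(2)[OF ij(2,2)] Fu Cmp_in[OF \<alpha>(1)[OF ij(2)] \<beta>h[OF ij(2)]]]
        Cmp_assoc[OF Fu \<alpha>(1)[OF ij(2)] \<beta>h[OF ij(2)]] \<alpha>(3)[OF ij u] by simp
    from \<beta>D(4)[OF ij(1,1) \<beta>h[OF ij(2)] this]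
    have "\<exists>w. w \<in> Hom C (Q i) (Q j) \<and> w \<cdot> \<beta> i = \<beta> j" by (auto simp: Q_def)
    from someI_ex[OF this] show ?thesis using u by (simp add: H_def J.HomD)
  qed
  define HF where "HF = (\<lparr>omap = Q, amap = H\<rparr> :: ('u, 'u, 'o, 'm) ftor)"
  define GF where "GF = (\<lparr>omap = (\<lambda>_. P), amap = (\<lambda>_. Idt C P)\<rparr> :: ('u, 'u, 'o, 'm) ftor)"
  have idP: "Idt C P \<in> Hom C P P" "Idt C P \<cdot> Idt C P = Idt C P"
    using Idt_in[OF P] Idt_Cmp by auto
  have HF: "is_functor J C HF"
    unfolding is_functor_def HF_def ftor.simps
  proof (intro conjI ballI)
    show Qj: "Q j \<in> Obj C" if "j \<in> Obj J" for j using Hom_Obj(2)[OF \<beta>h[OF that]] .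
    show "H u \<in> Hom C (Q i) (Q j)" if "i \<in> Obj J" "j \<in> Obj J" "u \<in> Hom J i j" for i j u
      using H[OF that] by simp
    show "H (Idt J j) = Idt C (Q j)" if j: "j \<in> Obj J" for j
      using H[OF j j J.Idt_in[OF j]] epi_cancel[OF \<beta>D(3)[OF j j] \<beta>h[OF j] _ Idt_in[OF Qj[OF j]]]
        Idt_Cmp[OF \<beta>h[OF j]] by simp
    show "H (v \<cdot>\<^bsub>J\<^esub> u) = H v \<cdot> H u"
      if ijk: "i \<in> Obj J" "j \<in> Obj J" "k \<in> Obj J" and u: "u \<in> Hom J i j" and v: "v \<in> Hom J j k"
      for i j k u v
    proof (rule epi_cancel[OF \<beta>D(3)[OF ijk(1,1)] \<beta>h[OF ijk(1)]])
      note Hu = H[OF ijk(1,2) u] and Hv = H[OF ijk(2,3) v]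
        and Hvu = H[OF ijk(1,3) J.Cmp_in[OF u v]]
      show "H (v \<cdot>\<^bsub>J\<^esub> u) \<in> Hom C (Q i) (Q k)" using Hvu by simp
      show "H v \<cdot> H u \<in> Hom C (Q i) (Q k)" using Hu Hv Cmp_in by blast
      show "H (v \<cdot>\<^bsub>J\<^esub> u) \<cdot> \<beta> i = H v \<cdot> H u \<cdot> \<beta> i"
        using Cmp_assoc[OF \<beta>h[OF ijk(1)] conjunct1[OF Hu] conjunct1[OF Hv]] Hu Hv Hvu by simp
    qed
  qed
  have GF: "is_functor J C GF" using P idP by (simp add: is_functor_def GF_def)
  obtain M m where M: "is_colimit J C HF M m"
    using ex J HF unfolding exact_filtered_colimits_def by meson
  have MO: "M \<in> Obj C" and m: "\<And>j. j \<in> Obj J \<Longrightarrow> m j \<in> Hom C (Q j) M"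
    and mH: "\<And>i j u. \<lbrakk>i \<in> Obj J; j \<in> Obj J; u \<in> Hom J i j\<rbrakk> \<Longrightarrow> m j \<cdot> H u = m i"
    using M by (auto simp: is_colimit_def HF_def)
  \<comment> \<open>Any two objects of a filtered category map to a third, so a cocone on a constant
    diagram has constant components. Hence P is the colimit of its constant diagram, and the m j
    \<beta> j are all the same morphism.\<close>
  have const: "g i = g j"
    if g: "\<And>i j u. \<lbrakk>i \<in> Obj J; j \<in> Obj J; u \<in> Hom J i j\<rbrakk> \<Longrightarrow> g j = g i"
      and ij: "i \<in> Obj J" "j \<in> Obj J" for g :: "'u \<Rightarrow> 'm" and i j
  proof -
    obtain k u v where "k \<in> Obj J" "u \<in> Hom J i k" "v \<in> Hom J j k"
      using J(2) ij unfolding filtered_def by blast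
    then show ?thesis using g[of i k u] g[of j k v] ij by simp
  qed
  obtain j0 where j0: "j0 \<in> Obj J" using J(2) by (auto simp: filtered_def)
  have GL: "is_colimit J C GF P (\<lambda>_. Idt C P)"
  proof (rule is_colimitI)
    fix T g assume T: "T \<in> Obj C" and g: "\<And>j. j \<in> Obj J \<Longrightarrow> g j \<in> Hom C (omap GF j) T"
      and co: "\<And>i j u. \<lbrakk>i \<in> Obj J; j \<in> Obj J; u \<in> Hom J i j\<rbrakk> \<Longrightarrow> g j \<cdot> amap GF u = g i"
    have gP: "g j \<in> Hom C P T" if "j \<in> Obj J" for j using g[OF that] by (simp add: GF_def)
    have gc: "g i = g j" if ij: "i \<in> Obj J" "j \<in> Obj J" for i j
    proof (rule const[OF _ ij])
      fix i j u assume ij: "i \<in> Obj J" "j \<in> Obj J" "u \<in> Hom J i j"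
      show "g j = g i" using co[OF ij] Cmp_Idt[OF gP[OF ij(2)]] by (simp add: GF_def)
    qed
    have "\<forall>j\<in>Obj J. g j0 \<cdot> Idt C P = g j"
      unfolding Cmp_Idt[OF gP[OF j0]] by (intro ballI gc[OF j0])
    then show "\<exists>h\<in>Hom C P T. \<forall>j\<in>Obj J. h \<cdot> Idt C P = g j" by (rule bexI) (rule gP[OF j0])
  next
    fix T g h assume gh: "g \<in> Hom C P T" "h \<in> Hom C P T"
      and eq: "\<And>j. j \<in> Obj J \<Longrightarrow> g \<cdot> Idt C P = h \<cdot> Idt C P"
    show "g = h" using eq[OF j0] Cmp_Idt[OF gh(1)] Cmp_Idt[OF gh(2)] by simp
  qed (use P idP in \<open>simp_all add: GF_def\<close>)
  define g where "g = m j0 \<cdot> \<beta> j0"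
  have gh: "g \<in> Hom C P M" unfolding g_def by (rule Cmp_in[OF \<beta>h[OF j0] m[OF j0]])
  have gm: "g = m j \<cdot> \<beta> j" if j: "j \<in> Obj J" for j
    unfolding g_def
  proof (rule const[of "\<lambda>j. m j \<cdot> \<beta> j", OF _ j0 j])
    fix i j u assume ij: "i \<in> Obj J" "j \<in> Obj J" and u: "u \<in> Hom J i j"
    show "m j \<cdot> \<beta> j = m i \<cdot> \<beta> i"
      using Cmp_assoc[OF \<beta>h[OF ij(1)] conjunct1[OF H[OF ij u]] m[OF ij(2)]] H[OF ij u] mH[OF ij u]
      by simp
  qed
  have se: "\<forall>j\<in>Obj J. short_exact C (\<alpha> j) (\<beta> j)"
    using mono_kernel_cokernel[OF \<alpha>(2,1) \<beta>] \<beta> by (simp add: short_exact_def)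
  have \<alpha>nat: "is_nat_trans J C F GF \<alpha>"
    using \<alpha> Idt_Cmp[OF \<alpha>(1)] by (simp add: is_nat_trans_def GF_def)
  have \<beta>nat: "is_nat_trans J C GF HF \<beta>"
    using H \<beta>h Cmp_Idt[OF \<beta>h] by (simp add: is_nat_trans_def GF_def HF_def)
  have fk: "\<forall>j\<in>Obj J. f \<cdot> c j = Idt C P \<cdot> \<alpha> j" using f(2) Idt_Cmp[OF \<alpha>(1)] by simp
  have gk: "\<forall>j\<in>Obj J. g \<cdot> Idt C P = m j \<cdot> \<beta> j"
    unfolding Cmp_Idt[OF gh] by (intro ballI gm)
  have "short_exact C f g"
    using ex[unfolded exact_filtered_colimits_def, rule_format, OF conjI[OF J(1) conjI[OF J(2) conjI[OF J(3,4)]]],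
      THEN conjunct2, rule_format, of F GF HF \<alpha> \<beta> L c P "\<lambda>_. Idt C P" M m f g]
      F GF HF \<alpha>nat \<beta>nat se L GL M f(1) fk gh gk by blast
  then show ?thesis using kernelD(3)[OF _ gh] by (auto simp: short_exact_def)
qed

text \<open>The sum of the composites t i . p i over F retracts \<alpha>, since p j \<alpha> t i is
  an identity or zero according to whether i = j.\<close>

lemma finite_coproduct_mono:
  assumes fin: "finite F" and B: "is_coproduct C F A B t" and \<alpha>: "\<alpha> \<in> Hom C B P"
    and p: "\<And>i. i \<in> F \<Longrightarrow> p i \<in> Hom C P (A i)"
    and diag: "\<And>i. i \<in> F \<Longrightarrow> p i \<cdot> (\<alpha> \<cdot> t i) = Idt C (A i)"
    and off: "\<And>i j. \<lbrakk>i \<in> F; j \<in> F; i \<noteq> j\<rbrakk> \<Longrightarrow> zero_mor C (p j \<cdot> (\<alpha> \<cdot> t i))"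
  shows "is_mono C \<alpha>"
proof -
  note t = coproduct_in[OF B]
  have at: "\<alpha> \<cdot> t i \<in> Hom C (A i) P" if "i \<in> F" for i using Cmp_in[OF t[OF that] \<alpha>] .
  have BO: "B \<in> Obj C" using B by (simp add: is_coproduct_def)
  \<comment> \<open>Here r is the sum of the t i . p i over i in F', known by its effect on the
    \<alpha> t i alone. Adding the term for k changes that effect only at i = k. The case F' = F
    gives the retraction.\<close>
  have "\<exists>r\<in>Hom C P B. \<forall>i\<in>F. (i \<in> F' \<longrightarrow> r \<cdot> (\<alpha> \<cdot> t i) = t i) \<and>
      (i \<notin> F' \<longrightarrow> zero_mor C (r \<cdot> (\<alpha> \<cdot> t i)))"
    if "finite F'" "F' \<subseteq> F" for F'
    using that
  proof (induction F')
    case empty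
    obtain r where "r \<in> Hom C P B" "zero_mor C r" using ex_zero_mor Hom_Obj[OF \<alpha>] by blast
    then show ?case using zero_Cmp_left at by blast
  next
    case (insert k F')
    then obtain r where r: "r \<in> Hom C P B" and
      r1: "\<And>i. i \<in> F' \<Longrightarrow> r \<cdot> (\<alpha> \<cdot> t i) = t i" and
      r0: "\<And>i. \<lbrakk>i \<in> F; i \<notin> F'\<rbrakk> \<Longrightarrow> zero_mor C (r \<cdot> (\<alpha> \<cdot> t i))" by auto
    have k: "k \<in> F" using insert by simp
    have tp: "t k \<cdot> p k \<in> Hom C P B" by (rule Cmp_in[OF p[OF k] t[OF k]])
    have tp1: "t k \<cdot> p k \<cdot> (\<alpha> \<cdot> t k) = t k"
      using Cmp_assoc[OF at[OF k] p[OF k] t[OF k]] diag[OF k] Cmp_Idt[OF t[OF k]] by simp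
    have tp0: "zero_mor C (t k \<cdot> p k \<cdot> (\<alpha> \<cdot> t i))" if i: "i \<in> F" "i \<noteq> k" for i
      using Cmp_assoc[OF at[OF i(1)] p[OF k] t[OF k]]
        zero_Cmp_right[OF off[OF i(1) k i(2)] Cmp_in[OF at[OF i(1)] p[OF k]] t[OF k]] by simp
    obtain d where d: "d \<in> Hom C P B"
      "\<And>c f. \<lbrakk>f \<in> Hom C c P; zero_mor C (t k \<cdot> p k \<cdot> f)\<rbrakk> \<Longrightarrow> d \<cdot> f = r \<cdot> f"
      "\<And>c f. \<lbrakk>f \<in> Hom C c P; zero_mor C (r \<cdot> f)\<rbrakk> \<Longrightarrow> d \<cdot> f = t k \<cdot> p k \<cdot> f"
      using addition[OF r tp] by metis
    have "(i \<in> insert k F' \<longrightarrow> d \<cdot> (\<alpha> \<cdot> t i) = t i) \<and>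
        (i \<notin> insert k F' \<longrightarrow> zero_mor C (d \<cdot> (\<alpha> \<cdot> t i)))" if i: "i \<in> F" for i
    proof (cases "i = k")
      case True
      then show ?thesis using d(3)[OF at[OF k] r0[OF k insert(2)]] tp1 by simp
    next
      case False
      then show ?thesis using d(2)[OF at[OF i] tp0[OF i False]] r1 r0[OF i] by simp
    qed
    then show ?case using d(1) by blast
  qed
  from this[OF fin subset_refl] obtain r where r: "r \<in> Hom C P B" "\<And>i. i \<in> F \<Longrightarrow> r \<cdot> (\<alpha> \<cdot> t i) = t i"
    by blast
  have "r \<cdot> \<alpha> = Idt C B"
  proof (rule coproduct_unique[OF B Cmp_in[OF \<alpha> r(1)] Idt_in[OF BO]])
    fix i assume i: "i \<in> F"
    show "r \<cdot> \<alpha> \<cdot> t i = Idt C B \<cdot> t i"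
      using Cmp_assoc[OF t[OF i] \<alpha> r(1)] r(2)[OF i] Idt_Cmp[OF t[OF i]] by simp
  qed
  then show ?thesis by (rule split_mono[OF \<alpha> r(1)])
qed

text \<open>A coproduct is the filtered colimit of the coproducts over finite sets of indices.\<close>

lemma coproduct_to_product_mono:
  fixes \<kappa> :: "'u rel" and I :: "'u set"
  assumes \<kappa>: "universe \<kappa>" and cop: "has_small_coproducts \<kappa> C"
    and ex: "exact_filtered_colimits \<kappa> C"
    and I: "small \<kappa> I" and A: "A ` I \<subseteq> Obj C"
    and S: "is_coproduct C I A S s" and f: "f \<in> Hom C S P"
    and p: "\<And>i. i \<in> I \<Longrightarrow> p i \<in> Hom C P (A i)"
    and diag: "\<And>i. i \<in> I \<Longrightarrow> p i \<cdot> (f \<cdot> s i) = Idt C (A i)"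
    and off: "\<And>i j. \<lbrakk>i \<in> I; j \<in> I; i \<noteq> j\<rbrakk> \<Longrightarrow> zero_mor C (p j \<cdot> (f \<cdot> s i))"
  shows "is_mono C f"
proof -
  \<comment> \<open>The finite subsets of I are to index a diagram, so they are coded in
    \<open>'u\<close>. This is possible because \<kappa> is a strong limit, so Pow I is
    small.\<close>
  obtain enc :: "'u set \<Rightarrow> 'u" where enc: "inj_on enc (Pow I)"
    using small_inj[OF \<kappa> universeD(3)[OF \<kappa> I]] by metis
  obtain e :: "'u \<times> 'u \<Rightarrow> 'u" where e: "inj e" using universe_pairing[OF \<kappa>] by metis
  define dec where "dec = inv_into (Pow I) enc"
  define D where "D = enc ` {F. finite F \<and> F \<subseteq> I}"
  \<comment> \<open>Codes are ordered by inclusion of the sets they stand for; unions of finite sets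
    make this order directed.\<close>
  define J where "J = preorder_cat e D (\<lambda>x y. dec x \<subseteq> dec y)"
  have dec_enc: "dec (enc F) = F" if "F \<subseteq> I" for F
    using inv_into_f_f[OF enc, of F] that by (simp add: dec_def)
  have encD: "enc F \<in> D" if "finite F" "F \<subseteq> I" for F using that by (simp add: D_def)
  have decD: "finite (dec x) \<and> dec x \<subseteq> I" if "x \<in> D" for x
    using that dec_enc by (auto simp: D_def)
  have catJ: "category J" unfolding J_def by (rule category_preorder_cat[OF e]) auto
  interpret J: category J by (rule catJ)
  have J_Obj [simp]: "Obj J = D" by (simp add: J_def)
  have J_Hom: "u \<in> Hom J x y \<longleftrightarrow> x \<in> D \<and> y \<in> D \<and> dec x \<subseteq> dec y \<and> u = e (x, y)" for u x y
    by (simp add: J_def preorder_cat_Hom[OF e])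
  have filJ: "filtered J"
    unfolding J_def
  proof (rule filtered_preorder_cat[OF e])
    show "D \<noteq> {}" using encD[of "{}"] by auto
    fix x y assume "x \<in> D" "y \<in> D"
    then have "enc (dec x \<union> dec y) \<in> D" "dec (enc (dec x \<union> dec y)) = dec x \<union> dec y"
      using encD[of "dec x \<union> dec y"] dec_enc[of "dec x \<union> dec y"] decD by auto
    then show "\<exists>z\<in>D. dec x \<subseteq> dec z \<and> dec y \<subseteq> dec z" by blast
  qed auto
  have smD: "small \<kappa> D"
  proof -
    have "D \<subseteq> enc ` Pow I" by (auto simp: D_def)
    then show ?thesis using small_subset[OF small_image[OF universeD(3)[OF \<kappa> I]]] by metis
  qed
  have smA: "small \<kappa> (Arr J)"
  proof -
    have "Arr J \<subseteq> e ` (D \<times> D)" by (auto simp: J_def preorder_cat_def)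
    then show ?thesis using small_subset[OF small_image[OF small_Times_self[OF \<kappa> smD]]] by metis
  qed
  note s = coproduct_in[OF S]
  have SO: "S \<in> Obj C" using S by (simp add: is_coproduct_def)
  have "\<exists>B t. is_coproduct C (dec x) A B t" if x: "x \<in> D" for x
  proof -
    have "small \<kappa> (dec x) \<and> A ` dec x \<subseteq> Obj C"
      using decD[OF x] small_subset[OF I] A by blast
    then show ?thesis using cop by (simp add: has_small_coproducts_def)
  qed
  then obtain B t where Bt: "\<And>x. x \<in> D \<Longrightarrow> is_coproduct C (dec x) A (B x) (t x)" by metis
  note t = coproduct_in[OF Bt]
  have BO: "B x \<in> Obj C" if "x \<in> D" for x using Bt[OF that] by (simp add: is_coproduct_def)
  \<comment> \<open>The canonical morphism from the coproduct over one finite set to that over a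
    larger one; being determined on summands, it is functorial.\<close>
  define m where "m u = (SOME w. w \<in> Hom C (B (Dom J u)) (B (Cod J u)) \<and>
      (\<forall>i\<in>dec (Dom J u). w \<cdot> t (Dom J u) i = t (Cod J u) i))" for u
  have m: "m u \<in> Hom C (B x) (B y) \<and> (\<forall>i\<in>dec x. m u \<cdot> t x i = t y i)" if u: "u \<in> Hom J x y" for u x y
  proof -
    have xy: "x \<in> D" "y \<in> D" "dec x \<subseteq> dec y" using u by (simp_all add: J_Hom)
    obtain w where "w \<in> Hom C (B x) (B y)" "\<And>i. i \<in> dec x \<Longrightarrow> w \<cdot> t x i = t y i"
      by (rule coproduct_ex1[OF Bt[OF xy(1)] BO[OF xy(2)], of "t y"])
        (use t[OF xy(2)] xy(3) in blast)+
    then have "\<exists>w. w \<in> Hom C (B x) (B y) \<and> (\<forall>i\<in>dec x. w \<cdot> t x i = t y i)" by metis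
    from someI_ex[OF this] show ?thesis using u by (simp add: m_def J.HomD)
  qed
  define F where "F = (\<lparr>omap = B, amap = m\<rparr> :: ('u, 'u, 'o, 'm) ftor)"
  have F: "is_functor J C F"
    unfolding is_functor_def F_def ftor.simps J_Obj
  proof (intro conjI ballI)
    show "B x \<in> Obj C" if "x \<in> D" for x by (rule BO[OF that])
    show "m u \<in> Hom C (B x) (B y)" if "u \<in> Hom J x y" for x y u using m[OF that] by simp
    show "m (Idt J x) = Idt C (B x)" if x: "x \<in> D" for x
    proof (rule coproduct_unique[OF Bt[OF x] _ Idt_in[OF BO[OF x]]])
      have "Idt J x \<in> Hom J x x" using J.Idt_in x by simp
      note mx = m[OF this]
      show "m (Idt J x) \<in> Hom C (B x) (B x)" using mx by simp
      fix i assume i: "i \<in> dec x"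
      show "m (Idt J x) \<cdot> t x i = Idt C (B x) \<cdot> t x i" using mx i Idt_Cmp[OF t[OF x i]] by simp
    qed
    show "m (v \<cdot>\<^bsub>J\<^esub> u) = m v \<cdot> m u"
      if xyz: "x \<in> D" "y \<in> D" "z \<in> D" and u: "u \<in> Hom J x y" and v: "v \<in> Hom J y z"
      for x y z u v
    proof (rule coproduct_unique[OF Bt[OF xyz(1)]])
      note mu = m[OF u] and mv = m[OF v] and mvu = m[OF J.Cmp_in[OF u v]]
      show "m (v \<cdot>\<^bsub>J\<^esub> u) \<in> Hom C (B x) (B z)" using mvu by simp
      show "m v \<cdot> m u \<in> Hom C (B x) (B z)" using mu mv Cmp_in by blast
      fix i assume i: "i \<in> dec x"
      have "i \<in> dec y" using i u by (auto simp: J_Hom)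
      then show "m (v \<cdot>\<^bsub>J\<^esub> u) \<cdot> t x i = m v \<cdot> m u \<cdot> t x i"
        using Cmp_assoc[OF t[OF xyz(1) i] conjunct1[OF mu] conjunct1[OF mv]] mu mv mvu i by simp
    qed
  qed
  have "\<exists>k. k \<in> Hom C (B x) S \<and> (\<forall>i\<in>dec x. k \<cdot> t x i = s i)" if x: "x \<in> D" for x
  proof -
    obtain k where "k \<in> Hom C (B x) S" "\<And>i. i \<in> dec x \<Longrightarrow> k \<cdot> t x i = s i"
      by (rule coproduct_ex1[OF Bt[OF x] SO, of s]) (use s decD[OF x] in blast)+
    then show ?thesis by metis
  qed
  then obtain k where k: "\<And>x. x \<in> D \<Longrightarrow> k x \<in> Hom C (B x) S"
    and kt: "\<And>x i. \<lbrakk>x \<in> D; i \<in> dec x\<rbrakk> \<Longrightarrow> k x \<cdot> t x i = s i" by metis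
  \<comment> \<open>Singletons recover the summands of S from the diagram: the code of {i} lies
    below that of every finite set containing i, so a cocone is determined at i by its component at
    {i}.\<close>
  have sing: "enc {i} \<in> D" "i \<in> dec (enc {i})" if "i \<in> I" for i
    using encD[of "{i}"] dec_enc[of "{i}"] that by auto
  have sing_Hom: "\<exists>u. u \<in> Hom J (enc {i}) x" if "x \<in> D" "i \<in> dec x" for i x
  proof -
    have "i \<in> I" using that decD by blast
    then show ?thesis using dec_enc[of "{i}"] sing(1) that by (simp add: J_Hom)
  qed
  have kF: "k y \<cdot> m u = k x" if u: "u \<in> Hom J x y" for x y u
  proof (rule coproduct_unique[OF Bt _ k])
    show xy: "x \<in> D" "x \<in> D" using u by (simp_all add: J_Hom)
    have y: "y \<in> D" "dec x \<subseteq> dec y" using u by (simp_all add: J_Hom)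
    note mu = m[OF u]
    show "k y \<cdot> m u \<in> Hom C (B x) S" using mu k[OF y(1)] Cmp_in by blast
    fix i assume i: "i \<in> dec x"
    have "k y \<cdot> m u \<cdot> t x i = k y \<cdot> (m u \<cdot> t x i)"
      using Cmp_assoc[OF t[OF xy(1) i] conjunct1[OF mu] k[OF y(1)]] by simp
    also have "\<dots> = k x \<cdot> t x i" using mu i kt[OF y(1)] kt[OF xy(1) i] y(2) by auto
    finally show "k y \<cdot> m u \<cdot> t x i = k x \<cdot> t x i" .
  qed
  have L: "is_colimit J C F S k"
  proof (rule is_colimitI)
    fix T g assume T: "T \<in> Obj C" and "\<And>x. x \<in> Obj J \<Longrightarrow> g x \<in> Hom C (omap F x) T"
      and "\<And>i j u. \<lbrakk>i \<in> Obj J; j \<in> Obj J; u \<in> Hom J i j\<rbrakk> \<Longrightarrow> g j \<cdot> amap F u = g i"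
    then have g: "\<And>x. x \<in> D \<Longrightarrow> g x \<in> Hom C (B x) T"
      and gm: "\<And>x y u. \<lbrakk>x \<in> D; y \<in> D; u \<in> Hom J x y\<rbrakk> \<Longrightarrow> g y \<cdot> m u = g x"
      by (simp_all add: F_def)
    obtain h where h: "h \<in> Hom C S T"
      and hs: "\<And>i. i \<in> I \<Longrightarrow> h \<cdot> s i = g (enc {i}) \<cdot> t (enc {i}) i"
      by (rule coproduct_ex1[OF S T, of "\<lambda>i. g (enc {i}) \<cdot> t (enc {i}) i"])
        (use Cmp_in[OF t[OF sing] g[OF sing(1)]] in blast)+
    have "h \<cdot> k x = g x" if x: "x \<in> D" for x
    proof (rule coproduct_unique[OF Bt[OF x] Cmp_in[OF k[OF x] h] g[OF x]])
      fix i assume i: "i \<in> dec x"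
      have iI: "i \<in> I" using i decD[OF x] by blast
      note si = sing[OF iI]
      obtain u where u: "u \<in> Hom J (enc {i}) x" using sing_Hom[OF x i] by blast
      have "h \<cdot> k x \<cdot> t x i = h \<cdot> s i"
        using Cmp_assoc[OF t[OF x i] k[OF x] h] kt[OF x i] by simp
      also have "\<dots> = g x \<cdot> m u \<cdot> t (enc {i}) i" using hs[OF iI] gm[OF si(1) x u] by simp
      also have "\<dots> = g x \<cdot> t x i"
        using Cmp_assoc[OF t[OF si] conjunct1[OF m[OF u]] g[OF x]] m[OF u] si(2) by simp
      finally show "h \<cdot> k x \<cdot> t x i = g x \<cdot> t x i" .
    qed
    then show "\<exists>h\<in>Hom C S T. \<forall>x\<in>Obj J. h \<cdot> k x = g x" using h by auto
  next
    fix T g h assume g: "g \<in> Hom C S T" and h: "h \<in> Hom C S T"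
      and eq: "\<And>x. x \<in> Obj J \<Longrightarrow> g \<cdot> k x = h \<cdot> k x"
    show "g = h"
    proof (rule coproduct_unique[OF S g h])
      fix i assume i: "i \<in> I"
      note si = sing[OF i]
      show "g \<cdot> s i = h \<cdot> s i"
        using Cmp_assoc[OF t[OF si] k[OF si(1)] g] Cmp_assoc[OF t[OF si] k[OF si(1)] h]
          kt[OF si] eq[of "enc {i}"] si(1) by simp
    qed
  qed (use SO k kF in \<open>simp_all add: F_def\<close>)
  have mono: "is_mono C (f \<cdot> k x)" if x: "x \<in> D" for x
  proof (rule finite_coproduct_mono[OF _ Bt[OF x] Cmp_in[OF k[OF x] f], of p])
    have ft: "f \<cdot> k x \<cdot> t x i = f \<cdot> s i" if i: "i \<in> dec x" for i
      using Cmp_assoc[OF t[OF x i] k[OF x] f] kt[OF x i] by simp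
    show "finite (dec x)" using decD[OF x] by simp
    show "p i \<in> Hom C P (A i)" if "i \<in> dec x" for i using that decD[OF x] p by blast
    show "p i \<cdot> (f \<cdot> k x \<cdot> t x i) = Idt C (A i)" if "i \<in> dec x" for i
      using that decD[OF x] diag ft by auto
    show "zero_mor C (p j \<cdot> (f \<cdot> k x \<cdot> t x i))" if "i \<in> dec x" "j \<in> dec x" "i \<noteq> j" for i j
      using that decD[OF x] off[of i j] ft by auto
  qed
  show ?thesis
  proof (rule filtered_colimit_mono[OF ex catJ filJ _ smA F Hom_Obj(2)[OF f] _ _ _ L f])
    show "small \<kappa> (Obj J)" using smD by simp
    show "f \<cdot> k j \<in> Hom C (omap F j) P" if "j \<in> Obj J" for j
      using that Cmp_in[OF k f] by (simp add: F_def)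
    show "is_mono C (f \<cdot> k j)" if "j \<in> Obj J" for j using that mono by simp
    show "f \<cdot> k j \<cdot> amap F u = f \<cdot> k i" if "i \<in> Obj J" "j \<in> Obj J" and u: "u \<in> Hom J i j" for i j u
      using that Cmp_assoc[OF conjunct1[OF m[OF u]] k f] kF[OF u] by (simp add: F_def)
  qed simp
qed

end

section \<open>The adjunction of a Gabriel quotient\<close>

context category
begin

section \<open>Closure of weakly closed subcategories\<close>

lemma weakly_closed_mono:
  "\<lbrakk>weakly_closed \<kappa> C Z; is_mono C f; f \<in> Hom C a b; b \<in> Z\<rbrakk> \<Longrightarrow> a \<in> Z"
  unfolding weakly_closed_def by (metis Hom_DomD Hom_CodD)

lemma weakly_closed_epi:
  "\<lbrakk>weakly_closed \<kappa> C Z; is_epi C f; f \<in> Hom C a b; a \<in> Z\<rbrakk> \<Longrightarrow> b \<in> Z"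
  unfolding weakly_closed_def by (metis Hom_DomD Hom_CodD)

lemma weakly_closed_iso: "\<lbrakk>weakly_closed \<kappa> C Z; isomorphic C a b; a \<in> Z\<rbrakk> \<Longrightarrow> b \<in> Z"
  unfolding isomorphic_def using weakly_closed_epi iso_epi by metis

lemma weakly_closed_coproduct:
  fixes I :: "'u set" and \<kappa> :: "'u rel"
  shows "\<lbrakk>weakly_closed \<kappa> C Z; small \<kappa> I; A ` I \<subseteq> Z; is_coproduct C I A S s\<rbrakk> \<Longrightarrow> S \<in> Z"
  unfolding weakly_closed_def by blast

lemma weakly_closed_Obj: "weakly_closed \<kappa> C Z \<Longrightarrow> a \<in> Z \<Longrightarrow> a \<in> Obj C"
  unfolding weakly_closed_def by blast

end

locale gabriel = abelian_category X
  for X :: "('o, 'm) cat" (structure) +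
  fixes \<kappa> :: "'u rel" and Y :: "'o set" and Q :: "('o, 'n) cat"
    and \<pi> :: "('o, 'm, 'o, 'n) ftor" and \<omega> :: "('o, 'n, 'o, 'm) ftor"
  assumes universe: "universe \<kappa>"
    and loc: "localizing \<kappa> X Y"
    and quot: "gabriel_quotient X Y Q \<pi>"
    and adj: "right_adjoint X Q \<pi> \<omega>"

sublocale gabriel \<subseteq> Q: category Q
  using quot by (simp add: gabriel_quotient_def)

context gabriel
begin

section \<open>The adjoint functors, their unit and counit\<close>

lemma Obj_Q [simp]: "Obj Q = Obj X"
  using quot by (simp add: gabriel_quotient_def)

lemma pi_Obj [simp]: "a \<in> Obj X \<Longrightarrow> omap \<pi> a = a"
  using quot by (simp add: gabriel_quotient_def)

lemma pi_Hom: "f \<in> Hom X a b \<Longrightarrow> amap \<pi> f \<in> Hom Q a b"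
  using quot Hom_Obj[of f a b] by (auto simp: gabriel_quotient_def is_functor_def)

lemma pi_Idt: "a \<in> Obj X \<Longrightarrow> amap \<pi> (Idt X a) = Idt Q a"
  using quot by (auto simp: gabriel_quotient_def is_functor_def)

lemma pi_Cmp: "\<lbrakk>f \<in> Hom X a b; g \<in> Hom X b c\<rbrakk> \<Longrightarrow> amap \<pi> (g \<cdot> f) = amap \<pi> g \<cdot>\<^bsub>Q\<^esub> amap \<pi> f"
  using quot Hom_Obj[of f a b] Hom_Obj[of g b c] unfolding gabriel_quotient_def is_functor_def
  by blast

lemma om_functor: "is_functor Q X \<omega>"
  using adj by (simp add: right_adjoint_def)

lemma om_Obj: "a \<in> Obj X \<Longrightarrow> omap \<omega> a \<in> Obj X"
  using om_functor by (simp add: is_functor_def)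

lemma om_Hom: "f \<in> Hom Q a b \<Longrightarrow> amap \<omega> f \<in> Hom X (omap \<omega> a) (omap \<omega> b)"
  using om_functor Q.Hom_Obj[of f a b] by (simp add: is_functor_def)

lemma om_Idt: "a \<in> Obj X \<Longrightarrow> amap \<omega> (Idt Q a) = Idt X (omap \<omega> a)"
  using om_functor by (simp add: is_functor_def)

lemma om_Cmp: "\<lbrakk>f \<in> Hom Q a b; g \<in> Hom Q b c\<rbrakk> \<Longrightarrow> amap \<omega> (g \<cdot>\<^bsub>Q\<^esub> f) = amap \<omega> g \<cdot> amap \<omega> f"
  using om_functor Q.Hom_Obj[of f a b] Q.Hom_Obj[of g b c] unfolding is_functor_def by blast

text \<open>The hom-bijections \<phi> are recovered from \<eta> a, the value of \<phi> at the
  identity of a: naturality in the target gives \<phi> h = \<omega> h . \<eta> a, and naturality in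
  the source makes \<eta> natural. As \<pi> fixes objects, \<eta> a goes from a to \<omega>
  a.\<close>

lemma ex_unit:
  "\<exists>\<eta>. (\<forall>a\<in>Obj X. \<eta> a \<in> Hom X a (omap \<omega> a)) \<and>
     (\<forall>a b u. u \<in> Hom X a b \<longrightarrow> amap \<omega> (amap \<pi> u) \<cdot> \<eta> a = \<eta> b \<cdot> u) \<and>
     (\<forall>a\<in>Obj X. \<forall>b\<in>Obj X. bij_betw (\<lambda>h. amap \<omega> h \<cdot> \<eta> a) (Hom Q a b) (Hom X a (omap \<omega> b)))"
proof -
  obtain \<phi> where bij0: "\<forall>a\<in>Obj X. \<forall>b\<in>Obj Q.
         bij_betw (\<phi> a b) (Hom Q (omap \<pi> a) b) (Hom X a (omap \<omega> b))"
    and nat0: "\<forall>a \<in> Obj X. \<forall>a' \<in> Obj X. \<forall>b \<in> Obj Q. \<forall>b' \<in> Obj Q.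
       \<forall>u \<in> Hom X a' a. \<forall>v \<in> Hom Q b b'. \<forall>h \<in> Hom Q (omap \<pi> a) b.
         \<phi> a' b' (v \<cdot>\<^bsub>Q\<^esub> (h \<cdot>\<^bsub>Q\<^esub> amap \<pi> u)) = amap \<omega> v \<cdot> (\<phi> a b h \<cdot> u)"
    using adj unfolding right_adjoint_def by blast
  have bij: "bij_betw (\<phi> a b) (Hom Q a b) (Hom X a (omap \<omega> b))"
    if "a \<in> Obj X" "b \<in> Obj X" for a b
    using bij0 that by simp
  have nat: "\<phi> a' b' (v \<cdot>\<^bsub>Q\<^esub> (h \<cdot>\<^bsub>Q\<^esub> amap \<pi> u)) = amap \<omega> v \<cdot> (\<phi> a b h \<cdot> u)"
    if "u \<in> Hom X a' a" "v \<in> Hom Q b b'" "h \<in> Hom Q a b" for a a' b b' u v h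
    using nat0 that Hom_Obj[OF that(1)] Q.Hom_Obj[OF that(2)] by simp
  define \<eta> where "\<eta> a = \<phi> a a (Idt Q a)" for a
  have \<eta>: "\<eta> a \<in> Hom X a (omap \<omega> a)" if a: "a \<in> Obj X" for a
    using bij_betwE[OF bij[OF a a]] Q.Idt_in[of a] a by (simp add: \<eta>_def)
  have \<phi>: "\<phi> a b h = amap \<omega> h \<cdot> \<eta> a" if h: "h \<in> Hom Q a b" for a b h
  proof -
    have a: "a \<in> Obj X" using Q.Hom_Obj[OF h] by simp
    then have ia: "Idt Q a \<in> Hom Q a a" using Q.Idt_in by simp
    show ?thesis
      using nat[OF Idt_in[OF a] h ia] pi_Idt[OF a] Q.Idt_Cmp[OF ia] Q.Cmp_Idt[OF h]
        Cmp_Idt[OF \<eta>[OF a]] by (simp add: \<eta>_def)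
  qed
  have "amap \<omega> (amap \<pi> u) \<cdot> \<eta> a = \<eta> b \<cdot> u" if u: "u \<in> Hom X a b" for a b u
  proof -
    have b: "b \<in> Obj X" using Hom_Obj[OF u] by simp
    then have ib: "Idt Q b \<in> Hom Q b b" using Q.Idt_in by simp
    show ?thesis
      using nat[OF u ib ib] \<phi>[OF pi_Hom[OF u]] Q.Idt_Cmp[OF pi_Hom[OF u]] om_Idt[OF b]
        Idt_Cmp[OF Cmp_in[OF u \<eta>[OF b]]] by (simp add: \<eta>_def)
  qed
  moreover have "bij_betw (\<lambda>h. amap \<omega> h \<cdot> \<eta> a) (Hom Q a b) (Hom X a (omap \<omega> b))"
    if "a \<in> Obj X" "b \<in> Obj X" for a b
    using bij[OF that] bij_betw_cong[of "Hom Q a b" "\<phi> a b" "\<lambda>h. amap \<omega> h \<cdot> \<eta> a"] \<phi> by blast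
  ultimately show ?thesis using \<eta> by blast
qed

text \<open>The assumption is only that some adjunction exists; one is chosen here for good.\<close>

definition unit :: "'o \<Rightarrow> 'm" (\<open>\<eta>\<close>) where
  "unit = (SOME n. (\<forall>a\<in>Obj X. n a \<in> Hom X a (omap \<omega> a)) \<and>
     (\<forall>a b u. u \<in> Hom X a b \<longrightarrow> amap \<omega> (amap \<pi> u) \<cdot> n a = n b \<cdot> u) \<and>
     (\<forall>a\<in>Obj X. \<forall>b\<in>Obj X. bij_betw (\<lambda>h. amap \<omega> h \<cdot> n a) (Hom Q a b) (Hom X a (omap \<omega> b))))"

lemma unit_Hom: "a \<in> Obj X \<Longrightarrow> \<eta> a \<in> Hom X a (omap \<omega> a)"
  and unit_natural: "u \<in> Hom X a b \<Longrightarrow> amap \<omega> (amap \<pi> u) \<cdot> \<eta> a = \<eta> b \<cdot> u"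
  and unit_bij: "\<lbrakk>a \<in> Obj X; b \<in> Obj X\<rbrakk>
    \<Longrightarrow> bij_betw (\<lambda>h. amap \<omega> h \<cdot> \<eta> a) (Hom Q a b) (Hom X a (omap \<omega> b))"
  using someI_ex[OF ex_unit, folded unit_def] by blast+

text \<open>The passage from morphisms of X to morphisms of X/Y under the adjunction;
  \<open>unit_bij\<close> makes it a genuine inverse.\<close>

definition transpose :: "'o \<Rightarrow> 'o \<Rightarrow> 'm \<Rightarrow> 'n" where
  "transpose a b = inv_into (Hom Q a b) (\<lambda>h. amap \<omega> h \<cdot> \<eta> a)"

lemma transpose:
  assumes a: "a \<in> Obj X" and b: "b \<in> Obj X" and g: "g \<in> Hom X a (omap \<omega> b)"
  shows "transpose a b g \<in> Hom Q a b" "amap \<omega> (transpose a b g) \<cdot> \<eta> a = g"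
proof -
  have im: "g \<in> (\<lambda>h. amap \<omega> h \<cdot> \<eta> a) ` Hom Q a b"
    using g bij_betw_imp_surj_on[OF unit_bij[OF a b]] by simp
  show "transpose a b g \<in> Hom Q a b" unfolding transpose_def by (rule inv_into_into[OF im])
  show "amap \<omega> (transpose a b g) \<cdot> \<eta> a = g"
    using f_inv_into_f[OF im] by (simp add: transpose_def)
qed

lemma unit_cancel:
  assumes h: "h \<in> Hom Q a b" and h': "h' \<in> Hom Q a b"
    and eq: "amap \<omega> h \<cdot> \<eta> a = amap \<omega> h' \<cdot> \<eta> a"
  shows "h = h'"
proof -
  have ab: "a \<in> Obj X" "b \<in> Obj X" using Q.Hom_Obj[OF h] by simp_all
  show ?thesis by (rule inj_onD[OF bij_betw_imp_inj_on[OF unit_bij[OF ab]] eq h h'])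
qed

lemma om_unit_Hom: "h \<in> Hom Q a b \<Longrightarrow> amap \<omega> h \<cdot> \<eta> a \<in> Hom X a (omap \<omega> b)"
  using Cmp_in[OF unit_Hom om_Hom] Q.Hom_Obj(1) by simp

lemma transpose_eqI:
  assumes "h \<in> Hom Q a b" "amap \<omega> h \<cdot> \<eta> a = g"
  shows "transpose a b g = h"
proof (rule unit_cancel[OF _ assms(1)])
  have ab: "a \<in> Obj X" "b \<in> Obj X" using Q.Hom_Obj[OF assms(1)] by simp_all
  have g: "g \<in> Hom X a (omap \<omega> b)" using om_unit_Hom[OF assms(1)] assms(2) by simp
  show "transpose a b g \<in> Hom Q a b" "amap \<omega> (transpose a b g) \<cdot> \<eta> a = amap \<omega> h \<cdot> \<eta> a"
    using transpose[OF ab g] assms(2) by simp_all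
qed

lemma transpose_pi:
  assumes u: "u \<in> Hom X a a'" and b: "b \<in> Obj X" and g: "g \<in> Hom X a' (omap \<omega> b)"
  shows "transpose a b (g \<cdot> u) = transpose a' b g \<cdot>\<^bsub>Q\<^esub> amap \<pi> u"
proof (rule transpose_eqI)
  have a: "a \<in> Obj X" "a' \<in> Obj X" using Hom_Obj[OF u] .
  note t = transpose[OF a(2) b g]
  show "transpose a' b g \<cdot>\<^bsub>Q\<^esub> amap \<pi> u \<in> Hom Q a b" by (rule Q.Cmp_in[OF pi_Hom[OF u] t(1)])
  have "amap \<omega> (transpose a' b g \<cdot>\<^bsub>Q\<^esub> amap \<pi> u) \<cdot> \<eta> a
      = amap \<omega> (transpose a' b g) \<cdot> (amap \<omega> (amap \<pi> u) \<cdot> \<eta> a)"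
    using om_Cmp[OF pi_Hom[OF u] t(1)]
      Cmp_assoc[OF unit_Hom[OF a(1)] om_Hom[OF pi_Hom[OF u]] om_Hom[OF t(1)]] by simp
  also have "\<dots> = g \<cdot> u"
    using unit_natural[OF u] Cmp_assoc[OF u unit_Hom[OF a(2)] om_Hom[OF t(1)]] t(2) by simp
  finally show "amap \<omega> (transpose a' b g \<cdot>\<^bsub>Q\<^esub> amap \<pi> u) \<cdot> \<eta> a = g \<cdot> u" .
qed

lemma transpose_om:
  assumes a: "a \<in> Obj X" and v: "v \<in> Hom Q b b'" and g: "g \<in> Hom X a (omap \<omega> b)"
  shows "transpose a b' (amap \<omega> v \<cdot> g) = v \<cdot>\<^bsub>Q\<^esub> transpose a b g"
proof (rule transpose_eqI)
  have b: "b \<in> Obj X" using Q.Hom_Obj[OF v] by simp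
  note t = transpose[OF a b g]
  show "v \<cdot>\<^bsub>Q\<^esub> transpose a b g \<in> Hom Q a b'" by (rule Q.Cmp_in[OF t(1) v])
  show "amap \<omega> (v \<cdot>\<^bsub>Q\<^esub> transpose a b g) \<cdot> \<eta> a = amap \<omega> v \<cdot> g"
    using om_Cmp[OF t(1) v] Cmp_assoc[OF unit_Hom[OF a] om_Hom[OF t(1)] om_Hom[OF v]] t(2) by simp
qed

lemma transpose_cancel:
  assumes "a \<in> Obj X" "b \<in> Obj X" "g \<in> Hom X a (omap \<omega> b)" "g' \<in> Hom X a (omap \<omega> b)"
    "transpose a b g = transpose a b g'"
  shows "g = g'"
  using transpose(2)[OF assms(1-3)] transpose(2)[OF assms(1,2,4)] assms(5) by metis

definition counit :: "'o \<Rightarrow> 'n" (\<open>\<epsilon>\<close>) where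
  "counit b = transpose (omap \<omega> b) b (Idt X (omap \<omega> b))"

lemma counit_Hom: "b \<in> Obj X \<Longrightarrow> \<epsilon> b \<in> Hom Q (omap \<omega> b) b"
  unfolding counit_def using transpose(1)[OF om_Obj _ Idt_in[OF om_Obj]] by simp

lemma transpose_counit:
  assumes a: "a \<in> Obj X" and b: "b \<in> Obj X" and g: "g \<in> Hom X a (omap \<omega> b)"
  shows "transpose a b g = \<epsilon> b \<cdot>\<^bsub>Q\<^esub> amap \<pi> g"
  using transpose_pi[OF g b Idt_in[OF om_Obj[OF b]]] Idt_Cmp[OF g] by (simp add: counit_def)

lemma counit_natural:
  assumes f: "f \<in> Hom Q a b"
  shows "f \<cdot>\<^bsub>Q\<^esub> \<epsilon> a = \<epsilon> b \<cdot>\<^bsub>Q\<^esub> amap \<pi> (amap \<omega> f)"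
proof -
  have ab: "a \<in> Obj X" "b \<in> Obj X" using Q.Hom_Obj[OF f] by simp_all
  note i = Idt_in[OF om_Obj[OF ab(1)]]
  show ?thesis
    using transpose_om[OF om_Obj[OF ab(1)] f i] Cmp_Idt[OF om_Hom[OF f]]
      transpose_counit[OF om_Obj[OF ab(1)] ab(2) om_Hom[OF f]] by (simp add: counit_def)
qed

section \<open>Objects of Y and torsionfree objects\<close>

lemma weakly_closed_Y: "weakly_closed \<kappa> X Y"
  using loc by (simp add: localizing_def)

lemma Y_extension_mono:
  assumes f: "f \<in> Hom X a b" "is_mono X f" and q: "is_cokernel X f q" and Y: "a \<in> Y" "Cod X q \<in> Y"
  shows "b \<in> Y"
proof -
  have "short_exact X f q" using mono_kernel_cokernel[OF f(2,1) q] q by (simp add: short_exact_def)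
  then have "Cod X f \<in> Y" using loc Y f(1) unfolding localizing_def by (metis Hom_DomD)
  then show ?thesis using f(1) by (simp add: HomD)
qed

lemma Y_extension_epi:
  assumes f: "f \<in> Hom X b c" "is_epi X f" and k: "is_kernel X f k" and Y: "c \<in> Y" "Dom X k \<in> Y"
  shows "b \<in> Y"
proof -
  have "short_exact X k f" using epi_cokernel_kernel[OF f(2,1) k] k by (simp add: short_exact_def)
  then have "Cod X k \<in> Y" using loc Y f(1) unfolding localizing_def by (metis Hom_CodD)
  then show ?thesis using kernelD(1)[OF k f(1)] by (simp add: HomD)
qed

text \<open>A zero object is the coproduct of the empty family.\<close>

lemma zero_object_Y:
  assumes z: "zero_object X z" shows "z \<in> Y"
proof (rule weakly_closed_coproduct[OF weakly_closed_Y])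
  show "small \<kappa> ({} :: 'u set)" by (rule small_finite[OF universe]) simp
  show "is_coproduct X ({} :: 'u set) (\<lambda>_. z) z (\<lambda>_. Idt X z)"
  proof (rule is_coproductI)
    show "z \<in> Obj X" by (rule zero_object_Obj[OF z])
    show "\<exists>h\<in>Hom X z T. \<forall>i\<in>{}. h \<cdot> Idt X z = g i" if "T \<in> Obj X" for T and g :: "'u \<Rightarrow> 'm"
      using zero_objectD(2)[OF z that] by simp
    show "g = h" if "g \<in> Hom X z T" "h \<in> Hom X z T" for T g h
      using zero_objectD(4)[OF z Hom_Obj(2)] that by blast
  qed auto
qed simp

text \<open>The image of a morphism K -> M with K in Y is a quotient of K, so it is a subobject of M
  in Y and lies in \<tau>(M). Conversely, if all these morphisms vanish, zero is the largest
  subobject in Y. The criterion avoids \<tau> and speaks of morphisms only.\<close>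

lemma torsionfree_iff:
  "torsionfree X Y M \<longleftrightarrow> M \<in> Obj X \<and> (\<forall>K f. K \<in> Y \<and> f \<in> Hom X K M \<longrightarrow> zero_mor X f)"
proof (intro iffI conjI allI impI)
  assume "torsionfree X Y M"
  then show "M \<in> Obj X" by (simp add: torsionfree_def)
  from \<open>torsionfree X Y M\<close> obtain t where t: "torsion_part X Y M t" "zero_object X (Dom X t)"
    by (auto simp: torsionfree_def)
  have th: "t \<in> Hom X (Dom X t) M" using t(1) by (simp add: torsion_part_def is_mono_def Hom_def)
  fix K f assume Kf: "K \<in> Y \<and> f \<in> Hom X K M"
  then have f: "f \<in> Hom X K M" by simp
  obtain c m e where m: "m \<in> Hom X c M" "is_mono X m" and e: "e \<in> Hom X K c" "is_epi X e"
    and me: "m \<cdot> e = f"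
    by (rule image_factorization[OF f])
  have "c \<in> Y" using weakly_closed_epi[OF weakly_closed_Y e(2,1)] Kf by simp
  then have "Dom X m \<in> Y" "Cod X m = M" using m(1) by (simp_all add: HomD)
  then have "\<exists>h\<in>Hom X (Dom X m) (Dom X t). t \<cdot> h = m"
    using t(1) m(2) unfolding torsion_part_def by blast
  then obtain h where h: "h \<in> Hom X c (Dom X t)" "t \<cdot> h = m" using m(1) by (auto simp: HomD)
  have "zero_mor X m"
    using zero_Cmp_left[OF zero_mor_from_zero[OF t(2) th] h(1) th] h(2) by simp
  then show "zero_mor X f" using zero_Cmp_left[OF _ e(1) m(1)] me by simp
next
  assume R: "M \<in> Obj X \<and> (\<forall>K f. K \<in> Y \<and> f \<in> Hom X K M \<longrightarrow> zero_mor X f)"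
  obtain z where z: "zero_object X z" using ex_zero_object by blast
  have zO: "z \<in> Obj X" by (rule zero_object_Obj[OF z])
  obtain t where t: "t \<in> Hom X z M" using zero_objectD(2)[OF z] R by blast
  have "is_mono X t" by (rule monoI[OF t]) (use zero_objectD(3)[OF z Hom_Obj(1)] in blast)
  moreover have "\<exists>h\<in>Hom X (Dom X s) z. t \<cdot> h = s" if s: "is_mono X s" "Cod X s = M" "Dom X s \<in> Y" for s
  proof -
    have sh: "s \<in> Hom X (Dom X s) M" using s by (auto simp: is_mono_def Hom_def)
    then have zs: "zero_mor X s" using R s by blast
    obtain h where h: "h \<in> Hom X (Dom X s) z" using zero_objectD(1)[OF z Hom_Obj(1)[OF sh]] by blast
    have "t \<cdot> h = s"
      by (rule zero_mor_unique[OF zero_morI[OF z h t] Cmp_in[OF h t] zs sh])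
    then show ?thesis using h by blast
  qed
  ultimately have "torsion_part X Y M t"
    using zero_object_Y[OF z] t by (simp add: torsion_part_def HomD)
  then show "torsionfree X Y M" using R z t by (auto simp: torsionfree_def HomD)
qed

lemma torsionfree_mono:
  assumes "torsionfree X Y b" "f \<in> Hom X a b" "is_mono X f"
  shows "torsionfree X Y a"
  using assms mono_zeroD[OF assms(3,2)] Cmp_in[OF _ assms(2)] Hom_Obj(1)[OF assms(2)]
  unfolding torsionfree_iff by blast

lemma torsionfree_product:
  assumes P: "is_product X I A P p" and A: "\<And>i. i \<in> I \<Longrightarrow> torsionfree X Y (A i)"
  shows "torsionfree X Y P"
  unfolding torsionfree_iff
proof (intro conjI allI impI)
  show PO: "P \<in> Obj X" using P by (simp add: is_product_def)
  fix K f assume "K \<in> Y \<and> f \<in> Hom X K P"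
  then have K: "K \<in> Y" and f: "f \<in> Hom X K P" by auto
  obtain z where z: "z \<in> Hom X K P" "zero_mor X z" using ex_zero_mor Hom_Obj[OF f] by blast
  have "f = z"
  proof (rule product_unique[OF P f z(1)])
    fix i assume i: "i \<in> I"
    note pi = product_in[OF P i]
    show "p i \<cdot> f = p i \<cdot> z"
      using zero_mor_unique[OF _ Cmp_in[OF f pi] zero_Cmp_right[OF z(2,1) pi] Cmp_in[OF z(1) pi]]
        A[OF i] K Cmp_in[OF f pi] unfolding torsionfree_iff by blast
  qed
  then show "zero_mor X f" using z by simp
qed

section \<open>Morphisms inverted by \<pi>, and objects of the form \<omega> b\<close>

lemma pi_dense_mono: "dense_mono X Y i \<Longrightarrow> is_iso Q (amap \<pi> i)"
  using quot by (simp add: gabriel_quotient_def)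

lemma pi_torsion_epi: "torsion_epi X Y p \<Longrightarrow> is_iso Q (amap \<pi> p)"
  using quot by (simp add: gabriel_quotient_def)

text \<open>For K in Y, the morphism from K to a zero object z is a torsion epimorphism, so \<pi>
  inverts it. A morphism K -> \<omega> b transposes to K -> b in X/Y, hence is governed by a
  morphism z -> b, and there is only one such, because z has just one morphism to \<omega> b in
  X.\<close>

lemma torsionfree_om:
  assumes b: "b \<in> Obj X"
  shows "torsionfree X Y (omap \<omega> b)"
  unfolding torsionfree_iff
proof (intro conjI allI impI om_Obj[OF b])
  fix K f assume "K \<in> Y \<and> f \<in> Hom X K (omap \<omega> b)"
  then have K: "K \<in> Y" and f: "f \<in> Hom X K (omap \<omega> b)" by auto
  have KO: "K \<in> Obj X" using Hom_Obj f by blast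
  obtain f0 where f0: "f0 \<in> Hom X K (omap \<omega> b)" "zero_mor X f0"
    using ex_zero_mor Hom_Obj[OF f] by blast
  obtain z where z: "zero_object X z" using ex_zero_object by blast
  obtain t where t: "t \<in> Hom X K z" using zero_objectD(1)[OF z KO] by blast
  have "is_epi X t" by (rule epiI[OF t]) (use zero_objectD(4)[OF z Hom_Obj(2)] in blast)
  moreover have "is_kernel X t (Idt X K)"
  proof (rule is_kernelI[OF t Idt_in[OF KO] _ mono_Idt[OF KO]])
    show "zero_mor X (t \<cdot> Idt X K)" using zero_mor_to_zero[OF z t] Cmp_Idt[OF t] by simp
    show "\<exists>h\<in>Hom X d K. Idt X K \<cdot> h = g" if "g \<in> Hom X d K" for d g
      using Idt_Cmp[OF that] that by blast
  qed
  ultimately have "torsion_epi X Y t"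
    using K Idt_in[OF KO] by (auto simp: torsion_epi_def HomD)
  from pi_torsion_epi[OF this] obtain s where s: "s \<in> Hom Q z K" "s \<cdot>\<^bsub>Q\<^esub> amap \<pi> t = Idt Q K"
    by (rule Q.isoE[OF _ pi_Hom[OF t]])
  have zO: "z \<in> Obj X" by (rule zero_object_Obj[OF z])
  define g where "g = transpose K b f"
  define g0 where "g0 = transpose K b f0"
  have g: "g \<in> Hom Q K b" and g0: "g0 \<in> Hom Q K b"
    unfolding g_def g0_def using transpose(1)[OF KO b] f f0 by auto
  have "g \<cdot>\<^bsub>Q\<^esub> s = g0 \<cdot>\<^bsub>Q\<^esub> s"
    using unit_cancel[OF Q.Cmp_in[OF s(1) g] Q.Cmp_in[OF s(1) g0]]
      zero_objectD(4)[OF z om_Obj[OF b] om_unit_Hom[OF Q.Cmp_in[OF s(1) g]]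
        om_unit_Hom[OF Q.Cmp_in[OF s(1) g0]]] by simp
  then have "g = g0"
    using Q.Cmp_assoc[OF pi_Hom[OF t] s(1) g] Q.Cmp_assoc[OF pi_Hom[OF t] s(1) g0] s(2)
      Q.Cmp_Idt[OF g] Q.Cmp_Idt[OF g0] by simp
  then have "f = f0" using transpose_cancel[OF KO b f f0(1)] by (simp add: g_def g0_def)
  then show "zero_mor X f" using f0 by simp
qed

text \<open>Since \<pi> i is invertible, the transpose of g extends along it in X/Y; transposing
  back gives f.\<close>

lemma extend_dense:
  assumes i: "dense_mono X Y i" "i \<in> Hom X a a'" and b: "b \<in> Obj X" and g: "g \<in> Hom X a (omap \<omega> b)"
  obtains f where "f \<in> Hom X a' (omap \<omega> b)" "f \<cdot> i = g"
proof -
  have a: "a \<in> Obj X" "a' \<in> Obj X" using Hom_Obj[OF i(2)] .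
  obtain s where s: "s \<in> Hom Q a' a" "s \<cdot>\<^bsub>Q\<^esub> amap \<pi> i = Idt Q a"
    by (rule Q.isoE[OF pi_dense_mono[OF i(1)] pi_Hom[OF i(2)]])
  note t = transpose[OF a(1) b g]
  define h where "h = transpose a b g \<cdot>\<^bsub>Q\<^esub> s"
  have h: "h \<in> Hom Q a' b" unfolding h_def by (rule Q.Cmp_in[OF s(1) t(1)])
  have hi: "h \<cdot>\<^bsub>Q\<^esub> amap \<pi> i = transpose a b g"
    using Q.Cmp_assoc[OF pi_Hom[OF i(2)] s(1) t(1)] s(2) Q.Cmp_Idt[OF t(1)] by (simp add: h_def)
  have "amap \<omega> h \<cdot> \<eta> a' \<cdot> i = amap \<omega> h \<cdot> (amap \<omega> (amap \<pi> i) \<cdot> \<eta> a)"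
    using Cmp_assoc[OF i(2) unit_Hom[OF a(2)] om_Hom[OF h]] unit_natural[OF i(2)] by simp
  also have "\<dots> = amap \<omega> (h \<cdot>\<^bsub>Q\<^esub> amap \<pi> i) \<cdot> \<eta> a"
    using Cmp_assoc[OF unit_Hom[OF a(1)] om_Hom[OF pi_Hom[OF i(2)]] om_Hom[OF h]]
      om_Cmp[OF pi_Hom[OF i(2)] h] by simp
  also have "\<dots> = g" using hi t(2) by simp
  finally show ?thesis using that[OF om_unit_Hom[OF h]] by simp
qed

text \<open>A torsion epimorphism out of a torsionfree object is invertible, so a morphism
  into \<open>\<omega> b\<close> has a representative defined on a dense subobject, which extends.\<close>

lemma pi_full:
  assumes b: "b \<in> Obj X" and h: "h \<in> Hom Q a (omap \<omega> b)"
  obtains f where "f \<in> Hom X a (omap \<omega> b)" "amap \<pi> f = h"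
proof -
  have a: "a \<in> Obj X" using Q.Hom_Obj[OF h] by simp
  obtain t where t: "t \<in> gabriel_triples X Y a (omap \<omega> b)" "represents Q \<pi> t h"
    using quot h a om_Obj[OF b] unfolding gabriel_quotient_def by blast
  obtain i p f where ipf: "t = (i, p, f)" by (cases t)
  have i: "dense_mono X Y i" and p: "torsion_epi X Y p" and f: "f \<in> Hom X (Dom X i) (Cod X p)"
    and ic: "Cod X i = a" and pd: "Dom X p = omap \<omega> b"
    using t(1) by (auto simp: ipf gabriel_triples_def)
  have ih: "i \<in> Hom X (Dom X i) a" using i ic by (auto simp: dense_mono_def is_mono_def Hom_def)
  have ph: "p \<in> Hom X (omap \<omega> b) (Cod X p)"
    using p pd by (auto simp: torsion_epi_def is_epi_def Hom_def)
  have rep: "amap \<pi> p \<cdot>\<^bsub>Q\<^esub> (h \<cdot>\<^bsub>Q\<^esub> amap \<pi> i) = amap \<pi> f"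
    using t(2) by (simp add: ipf represents_def)
  obtain k where k: "is_kernel X p k" "Dom X k \<in> Y" using p by (auto simp: torsion_epi_def)
  note kD = kernelD[OF k(1) ph]
  have zk: "zero_mor X k" using torsionfree_om[OF b] k(2) kD(1) unfolding torsionfree_iff by blast
  have "is_mono X p"
  proof (rule mono_zeroI[OF ph])
    fix c g assume g: "g \<in> Hom X c (omap \<omega> b)" and z: "zero_mor X (p \<cdot> g)"
    obtain w where "w \<in> Hom X c (Dom X k)" "k \<cdot> w = g" using kD(4)[OF g z] by blast
    then show "zero_mor X g" using zero_Cmp_left[OF zk _ kD(1)] by blast
  qed
  then have "is_iso X p" using mono_epi_iso[OF _ _ ph] p by (simp add: torsion_epi_def)
  then obtain p' where p': "p' \<in> Hom X (Cod X p) (omap \<omega> b)" "p' \<cdot> p = Idt X (omap \<omega> b)"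
    by (rule isoE[OF _ ph])
  obtain f' where f': "f' \<in> Hom X a (omap \<omega> b)" "f' \<cdot> i = p' \<cdot> f"
    by (rule extend_dense[OF i ih b Cmp_in[OF f p'(1)]])
  note Pi = pi_Hom[OF ih] and Pp = pi_Hom[OF ph] and Pp' = pi_Hom[OF p'(1)]
  have hi: "h \<cdot>\<^bsub>Q\<^esub> amap \<pi> i \<in> Hom Q (Dom X i) (omap \<omega> b)" by (rule Q.Cmp_in[OF Pi h])
  have "amap \<pi> f' \<cdot>\<^bsub>Q\<^esub> amap \<pi> i = amap \<pi> p' \<cdot>\<^bsub>Q\<^esub> amap \<pi> f"
    using pi_Cmp[OF ih f'(1)] pi_Cmp[OF f p'(1)] f'(2) by simp
  also have "\<dots> = amap \<pi> p' \<cdot>\<^bsub>Q\<^esub> amap \<pi> p \<cdot>\<^bsub>Q\<^esub> (h \<cdot>\<^bsub>Q\<^esub> amap \<pi> i)"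
    using Q.Cmp_assoc[OF hi Pp Pp'] rep by simp
  also have "\<dots> = h \<cdot>\<^bsub>Q\<^esub> amap \<pi> i"
    using pi_Cmp[OF ph p'(1)] p'(2) pi_Idt[OF om_Obj[OF b]] Q.Idt_Cmp[OF hi] by simp
  finally have "amap \<pi> f' = h"
    using Q.epi_cancel[OF Q.iso_epi[OF pi_dense_mono[OF i]] Pi pi_Hom[OF f'(1)] h] by simp
  then show ?thesis using that f'(1) by blast
qed

text \<open>A triangle identity provides the right inverse s, the image of the unit under \<pi>. It
  is also a left inverse because \<epsilon> b can be cancelled in front of endomorphisms of \<omega>
  b in X/Y: by \<open>pi_full\<close> these are of the form \<pi> f, and \<epsilon> b . \<pi> f is
  the transpose of f, which determines f.\<close>

lemma counit_iso:
  assumes b: "b \<in> Obj X" shows "is_iso Q (\<epsilon> b)"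
proof -
  note e = counit_Hom[OF b]
  have bi: "Idt Q b \<in> Hom Q b b" using Q.Idt_in b by simp
  have wi: "Idt Q (omap \<omega> b) \<in> Hom Q (omap \<omega> b) (omap \<omega> b)" using Q.Idt_in om_Obj[OF b] by simp
  define s where "s = amap \<pi> (amap \<omega> (Idt Q b) \<cdot> \<eta> b)"
  have s: "s \<in> Hom Q b (omap \<omega> b)" unfolding s_def by (rule pi_Hom[OF om_unit_Hom[OF bi]])
  have es: "\<epsilon> b \<cdot>\<^bsub>Q\<^esub> s = Idt Q b"
    using transpose_counit[OF b b om_unit_Hom[OF bi]] transpose_eqI[OF bi refl] by (simp add: s_def)
  have inj: "h = h'" if h: "h \<in> Hom Q (omap \<omega> b) (omap \<omega> b)" "h' \<in> Hom Q (omap \<omega> b) (omap \<omega> b)"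
    and eq: "\<epsilon> b \<cdot>\<^bsub>Q\<^esub> h = \<epsilon> b \<cdot>\<^bsub>Q\<^esub> h'" for h h'
  proof -
    obtain f where f: "f \<in> Hom X (omap \<omega> b) (omap \<omega> b)" "amap \<pi> f = h" by (rule pi_full[OF b h(1)])
    obtain f' where f': "f' \<in> Hom X (omap \<omega> b) (omap \<omega> b)" "amap \<pi> f' = h'" by (rule pi_full[OF b h(2)])
    have "transpose (omap \<omega> b) b f = transpose (omap \<omega> b) b f'"
      unfolding transpose_counit[OF om_Obj[OF b] b f(1)] transpose_counit[OF om_Obj[OF b] b f'(1)]
        f(2) f'(2) by (rule eq)
    then have "f = f'" by (rule transpose_cancel[OF om_Obj[OF b] b f(1) f'(1)])
    then show ?thesis using f f' by simp
  qed
  have "s \<cdot>\<^bsub>Q\<^esub> \<epsilon> b = Idt Q (omap \<omega> b)"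
    using inj[OF Q.Cmp_in[OF e s] wi] Q.Cmp_assoc[OF e s e] es Q.Idt_Cmp[OF e] Q.Cmp_Idt[OF e] by simp
  then show ?thesis using Q.isoI[OF e s _ es] by simp
qed

lemma om_pi_isomorphic: "b \<in> Obj X \<Longrightarrow> isomorphic Q (omap \<omega> b) b"
  using counit_iso counit_Hom by (auto simp: isomorphic_def)

text \<open>By the triangle identity \<pi> (\<eta> a) is a one-sided inverse of the isomorphism
  \<epsilon> a, hence its inverse.\<close>

lemma pi_unit_iso:
  assumes a: "a \<in> Obj X" shows "is_iso Q (amap \<pi> (\<eta> a))"
proof -
  note e = counit_Hom[OF a] and n = pi_Hom[OF unit_Hom[OF a]]
  have ai: "Idt Q a \<in> Hom Q a a" using Q.Idt_in a by simp
  have "amap \<omega> (Idt Q a) \<cdot> \<eta> a = \<eta> a" using om_Idt[OF a] Idt_Cmp[OF unit_Hom[OF a]] by simp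
  then have 1: "\<epsilon> a \<cdot>\<^bsub>Q\<^esub> amap \<pi> (\<eta> a) = Idt Q a"
    using transpose_eqI[OF ai] transpose_counit[OF a a unit_Hom[OF a]] by simp
  obtain s where s: "s \<in> Hom Q a (omap \<omega> a)" "s \<cdot>\<^bsub>Q\<^esub> \<epsilon> a = Idt Q (omap \<omega> a)"
    by (rule Q.isoE[OF counit_iso[OF a] e])
  have "amap \<pi> (\<eta> a) = s"
    using Q.Cmp_assoc[OF n e s(1)] 1 s(2) Q.Idt_Cmp[OF n] Q.Cmp_Idt[OF s(1)] by simp
  then show ?thesis using Q.isoI[OF n e 1] s(2) by simp
qed

text \<open>The triples (1, 1, f) and (1, 1, z) represent the same morphism, so they agree in
  Gabriel's colimit. This makes f zero after restriction to a dense subobject of a and passage to a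
  quotient of b by a subobject in Y. It is here that faithfulness of the description of the hom-sets
  is used.\<close>

lemma pi_zero_cases:
  assumes f: "f \<in> Hom X a b" and z: "z \<in> Hom X a b" "zero_mor X z" and eq: "amap \<pi> f = amap \<pi> z"
  obtains c d u v where "u \<in> Hom X c a" "dense_mono X Y u" "v \<in> Hom X b d" "torsion_epi X Y v"
    "zero_mor X (v \<cdot> (f \<cdot> u))"
proof -
  have ab: "a \<in> Obj X" "b \<in> Obj X" using Hom_Obj[OF f] .
  note ia = Idt_in[OF ab(1)] and ib = Idt_in[OF ab(2)]
  \<comment> \<open>Identities are admissible in a triple: their cokernels and kernels are zero
    objects, hence in Y.\<close>
  obtain q where q: "is_cokernel X (Idt X a) q" using cokernelE[OF ia] by blast
  note qD = cokernelD[OF q ia]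
  have "zero_mor X q" using qD(2) Cmp_Idt[OF qD(1)] by simp
  then have "zero_mor X (Idt X (Cod X q) \<cdot> q)" using Idt_Cmp[OF qD(1)] by simp
  then have "Cod X q \<in> Y"
    using zero_object_Y[OF zero_object_if_zero_Idt] epi_zeroD[OF qD(3,1) Idt_in] Hom_Obj(2)[OF qD(1)]
    by blast
  then have di: "dense_mono X Y (Idt X a)" using mono_Idt[OF ab(1)] q by (auto simp: dense_mono_def)
  obtain k where k: "is_kernel X (Idt X b) k" using kernelE[OF ib] by blast
  note kD = kernelD[OF k ib]
  have "zero_mor X k" using kD(2) Idt_Cmp[OF kD(1)] by simp
  then have "zero_mor X (k \<cdot> Idt X (Dom X k))" using Cmp_Idt[OF kD(1)] by simp
  then have "Dom X k \<in> Y"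
    using zero_object_Y[OF zero_object_if_zero_Idt] mono_zeroD[OF kD(3,1) Idt_in] Hom_Obj(1)[OF kD(1)]
    by blast
  then have ti: "torsion_epi X Y (Idt X b)" using epi_Idt[OF ab(2)] k by (auto simp: torsion_epi_def)
  have tri: "(Idt X a, Idt X b, g) \<in> gabriel_triples X Y a b" if "g \<in> Hom X a b" for g
    using di ti ia ib that by (simp add: gabriel_triples_def HomD)
  have rep: "represents Q \<pi> (Idt X a, Idt X b, g) (amap \<pi> g)" if g: "g \<in> Hom X a b" for g
    using pi_Idt[OF ab(1)] pi_Idt[OF ab(2)] Q.Cmp_Idt[OF pi_Hom[OF g]] Q.Idt_Cmp[OF pi_Hom[OF g]]
    by (simp add: represents_def)
  have "gabriel_equiv X Y (Idt X a, Idt X b, f) (Idt X a, Idt X b, z)"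
    using quot ab pi_Hom[OF f] tri[OF f] tri[OF z(1)] rep[OF f] rep[OF z(1)] eq
    unfolding gabriel_quotient_def by metis
  then obtain c d u u' v v' where
    u: "u \<in> Hom X c a" "u' \<in> Hom X c a" "Idt X a \<cdot> u = Idt X a \<cdot> u'" "dense_mono X Y (Idt X a \<cdot> u)"
    and v: "v \<in> Hom X b d" "v' \<in> Hom X b d" "v \<cdot> Idt X b = v' \<cdot> Idt X b" "torsion_epi X Y (v \<cdot> Idt X b)"
    and e: "v \<cdot> (f \<cdot> u) = v' \<cdot> (z \<cdot> u')"
    using ia ib unfolding gabriel_equiv_def by (auto simp: HomD)
  have "zero_mor X (v' \<cdot> (z \<cdot> u'))"
    using zero_Cmp_right[OF zero_Cmp_left[OF z(2) u(2) z(1)] Cmp_in[OF u(2) z(1)] v(2)] .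
  then show ?thesis
    using that[OF u(1) _ v(1)] u(4) v(4) Idt_Cmp[OF u(1)] Cmp_Idt[OF v(1)] e by simp
qed

text \<open>As v f kills the dense subobject u, it factors through the cokernel of u, which is in Y.
  Being epi, it makes d a quotient of that cokernel, so d is in Y, and b is an extension of d by the
  kernel of v.\<close>

lemma pi_zero_epi:
  assumes f: "f \<in> Hom X a b" and z: "z \<in> Hom X a b" "zero_mor X z" and eq: "amap \<pi> f = amap \<pi> z"
    and e: "is_epi X f"
  shows "b \<in> Y"
proof (rule pi_zero_cases[OF f z eq])
  fix c d u v assume u: "u \<in> Hom X c a" "dense_mono X Y u" and v: "v \<in> Hom X b d" "torsion_epi X Y v"
    and zz: "zero_mor X (v \<cdot> (f \<cdot> u))"
  obtain q where q: "is_cokernel X u q" "Cod X q \<in> Y" using u(2) by (auto simp: dense_mono_def)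
  obtain k where k: "is_kernel X v k" "Dom X k \<in> Y" using v(2) by (auto simp: torsion_epi_def)
  have vf: "v \<cdot> f \<in> Hom X a d" by (rule Cmp_in[OF f v(1)])
  have ve: "is_epi X v" using v(2) by (simp add: torsion_epi_def)
  have "zero_mor X (v \<cdot> f \<cdot> u)" using zz Cmp_assoc[OF u(1) f v(1)] by simp
  then obtain w where w: "w \<in> Hom X (Cod X q) d" "w \<cdot> q = v \<cdot> f"
    using cokernelD(4)[OF q(1) u(1) vf] by blast
  have "is_epi X w"
    using epi_factor[OF _ cokernelD(1)[OF q(1) u(1)] w(1)] epi_Cmp[OF e f ve v(1)] w(2) by simp
  then have "d \<in> Y" using weakly_closed_epi[OF weakly_closed_Y _ w(1) q(2)] by simp
  then show ?thesis by (rule Y_extension_epi[OF v(1) ve k(1) _ k(2)])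
qed

text \<open>Dually, f u embeds c into the kernel of v, and a is an extension of the cokernel of u by
  c.\<close>

lemma pi_zero_mono:
  assumes f: "f \<in> Hom X a b" and z: "z \<in> Hom X a b" "zero_mor X z" and eq: "amap \<pi> f = amap \<pi> z"
    and m: "is_mono X f"
  shows "a \<in> Y"
proof (rule pi_zero_cases[OF f z eq])
  fix c d u v assume u: "u \<in> Hom X c a" "dense_mono X Y u" and v: "v \<in> Hom X b d" "torsion_epi X Y v"
    and zz: "zero_mor X (v \<cdot> (f \<cdot> u))"
  obtain q where q: "is_cokernel X u q" "Cod X q \<in> Y" using u(2) by (auto simp: dense_mono_def)
  obtain k where k: "is_kernel X v k" "Dom X k \<in> Y" using v(2) by (auto simp: torsion_epi_def)
  have fu: "f \<cdot> u \<in> Hom X c b" by (rule Cmp_in[OF u(1) f])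
  have um: "is_mono X u" using u(2) by (simp add: dense_mono_def)
  obtain w where w: "w \<in> Hom X c (Dom X k)" "k \<cdot> w = f \<cdot> u"
    using kernelD(4)[OF k(1) v(1) fu zz] by blast
  have "is_mono X w"
    using mono_factor[OF _ w(1) kernelD(1)[OF k(1) v(1)]] mono_Cmp[OF um u(1) m f] w(2) by simp
  then have "c \<in> Y" using weakly_closed_mono[OF weakly_closed_Y _ w(1) k(2)] by simp
  then show ?thesis by (rule Y_extension_mono[OF u(1) um q(1) _ q(2)])
qed

text \<open>Cancelling \<pi> f shows that \<pi> q is the image of a zero morphism. So a subobject
  whose inclusion becomes epi in X/Y is dense.\<close>

lemma pi_epi_cokernel:
  assumes f: "f \<in> Hom X a b" "is_epi Q (amap \<pi> f)" and q: "q \<in> Hom X b c" "is_epi X q"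
    and z: "zero_mor X (q \<cdot> f)"
  shows "c \<in> Y"
proof -
  obtain y where y: "y \<in> Hom X b c" "zero_mor X y" using ex_zero_mor Hom_Obj[OF q(1)] by blast
  have "q \<cdot> f = y \<cdot> f"
    by (rule zero_mor_unique[OF z Cmp_in[OF f(1) q(1)] zero_Cmp_left[OF y(2) f(1) y(1)]
          Cmp_in[OF f(1) y(1)]])
  then have "amap \<pi> q \<cdot>\<^bsub>Q\<^esub> amap \<pi> f = amap \<pi> y \<cdot>\<^bsub>Q\<^esub> amap \<pi> f"
    using pi_Cmp[OF f(1) q(1)] pi_Cmp[OF f(1) y(1)] by simp
  then have "amap \<pi> q = amap \<pi> y"
    using Q.epi_cancel[OF f(2) pi_Hom[OF f(1)] pi_Hom[OF q(1)] pi_Hom[OF y(1)]] by simp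
  then show ?thesis by (rule pi_zero_epi[OF q(1) y _ q(2)])
qed

text \<open>The kernel of \<eta> M is sent to zero by \<pi>, since \<pi> (\<eta> M) is invertible;
  so it is a subobject of M in Y, hence zero.\<close>

lemma torsionfree_mono_unit:
  assumes M: "torsionfree X Y M" shows "is_mono X (\<eta> M)"
proof -
  have MO: "M \<in> Obj X" using M by (simp add: torsionfree_def)
  note n = unit_Hom[OF MO]
  obtain k where k: "is_kernel X (\<eta> M) k" using kernelE[OF n] by blast
  note kD = kernelD[OF k n]
  obtain z where z: "z \<in> Hom X (Dom X k) M" "zero_mor X z" using ex_zero_mor Hom_Obj[OF kD(1)] by blast
  have "\<eta> M \<cdot> k = \<eta> M \<cdot> z"
    by (rule zero_mor_unique[OF kD(2) Cmp_in[OF kD(1) n] zero_Cmp_right[OF z(2,1) n] Cmp_in[OF z(1) n]])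
  then have "amap \<pi> k = amap \<pi> z"
    using Q.mono_cancel[OF Q.iso_mono[OF pi_unit_iso[OF MO]] pi_Hom[OF n] pi_Hom[OF kD(1)] pi_Hom[OF z(1)]]
      pi_Cmp[OF kD(1) n] pi_Cmp[OF z(1) n] by simp
  then have "Dom X k \<in> Y" by (rule pi_zero_mono[OF kD(1) z _ kD(3)])
  then have zk: "zero_mor X k" using M kD(1) unfolding torsionfree_iff by blast
  show ?thesis
  proof (rule mono_zeroI[OF n])
    fix c g assume g: "g \<in> Hom X c M" and zg: "zero_mor X (\<eta> M \<cdot> g)"
    obtain w where "w \<in> Hom X c (Dom X k)" "k \<cdot> w = g" using kD(4)[OF g zg] by blast
    then show "zero_mor X g" using zero_Cmp_left[OF zk _ kD(1)] by blast
  qed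
qed

text \<open>Without exactness of \<pi> at hand, it is shown that \<omega> \<pi> f is mono in X;
  transposing carries this over to X/Y.\<close>

lemma pi_mono:
  assumes f: "f \<in> Hom X a b" "is_mono X f" and b: "torsionfree X Y b"
  shows "is_mono Q (amap \<pi> f)"
proof -
  have ab: "a \<in> Obj X" "b \<in> Obj X" using Hom_Obj[OF f(1)] .
  have a: "torsionfree X Y a" by (rule torsionfree_mono[OF b f])
  note na = unit_Hom[OF ab(1)] and nb = unit_Hom[OF ab(2)]
  have nam: "is_mono X (\<eta> a)" and nbm: "is_mono X (\<eta> b)" using torsionfree_mono_unit a b by auto
  note Pf = pi_Hom[OF f(1)]
  note Wf = om_Hom[OF Pf]
  obtain k where k: "is_kernel X (amap \<omega> (amap \<pi> f)) k" using kernelE[OF Wf] by blast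
  note kD = kernelD[OF k Wf]
  obtain c where c: "is_cokernel X (\<eta> a) c" using cokernelE[OF na] by blast
  note cD = cokernelD[OF c na]
  have cY: "Cod X c \<in> Y"
    by (rule pi_epi_cokernel[OF na Q.iso_epi[OF pi_unit_iso[OF ab(1)]] cD(1,3,2)])
  have ck: "c \<cdot> k \<in> Hom X (Dom X k) (Cod X c)" by (rule Cmp_in[OF kD(1) cD(1)])
  \<comment> \<open>The kernel k of \<omega> \<pi> f meets the subobject a of \<omega> a trivially,
    because \<omega> \<pi> f restricts there to the monomorphism \<eta> b . f. So it embeds into the
    cokernel of \<eta> a, which lies in Y, and vanishes because \<omega> a is torsionfree.\<close>
  have "is_mono X (c \<cdot> k)"
  proof (rule mono_zeroI[OF ck])
    fix d x assume x: "x \<in> Hom X d (Dom X k)" and z: "zero_mor X (c \<cdot> k \<cdot> x)"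
    have kx: "k \<cdot> x \<in> Hom X d (omap \<omega> a)" by (rule Cmp_in[OF x kD(1)])
    have "zero_mor X (c \<cdot> (k \<cdot> x))" using z Cmp_assoc[OF x kD(1) cD(1)] by simp
    from kernelD(4)[OF mono_kernel_cokernel[OF nam na c] cD(1) kx this]
    obtain l where l: "l \<in> Hom X d a" "\<eta> a \<cdot> l = k \<cdot> x" using na by (auto simp: HomD)
    have fl: "f \<cdot> l \<in> Hom X d b" by (rule Cmp_in[OF l(1) f(1)])
    have "\<eta> b \<cdot> (f \<cdot> l) = amap \<omega> (amap \<pi> f) \<cdot> k \<cdot> x"
      using Cmp_assoc[OF l(1) f(1) nb] unit_natural[OF f(1)] Cmp_assoc[OF l(1) na Wf] l(2)
        Cmp_assoc[OF x kD(1) Wf] by simp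
    then have "zero_mor X (\<eta> b \<cdot> (f \<cdot> l))"
      using zero_Cmp_left[OF kD(2) x Cmp_in[OF kD(1) Wf]] by simp
    then have "zero_mor X l" using mono_zeroD[OF nbm nb fl] mono_zeroD[OF f(2,1) l(1)] by blast
    then have "zero_mor X (k \<cdot> x)" using zero_Cmp_right[OF _ l(1) na] l(2) by simp
    then show "zero_mor X x" by (rule mono_zeroD[OF kD(3,1) x])
  qed
  then have "Dom X k \<in> Y" by (rule weakly_closed_mono[OF weakly_closed_Y _ ck cY])
  then have zk: "zero_mor X k" using torsionfree_om[OF ab(1)] kD(1) unfolding torsionfree_iff by blast
  have wm: "is_mono X (amap \<omega> (amap \<pi> f))"
  proof (rule mono_zeroI[OF Wf])
    fix d g assume g: "g \<in> Hom X d (omap \<omega> a)" and zg: "zero_mor X (amap \<omega> (amap \<pi> f) \<cdot> g)"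
    obtain w where "w \<in> Hom X d (Dom X k)" "k \<cdot> w = g" using kD(4)[OF g zg] by blast
    then show "zero_mor X g" using zero_Cmp_left[OF zk _ kD(1)] by blast
  qed
  show ?thesis
  proof (rule Q.monoI[OF Pf])
    fix d g h assume g: "g \<in> Hom Q d a" and h: "h \<in> Hom Q d a"
      and eq: "amap \<pi> f \<cdot>\<^bsub>Q\<^esub> g = amap \<pi> f \<cdot>\<^bsub>Q\<^esub> h"
    have d: "d \<in> Obj X" using Q.Hom_Obj[OF g] by simp
    have "amap \<omega> (amap \<pi> f) \<cdot> (amap \<omega> g \<cdot> \<eta> d) = amap \<omega> (amap \<pi> f) \<cdot> (amap \<omega> h \<cdot> \<eta> d)"
      using Cmp_assoc[OF unit_Hom[OF d] om_Hom[OF g] Wf] Cmp_assoc[OF unit_Hom[OF d] om_Hom[OF h] Wf]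
        om_Cmp[OF g Pf] om_Cmp[OF h Pf] eq by simp
    then show "g = h"
      using mono_cancel[OF wm Wf om_unit_Hom[OF g] om_unit_Hom[OF h]] unit_cancel[OF g h] by simp
  qed
qed

section \<open>Preservation properties of the adjoints\<close>

lemma pi_epi:
  assumes f: "f \<in> Hom X a b" "is_epi X f"
  shows "is_epi Q (amap \<pi> f)"
proof (rule Q.epiI[OF pi_Hom[OF f(1)]])
  fix c g h assume g: "g \<in> Hom Q b c" and h: "h \<in> Hom Q b c"
    and eq: "g \<cdot>\<^bsub>Q\<^esub> amap \<pi> f = h \<cdot>\<^bsub>Q\<^esub> amap \<pi> f"
  have ab: "a \<in> Obj X" "b \<in> Obj X" using Hom_Obj[OF f(1)] .
  have *: "amap \<omega> g \<cdot> \<eta> b \<cdot> f = amap \<omega> (g \<cdot>\<^bsub>Q\<^esub> amap \<pi> f) \<cdot> \<eta> a" if g: "g \<in> Hom Q b c" for g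
    using Cmp_assoc[OF f(1) unit_Hom[OF ab(2)] om_Hom[OF g]] unit_natural[OF f(1)]
      Cmp_assoc[OF unit_Hom[OF ab(1)] om_Hom[OF pi_Hom[OF f(1)]] om_Hom[OF g]]
      om_Cmp[OF pi_Hom[OF f(1)] g] by simp
  have "amap \<omega> g \<cdot> \<eta> b = amap \<omega> h \<cdot> \<eta> b"
    using epi_cancel[OF f(2,1) om_unit_Hom[OF g] om_unit_Hom[OF h]] *[OF g] *[OF h] eq by simp
  then show "g = h" by (rule unit_cancel[OF g h])
qed

lemma om_mono:
  assumes f: "f \<in> Hom Q a b" "is_mono Q f"
  shows "is_mono X (amap \<omega> f)"
proof (rule monoI[OF om_Hom[OF f(1)]])
  fix d g h assume g: "g \<in> Hom X d (omap \<omega> a)" and h: "h \<in> Hom X d (omap \<omega> a)"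
    and eq: "amap \<omega> f \<cdot> g = amap \<omega> f \<cdot> h"
  have o: "a \<in> Obj X" "d \<in> Obj X" using Q.Hom_Obj[OF f(1)] Hom_Obj[OF g] by simp_all
  show "g = h"
    using transpose_cancel[OF o(2,1) g h] transpose_om[OF o(2) f(1) g] transpose_om[OF o(2) f(1) h]
      Q.mono_cancel[OF f(2,1) transpose(1)[OF o(2,1) g] transpose(1)[OF o(2,1) h]] eq by simp
qed

lemma pi_coproduct:
  assumes S: "is_coproduct X I A S s" and A: "\<And>i. i \<in> I \<Longrightarrow> A i \<in> Obj X"
  shows "is_coproduct Q I A S (\<lambda>i. amap \<pi> (s i))"
proof (rule Q.is_coproductI)
  show SO: "S \<in> Obj Q" using S by (simp add: is_coproduct_def)
  show "amap \<pi> (s i) \<in> Hom Q (A i) S" if "i \<in> I" for i by (rule pi_Hom[OF coproduct_in[OF S that]])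
  fix T
  show "\<exists>h\<in>Hom Q S T. \<forall>i\<in>I. h \<cdot>\<^bsub>Q\<^esub> amap \<pi> (s i) = g i"
    if T: "T \<in> Obj Q" and g: "\<And>i. i \<in> I \<Longrightarrow> g i \<in> Hom Q (A i) T" for g
  proof -
    have TO: "T \<in> Obj X" and SO: "S \<in> Obj X" using T SO by simp_all
    obtain h where h: "h \<in> Hom X S (omap \<omega> T)" "\<And>i. i \<in> I \<Longrightarrow> h \<cdot> s i = amap \<omega> (g i) \<cdot> \<eta> (A i)"
      by (rule coproduct_ex1[OF S om_Obj[OF TO], of "\<lambda>i. amap \<omega> (g i) \<cdot> \<eta> (A i)"])
        (use om_unit_Hom[OF g] in blast)+
    have "transpose S T h \<cdot>\<^bsub>Q\<^esub> amap \<pi> (s i) = g i" if i: "i \<in> I" for i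
      using transpose_pi[OF coproduct_in[OF S i] TO h(1)] h(2)[OF i] transpose_eqI[OF g[OF i] refl]
      by simp
    then show ?thesis using transpose(1)[OF SO TO h(1)] by blast
  qed
  show "g = h" if g: "g \<in> Hom Q S T" and h: "h \<in> Hom Q S T"
    and eq: "\<And>i. i \<in> I \<Longrightarrow> g \<cdot>\<^bsub>Q\<^esub> amap \<pi> (s i) = h \<cdot>\<^bsub>Q\<^esub> amap \<pi> (s i)" for g h
  proof (rule unit_cancel[OF g h], rule coproduct_unique[OF S om_unit_Hom[OF g] om_unit_Hom[OF h]])
    fix i assume i: "i \<in> I"
    note si = coproduct_in[OF S i]
    have SO: "S \<in> Obj X" using SO by simp
    have *: "amap \<omega> g \<cdot> \<eta> S \<cdot> s i = amap \<omega> (g \<cdot>\<^bsub>Q\<^esub> amap \<pi> (s i)) \<cdot> \<eta> (A i)"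
      if g: "g \<in> Hom Q S T" for g
      using Cmp_assoc[OF si unit_Hom[OF SO] om_Hom[OF g]] unit_natural[OF si]
        Cmp_assoc[OF unit_Hom[OF A[OF i]] om_Hom[OF pi_Hom[OF si]] om_Hom[OF g]]
        om_Cmp[OF pi_Hom[OF si] g] by simp
    show "amap \<omega> g \<cdot> \<eta> S \<cdot> s i = amap \<omega> h \<cdot> \<eta> S \<cdot> s i"
      using *[OF g] *[OF h] eq[OF i] by simp
  qed
qed

lemma om_product:
  assumes P: "is_product Q I A P p"
  shows "is_product X I (\<lambda>i. omap \<omega> (A i)) (omap \<omega> P) (\<lambda>i. amap \<omega> (p i))"
proof -
  have PO: "P \<in> Obj X" using P by (simp add: is_product_def)
  have AO: "A i \<in> Obj X" if "i \<in> I" for i using Q.Hom_Obj[OF Q.product_in[OF P that]] by simp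
  show ?thesis
  proof (rule is_productI)
    show "omap \<omega> P \<in> Obj X" by (rule om_Obj[OF PO])
    show "amap \<omega> (p i) \<in> Hom X (omap \<omega> P) (omap \<omega> (A i))" if "i \<in> I" for i
      by (rule om_Hom[OF Q.product_in[OF P that]])
    fix T
    show "\<exists>h\<in>Hom X T (omap \<omega> P). \<forall>i\<in>I. amap \<omega> (p i) \<cdot> h = g i"
      if T: "T \<in> Obj X" and g: "\<And>i. i \<in> I \<Longrightarrow> g i \<in> Hom X T (omap \<omega> (A i))" for g
    proof -
      have TQ: "T \<in> Obj Q" using T by simp
      obtain h where h: "h \<in> Hom Q T P" "\<And>i. i \<in> I \<Longrightarrow> p i \<cdot>\<^bsub>Q\<^esub> h = transpose T (A i) (g i)"
        by (rule Q.product_ex1[OF P TQ, of "\<lambda>i. transpose T (A i) (g i)"])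
          (use transpose(1)[OF T AO g] in blast)+
      have "amap \<omega> (p i) \<cdot> (amap \<omega> h \<cdot> \<eta> T) = g i" if i: "i \<in> I" for i
        using Cmp_assoc[OF unit_Hom[OF T] om_Hom[OF h(1)] om_Hom[OF Q.product_in[OF P i]]]
          om_Cmp[OF h(1) Q.product_in[OF P i]] h(2)[OF i] transpose(2)[OF T AO[OF i] g[OF i]] by simp
      then show ?thesis using om_unit_Hom[OF h(1)] by blast
    qed
    show "g = h" if g: "g \<in> Hom X T (omap \<omega> P)" and h: "h \<in> Hom X T (omap \<omega> P)"
      and eq: "\<And>i. i \<in> I \<Longrightarrow> amap \<omega> (p i) \<cdot> g = amap \<omega> (p i) \<cdot> h" for g h
    proof -
      have T: "T \<in> Obj X" using Hom_Obj[OF g] by simp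
      have "transpose T P g = transpose T P h"
      proof (rule Q.product_unique[OF P transpose(1)[OF T PO g] transpose(1)[OF T PO h]])
        fix i assume i: "i \<in> I"
        show "p i \<cdot>\<^bsub>Q\<^esub> transpose T P g = p i \<cdot>\<^bsub>Q\<^esub> transpose T P h"
          using transpose_om[OF T Q.product_in[OF P i] g] transpose_om[OF T Q.product_in[OF P i] h]
            eq[OF i] by simp
      qed
      then show ?thesis by (rule transpose_cancel[OF T PO g h])
    qed
  qed
qed

text \<open>The transposed projections P -> A i in X/Y induce morphisms \<omega> P -> \<omega> (A
  i), and these assemble to a retraction r of \<eta> P. So a product of objects in the image of
  \<omega> is again, up to isomorphism, in that image; no product in X/Y is presupposed.\<close>

lemma unit_iso_product:
  assumes P: "is_product X I (\<lambda>i. omap \<omega> (A i)) P p" and A: "\<And>i. i \<in> I \<Longrightarrow> A i \<in> Obj X"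
  shows "is_iso X (\<eta> P)"
proof -
  have PO: "P \<in> Obj X" using P by (simp add: is_product_def)
  note n = unit_Hom[OF PO] and W = om_Obj[OF PO]
  note p = product_in[OF P]
  have pt: "transpose P (A i) (p i) \<in> Hom Q P (A i)"
    "amap \<omega> (transpose P (A i) (p i)) \<cdot> \<eta> P = p i" if i: "i \<in> I" for i
    using transpose[OF PO A[OF i] p[OF i]] by simp_all
  obtain r where r: "r \<in> Hom X (omap \<omega> P) P"
    "\<And>i. i \<in> I \<Longrightarrow> p i \<cdot> r = amap \<omega> (transpose P (A i) (p i))"
    by (rule product_ex1[OF P W, of "\<lambda>i. amap \<omega> (transpose P (A i) (p i))"])
      (use om_Hom[OF pt(1)] in blast)+
  have rn: "r \<cdot> \<eta> P = Idt X P"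
  proof (rule product_unique[OF P Cmp_in[OF n r(1)] Idt_in[OF PO]])
    fix i assume i: "i \<in> I"
    show "p i \<cdot> (r \<cdot> \<eta> P) = p i \<cdot> Idt X P"
      using Cmp_assoc[OF n r(1) p[OF i]] r(2)[OF i] pt(2)[OF i] Cmp_Idt[OF p[OF i]] by simp
  qed
  have nr: "\<eta> P \<cdot> r \<in> Hom X (omap \<omega> P) (omap \<omega> P)" by (rule Cmp_in[OF r(1) n])
  have "\<eta> P \<cdot> r \<cdot> \<eta> P = Idt X (omap \<omega> P) \<cdot> \<eta> P"
    using Cmp_assoc[OF n r(1) n] rn Cmp_Idt[OF n] Idt_Cmp[OF n] by simp
  \<comment> \<open>That r is also a right inverse is checked in X/Y: the two endomorphisms of
    \<omega> P agree after \<eta> P, and \<pi> (\<eta> P) is invertible.\<close>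
  then have "transpose (omap \<omega> P) P (\<eta> P \<cdot> r) \<cdot>\<^bsub>Q\<^esub> amap \<pi> (\<eta> P)
      = transpose (omap \<omega> P) P (Idt X (omap \<omega> P)) \<cdot>\<^bsub>Q\<^esub> amap \<pi> (\<eta> P)"
    using transpose_pi[OF n PO nr] transpose_pi[OF n PO Idt_in[OF W]] by simp
  then have "transpose (omap \<omega> P) P (\<eta> P \<cdot> r) = transpose (omap \<omega> P) P (Idt X (omap \<omega> P))"
    using Q.epi_cancel[OF Q.iso_epi[OF pi_unit_iso[OF PO]] pi_Hom[OF n]
        transpose(1)[OF W PO nr] transpose(1)[OF W PO Idt_in[OF W]]] by simp
  then have "\<eta> P \<cdot> r = Idt X (omap \<omega> P)" by (rule transpose_cancel[OF W PO nr Idt_in[OF W]])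
  then show ?thesis by (rule isoI[OF n r(1) rn])
qed

text \<open>Existence of the mediating morphism comes from transposing into X. For uniqueness,
  competing morphisms T -> P in X/Y must first be lifted to X, which is possible because P is
  isomorphic to \<omega> P.\<close>

lemma product_om:
  assumes P: "is_product X I (\<lambda>i. omap \<omega> (A i)) P p" and A: "\<And>i. i \<in> I \<Longrightarrow> A i \<in> Obj X"
  shows "is_product Q I A P (\<lambda>i. \<epsilon> (A i) \<cdot>\<^bsub>Q\<^esub> amap \<pi> (p i))"
proof -
  have PO: "P \<in> Obj X" using P by (simp add: is_product_def)
  note p = product_in[OF P]
  have pt: "\<epsilon> (A i) \<cdot>\<^bsub>Q\<^esub> amap \<pi> (p i) = transpose P (A i) (p i)" if i: "i \<in> I" for i
    using transpose_counit[OF PO A[OF i] p[OF i]] by simp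
  have pth: "transpose P (A i) (p i) \<in> Hom Q P (A i)" if i: "i \<in> I" for i
    by (rule transpose(1)[OF PO A[OF i] p[OF i]])
  obtain r where r: "r \<in> Hom X (omap \<omega> P) P" "r \<cdot> \<eta> P = Idt X P" "\<eta> P \<cdot> r = Idt X (omap \<omega> P)"
    by (rule isoE[OF unit_iso_product[OF P A] unit_Hom[OF PO]])
  have full: "\<exists>f\<in>Hom X T P. amap \<pi> f = h" if h: "h \<in> Hom Q T P" for T h
  proof -
    note n = unit_Hom[OF PO]
    obtain f where f: "f \<in> Hom X T (omap \<omega> P)" "amap \<pi> f = amap \<pi> (\<eta> P) \<cdot>\<^bsub>Q\<^esub> h"
      by (rule pi_full[OF PO Q.Cmp_in[OF h pi_Hom[OF n]]])
    have "amap \<pi> (r \<cdot> f) = h"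
      using pi_Cmp[OF f(1) r(1)] f(2) Q.Cmp_assoc[OF h pi_Hom[OF n] pi_Hom[OF r(1)]]
        pi_Cmp[OF n r(1)] r(2) pi_Idt[OF PO] Q.Idt_Cmp[OF h] by simp
    then show ?thesis using Cmp_in[OF f(1) r(1)] by blast
  qed
  show ?thesis
  proof (rule Q.is_productI)
    show "P \<in> Obj Q" using PO by simp
    show "\<epsilon> (A i) \<cdot>\<^bsub>Q\<^esub> amap \<pi> (p i) \<in> Hom Q P (A i)" if "i \<in> I" for i
      using pt[OF that] pth[OF that] by simp
    fix T
    show "\<exists>h\<in>Hom Q T P. \<forall>i\<in>I. \<epsilon> (A i) \<cdot>\<^bsub>Q\<^esub> amap \<pi> (p i) \<cdot>\<^bsub>Q\<^esub> h = g i"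
      if T: "T \<in> Obj Q" and g: "\<And>i. i \<in> I \<Longrightarrow> g i \<in> Hom Q T (A i)" for g
    proof -
      have TO: "T \<in> Obj X" using T by simp
      obtain h where h: "h \<in> Hom X T P" "\<And>i. i \<in> I \<Longrightarrow> p i \<cdot> h = amap \<omega> (g i) \<cdot> \<eta> T"
        by (rule product_ex1[OF P TO, of "\<lambda>i. amap \<omega> (g i) \<cdot> \<eta> T"])
          (use om_unit_Hom[OF g] in blast)+
      have "\<epsilon> (A i) \<cdot>\<^bsub>Q\<^esub> amap \<pi> (p i) \<cdot>\<^bsub>Q\<^esub> amap \<pi> h = g i" if i: "i \<in> I" for i
        using pt[OF i] transpose_pi[OF h(1) A[OF i] p[OF i]] h(2)[OF i] transpose_eqI[OF g[OF i] refl]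
        by simp
      then show ?thesis using pi_Hom[OF h(1)] by blast
    qed
    show "g = h" if g: "g \<in> Hom Q T P" and h: "h \<in> Hom Q T P"
      and eq: "\<And>i. i \<in> I \<Longrightarrow> \<epsilon> (A i) \<cdot>\<^bsub>Q\<^esub> amap \<pi> (p i) \<cdot>\<^bsub>Q\<^esub> g = \<epsilon> (A i) \<cdot>\<^bsub>Q\<^esub> amap \<pi> (p i) \<cdot>\<^bsub>Q\<^esub> h"
    for g h
    proof -
      have T: "T \<in> Obj X" using Q.Hom_Obj[OF g] by simp
      obtain g' where g': "g' \<in> Hom X T P" "amap \<pi> g' = g" using full[OF g] by blast
      obtain h' where h': "h' \<in> Hom X T P" "amap \<pi> h' = h" using full[OF h] by blast
      have "g' = h'"
      proof (rule product_unique[OF P g'(1) h'(1)])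
        fix i assume i: "i \<in> I"
        have "transpose T (A i) (p i \<cdot> g') = transpose T (A i) (p i \<cdot> h')"
          using transpose_pi[OF g'(1) A[OF i] p[OF i]] transpose_pi[OF h'(1) A[OF i] p[OF i]]
            eq[OF i] pt[OF i] g'(2) h'(2) by simp
        then show "p i \<cdot> g' = p i \<cdot> h'"
          by (rule transpose_cancel[OF T A[OF i] Cmp_in[OF g'(1) p[OF i]] Cmp_in[OF h'(1) p[OF i]]])
      qed
      then show ?thesis using g' h' by simp
    qed
  qed
qed

end

section \<open>Closed subcategories\<close>

lemma closed_subcatI:
  fixes \<kappa> :: "'u rel"
  assumes "Z \<subseteq> Obj C"
    and "\<And>f. is_mono C f \<Longrightarrow> Cod C f \<in> Z \<Longrightarrow> Dom C f \<in> Z"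
    and "\<And>f. is_epi C f \<Longrightarrow> Dom C f \<in> Z \<Longrightarrow> Cod C f \<in> Z"
    and "\<And>(I :: 'u set) A S s. \<lbrakk>small \<kappa> I; A ` I \<subseteq> Z; is_coproduct C I A S s\<rbrakk> \<Longrightarrow> S \<in> Z"
    and "\<And>(I :: 'u set) A P p. \<lbrakk>small \<kappa> I; A ` I \<subseteq> Z; is_product C I A P p\<rbrakk> \<Longrightarrow> P \<in> Z"
  shows "closed_subcat \<kappa> C Z"
  unfolding closed_subcat_def weakly_closed_def
  by (intro conjI allI impI; (elim conjE)?; (rule assms; assumption))

lemma generated_mono:
  fixes \<kappa> :: "'u rel"
  assumes "E \<subseteq> E'"
  shows "generated \<kappa> C E \<subseteq> generated \<kappa> C E'"
proof
  fix N assume "N \<in> generated \<kappa> C E"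
  then obtain I :: "'u set" and A S s e where *: "small \<kappa> I" "A ` I \<subseteq> E" "is_coproduct C I A S s"
    "e \<in> Hom C S N" "is_epi C e"
    unfolding generated_def mem_Collect_eq by blast
  then have "A ` I \<subseteq> E'" using assms by simp
  then show "N \<in> generated \<kappa> C E'" unfolding generated_def mem_Collect_eq using * by metis
qed

locale gabriel_AB4 = gabriel X \<kappa> Y Q \<pi> \<omega>
  for X :: "('o, 'm) cat" (structure) and \<kappa> :: "'u rel" and Y :: "'o set"
    and Q :: "('o, 'n) cat" and \<pi> :: "('o, 'm, 'o, 'n) ftor" and \<omega> :: "('o, 'n, 'o, 'm) ftor" +
  assumes groth: "grothendieck \<kappa> X" and prods: "exact_products \<kappa> X"
begin

section \<open>Small products and coproducts in X\<close>

lemma ex_coproduct: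
  fixes I :: "'u set"
  assumes "small \<kappa> I" "A ` I \<subseteq> Obj X"
  obtains S s where "is_coproduct X I A S s"
  using groth assms unfolding grothendieck_def has_small_coproducts_def by blast

lemma ex_product:
  fixes I :: "'u set"
  assumes "small \<kappa> I" "A ` I \<subseteq> Obj X"
  obtains P p where "is_product X I A P p"
  using prods assms unfolding exact_products_def by blast

lemma product_map_epi:
  fixes I :: "'u set"
  assumes I: "small \<kappa> I" and P: "is_product X I A P p" and R: "is_product X I B R r"
    and e: "\<And>i. i \<in> I \<Longrightarrow> e i \<in> Hom X (A i) (B i) \<and> is_epi X (e i)"
  obtains g where "g \<in> Hom X P R" "is_epi X g"
proof -
  have PO: "P \<in> Obj X" and RO: "R \<in> Obj X" using P R by (simp_all add: is_product_def)
  have eh: "e i \<in> Hom X (A i) (B i)" and ee: "is_epi X (e i)" if "i \<in> I" for i using e[OF that] by auto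
  have "\<forall>i\<in>I. \<exists>k. is_kernel X (e i) k" using kernelE[OF eh] by blast
  then obtain k where k: "\<And>i. i \<in> I \<Longrightarrow> is_kernel X (e i) (k i)" by metis
  define K where "K i = Dom X (k i)" for i
  have kh: "k i \<in> Hom X (K i) (A i)" if "i \<in> I" for i
    using kernelD(1)[OF k[OF that] eh[OF that]] by (simp add: K_def)
  have "K ` I \<subseteq> Obj X" using Hom_Obj(1)[OF kh] by blast
  then obtain L l where L: "is_product X I K L l" by (rule ex_product[OF I])
  have LO: "L \<in> Obj X" using L by (simp add: is_product_def)
  obtain f where f: "f \<in> Hom X L P" "\<And>i. i \<in> I \<Longrightarrow> p i \<cdot> f = k i \<cdot> l i"
    by (rule product_ex1[OF P LO, of "\<lambda>i. k i \<cdot> l i"]) (use Cmp_in[OF product_in[OF L] kh] in blast)+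
  obtain g where g: "g \<in> Hom X P R" "\<And>i. i \<in> I \<Longrightarrow> r i \<cdot> g = e i \<cdot> p i"
    by (rule product_ex1[OF R PO, of "\<lambda>i. e i \<cdot> p i"]) (use Cmp_in[OF product_in[OF P] eh] in blast)+
  have se: "\<forall>i\<in>I. k i \<in> Hom X (K i) (A i) \<and> e i \<in> Hom X (A i) (B i) \<and> short_exact X (k i) (e i)"
    using kh eh k epi_cokernel_kernel[OF ee eh k] by (simp add: short_exact_def)
  have "short_exact X f g"
    using prods[unfolded exact_products_def, THEN conjunct2, rule_format, of I k K A e B L l P p R r f g]
      I se L P R f g by blast
  then have "is_epi X g" using cokernelD(3)[OF _ f(1)] by (auto simp: short_exact_def)
  then show ?thesis by (rule that[OF g(1)])
qed

lemma torsionfree_coproduct: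
  fixes I :: "'u set"
  assumes I: "small \<kappa> I" and A: "\<And>i. i \<in> I \<Longrightarrow> torsionfree X Y (A i)" and S: "is_coproduct X I A S s"
  shows "torsionfree X Y S"
proof -
  have AO: "A i \<in> Obj X" if "i \<in> I" for i using A[OF that] by (simp add: torsionfree_def)
  then have AI: "A ` I \<subseteq> Obj X" by blast
  then obtain P p where P: "is_product X I A P p" by (rule ex_product[OF I])
  have PO: "P \<in> Obj X" using P by (simp add: is_product_def)
  \<comment> \<open>The Kronecker delta: d i j is the identity for i = j and zero otherwise. Its
    rows are the morphisms c i from A i to the product, which assemble to the canonical f from
    coproduct to product.\<close>
  have "\<exists>d. d \<in> Hom X (A i) (A j) \<and> (if i = j then d = Idt X (A i) else zero_mor X d)"
    if "i \<in> I" "j \<in> I" for i j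
    using Idt_in[OF AO[OF that(1)]] ex_zero_mor[OF AO[OF that(1)] AO[OF that(2)]] by metis
  then obtain d where d: "\<And>i j. \<lbrakk>i \<in> I; j \<in> I\<rbrakk> \<Longrightarrow> d i j \<in> Hom X (A i) (A j)"
    "\<And>i j. \<lbrakk>i \<in> I; j \<in> I\<rbrakk> \<Longrightarrow> if i = j then d i j = Idt X (A i) else zero_mor X (d i j)"
    by metis
  have "\<exists>c. c \<in> Hom X (A i) P \<and> (\<forall>j\<in>I. p j \<cdot> c = d i j)" if i: "i \<in> I" for i
  proof -
    obtain c where "c \<in> Hom X (A i) P" "\<And>j. j \<in> I \<Longrightarrow> p j \<cdot> c = d i j"
      by (rule product_ex1[OF P AO[OF i], of "d i"]) (use d(1)[OF i] in blast)+
    then show ?thesis by metis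
  qed
  then obtain c where c: "\<And>i. i \<in> I \<Longrightarrow> c i \<in> Hom X (A i) P"
    "\<And>i j. \<lbrakk>i \<in> I; j \<in> I\<rbrakk> \<Longrightarrow> p j \<cdot> c i = d i j" by metis
  obtain f where f: "f \<in> Hom X S P" "\<And>i. i \<in> I \<Longrightarrow> f \<cdot> s i = c i"
    by (rule coproduct_ex1[OF S PO, of c]) (use c(1) in blast)+
  have "is_mono X f"
  proof (rule coproduct_to_product_mono[OF universe _ _ I AI S f(1)])
    show "has_small_coproducts \<kappa> X" "exact_filtered_colimits \<kappa> X"
      using groth by (simp_all add: grothendieck_def)
    show "p i \<in> Hom X P (A i)" if "i \<in> I" for i by (rule product_in[OF P that])
    show "p i \<cdot> (f \<cdot> s i) = Idt X (A i)" if "i \<in> I" for i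
      using f(2)[OF that] c(2)[OF that that] d(2)[OF that that] by simp
    show "zero_mor X (p j \<cdot> (f \<cdot> s i))" if "i \<in> I" "j \<in> I" "i \<noteq> j" for i j
      using f(2)[OF that(1)] c(2)[OF that(1,2)] d(2)[OF that(1,2)] that(3) by simp
  qed
  then show ?thesis using torsionfree_mono[OF torsionfree_product[OF P A] f(1)] by blast
qed

section \<open>The image of a closed subcategory in X/Y\<close>

lemma om_isomorphic:
  assumes "isomorphic Q a b" shows "isomorphic X (omap \<omega> a) (omap \<omega> b)"
proof -
  obtain f where f: "f \<in> Hom Q a b" "is_iso Q f" using assms by (auto simp: isomorphic_def)
  obtain g where g: "g \<in> Hom Q b a" "g \<cdot>\<^bsub>Q\<^esub> f = Idt Q a" "f \<cdot>\<^bsub>Q\<^esub> g = Idt Q b"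
    by (rule Q.isoE[OF f(2,1)])
  have o: "a \<in> Obj X" "b \<in> Obj X" using Q.Hom_Obj[OF f(1)] by simp_all
  have "is_iso X (amap \<omega> f)"
    by (rule isoI[OF om_Hom[OF f(1)] om_Hom[OF g(1)]])
      (use om_Cmp[OF f(1) g(1)] om_Cmp[OF g(1) f(1)] g om_Idt o in simp_all)
  then show ?thesis using om_Hom[OF f(1)] by (auto simp: isomorphic_def)
qed

text \<open>If N is isomorphic to \<pi> M, then \<omega> N is isomorphic to \<omega> \<pi> M, which
  stability puts in Z. Conversely, N is isomorphic to \<pi> of \<omega> N.\<close>

lemma image_subcat_iff:
  assumes Z: "weakly_closed \<kappa> X Z" and st: "essentially_stable \<pi> \<omega> Z"
  shows "N \<in> image_subcat Q \<pi> Z \<longleftrightarrow> N \<in> Obj X \<and> omap \<omega> N \<in> Z"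
proof
  assume "N \<in> image_subcat Q \<pi> Z"
  then obtain M where N: "N \<in> Obj X" and M: "M \<in> Z" "isomorphic Q N (omap \<pi> M)"
    by (auto simp: image_subcat_def)
  have "omap \<omega> (omap \<pi> M) \<in> Z" using st M(1) by (simp add: essentially_stable_def)
  then have "omap \<omega> N \<in> Z"
    using weakly_closed_iso[OF Z isomorphic_sym[OF om_isomorphic[OF M(2)]]] by simp
  then show "N \<in> Obj X \<and> omap \<omega> N \<in> Z" using N by simp
next
  assume N: "N \<in> Obj X \<and> omap \<omega> N \<in> Z"
  then have "isomorphic Q N (omap \<pi> (omap \<omega> N))"
    using Q.isomorphic_sym[OF om_pi_isomorphic[of N]] om_Obj[of N] by simp
  then show "N \<in> image_subcat Q \<pi> Z" using N by (auto simp: image_subcat_def)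
qed

theorem closed_image_subcat:
  assumes Z: "closed_subcat \<kappa> X Z" and st: "essentially_stable \<pi> \<omega> Z"
  shows "closed_subcat \<kappa> Q (image_subcat Q \<pi> Z)"
proof -
  have wZ: "weakly_closed \<kappa> X Z" using Z by (simp add: closed_subcat_def)
  note iff = image_subcat_iff[OF wZ st]
  let ?W = "image_subcat Q \<pi> Z"
  have sub: "Dom Q f \<in> ?W" if f: "is_mono Q f" "Cod Q f \<in> ?W" for f
  proof -
    have fh: "f \<in> Hom Q (Dom Q f) (Cod Q f)" using f(1) by (simp add: is_mono_def Hom_def)
    show ?thesis
      using weakly_closed_mono[OF wZ om_mono[OF fh f(1)] om_Hom[OF fh]] f(2) Q.Hom_Obj(1)[OF fh]
      unfolding iff by simp
  qed
  have quo: "Cod Q f \<in> ?W" if f: "is_epi Q f" "Dom Q f \<in> ?W" for f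
  proof -
    define a where "a = Dom Q f"
    define b where "b = Cod Q f"
    have fh: "f \<in> Hom Q a b" using f(1) by (simp add: is_epi_def Hom_def a_def b_def)
    have ab: "a \<in> Obj X" "b \<in> Obj X" using Q.Hom_Obj[OF fh] by simp_all
    have aZ: "omap \<omega> a \<in> Z" using f(2) unfolding iff by (simp add: a_def)
    note wf = om_Hom[OF fh]
    \<comment> \<open>\<omega> f need not be epi, so \<omega> b itself is not a quotient of \<omega>
      a. Its image c is one, and turns out to be dense in \<omega> b.\<close>
    obtain c j e where j: "j \<in> Hom X c (omap \<omega> b)" "is_mono X j"
      and e: "e \<in> Hom X (omap \<omega> a) c" "is_epi X e" "j \<cdot> e = amap \<omega> f"
      by (rule image_factorization[OF wf])
    have cZ: "c \<in> Z" by (rule weakly_closed_epi[OF wZ e(2,1) aZ])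
    obtain q where q: "is_cokernel X j q" using cokernelE[OF j(1)] by blast
    note qD = cokernelD[OF q j(1)]
    have "zero_mor X (q \<cdot> amap \<omega> f)"
      using zero_Cmp_left[OF qD(2) e(1) Cmp_in[OF j(1) qD(1)]] Cmp_assoc[OF e(1) j(1) qD(1)] e(3)
      by simp
    \<comment> \<open>Up to the invertible counits, \<pi> (\<omega> f) is f.\<close>
    moreover have "is_epi Q (amap \<pi> (amap \<omega> f))"
    proof (rule Q.epi_factor)
      obtain s where s: "s \<in> Hom Q b (omap \<omega> b)" "s \<cdot>\<^bsub>Q\<^esub> \<epsilon> b = Idt Q (omap \<omega> b)"
        "\<epsilon> b \<cdot>\<^bsub>Q\<^esub> s = Idt Q b"
        by (rule Q.isoE[OF counit_iso[OF ab(2)] counit_Hom[OF ab(2)]])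
      have "is_epi Q (s \<cdot>\<^bsub>Q\<^esub> (f \<cdot>\<^bsub>Q\<^esub> \<epsilon> a))"
      proof (rule Q.epi_Cmp[OF Q.epi_Cmp Q.Cmp_in _ s(1)])
        show "is_epi Q (\<epsilon> a)" by (rule Q.iso_epi[OF counit_iso[OF ab(1)]])
        show "is_epi Q s" by (rule Q.split_epi[OF s(1) counit_Hom[OF ab(2)] s(2)])
      qed (rule counit_Hom[OF ab(1)] f fh)+
      moreover have "s \<cdot>\<^bsub>Q\<^esub> (f \<cdot>\<^bsub>Q\<^esub> \<epsilon> a) = amap \<pi> (amap \<omega> f)"
        using counit_natural[OF fh] Q.Cmp_assoc[OF pi_Hom[OF wf] counit_Hom[OF ab(2)] s(1)] s(2)
          Q.Idt_Cmp[OF pi_Hom[OF wf]] by simp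
      ultimately show "is_epi Q (amap \<pi> (amap \<omega> f) \<cdot>\<^bsub>Q\<^esub> Idt Q (omap \<omega> a))"
        using Q.Cmp_Idt[OF pi_Hom[OF wf]] by simp
      show "Idt Q (omap \<omega> a) \<in> Hom Q (omap \<omega> a) (omap \<omega> a)" using Q.Idt_in om_Obj[OF ab(1)] by simp
      show "amap \<pi> (amap \<omega> f) \<in> Hom Q (omap \<omega> a) (omap \<omega> b)" by (rule pi_Hom[OF wf])
    qed
    ultimately have "Cod X q \<in> Y" using pi_epi_cokernel[OF wf _ qD(1,3)] by blast
    then have "dense_mono X Y j" using j(2) q by (auto simp: dense_mono_def)
    then have "isomorphic Q c (omap \<omega> b)" using pi_dense_mono pi_Hom[OF j(1)] by (auto simp: isomorphic_def)
    then have "isomorphic Q b (omap \<pi> c)"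
      using Q.isomorphic_sym[OF Q.isomorphic_trans[OF _ om_pi_isomorphic[OF ab(2)]]] Hom_Obj(1)[OF j(1)]
      by simp
    then have "b \<in> ?W" using cZ ab(2) by (auto simp: image_subcat_def)
    then show ?thesis by (simp add: b_def)
  qed
  have cop: "S \<in> ?W" if I: "small \<kappa> I" and A: "A ` I \<subseteq> ?W" and S: "is_coproduct Q I A S s"
    for I :: "'u set" and A S s
  proof -
    have AZ: "A i \<in> Obj X" "omap \<omega> (A i) \<in> Z" if "i \<in> I" for i using A that iff by blast+
    then obtain C c where C: "is_coproduct X I (\<lambda>i. omap \<omega> (A i)) C c"
      using ex_coproduct[OF I, of "\<lambda>i. omap \<omega> (A i)"] om_Obj by blast
    have "C \<in> Z" by (rule weakly_closed_coproduct[OF wZ I _ C]) (use AZ in blast)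
    \<comment> \<open>C and S are both coproducts of the \<omega> (A i) in X/Y, the one coming from
      X and the other by changing the summands along the counits.\<close>
    have QC: "is_coproduct Q I (\<lambda>i. omap \<omega> (A i)) C (\<lambda>i. amap \<pi> (c i))"
      by (rule pi_coproduct[OF C om_Obj[OF AZ(1)]])
    have QS: "is_coproduct Q I (\<lambda>i. omap \<omega> (A i)) S (\<lambda>i. s i \<cdot>\<^bsub>Q\<^esub> \<epsilon> (A i))"
      by (rule Q.coproduct_change_iso[OF S]) (use counit_Hom counit_iso AZ in blast)
    have "C \<in> Obj X" using C by (simp add: is_coproduct_def)
    then have "isomorphic Q S (omap \<pi> C)" using Q.coproduct_iso[OF QS QC] by simp
    moreover have "S \<in> Obj Q" using S by (simp add: is_coproduct_def)
    ultimately show ?thesis using \<open>C \<in> Z\<close> by (auto simp: image_subcat_def)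
  qed
  have pro: "P \<in> ?W" if I: "small \<kappa> I" and A: "A ` I \<subseteq> ?W" and P: "is_product Q I A P p"
    for I :: "'u set" and A P p
  proof -
    have "(\<lambda>i. omap \<omega> (A i)) ` I \<subseteq> Z" using A iff by blast
    then have "omap \<omega> P \<in> Z" using Z I om_product[OF P] unfolding closed_subcat_def by blast
    moreover have "P \<in> Obj X" using P by (simp add: is_product_def)
    ultimately show ?thesis using iff by blast
  qed
  have "?W \<subseteq> Obj Q" by (auto simp: image_subcat_def)
  then show ?thesis by (rule closed_subcatI[OF _ sub quo cop pro])
qed

section \<open>The lift of a closed subcategory of X/Y\<close>

lemma generated_single:
  assumes S: "S \<in> E" "S \<in> Obj X" and e: "e \<in> Hom X S N" "is_epi X e"
  shows "N \<in> generated \<kappa> X E"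
proof -
  \<comment> \<open>Any element of \<open>'u\<close> can serve as the single index.\<close>
  let ?I = "{undefined :: 'u}"
  have "is_coproduct X ?I (\<lambda>_. S) S (\<lambda>_. Idt X S)"
  proof (rule is_coproductI)
    show "S \<in> Obj X" by fact
    show "Idt X S \<in> Hom X S S" by (rule Idt_in[OF S(2)])
    show "\<exists>h\<in>Hom X S T. \<forall>i\<in>?I. h \<cdot> Idt X S = g i"
      if "\<And>i. i \<in> ?I \<Longrightarrow> g i \<in> Hom X S T" for T and g :: "'u \<Rightarrow> 'm"
      using that[of undefined] Cmp_Idt[of "g undefined" S T] by auto
    show "g = h" if "g \<in> Hom X S T" "h \<in> Hom X S T"
      and "\<And>i. i \<in> ?I \<Longrightarrow> g \<cdot> Idt X S = h \<cdot> Idt X S" for T g h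
      using that(3)[of undefined] Cmp_Idt[OF that(1)] Cmp_Idt[OF that(2)] by simp
  qed
  moreover have "small \<kappa> ?I" by (rule small_finite[OF universe]) simp
  moreover have "(\<lambda>_. S) ` ?I \<subseteq> E" using S(1) by simp
  ultimately show ?thesis using e unfolding generated_def mem_Collect_eq by metis
qed

context
  fixes W :: "'o set"
  assumes W: "closed_subcat \<kappa> Q W"
begin

text \<open>Written exactly as the generating class inside \<open>lift_subcat\<close>, so that it
  can be folded there.\<close>

definition lifted where "lifted = {M \<in> Obj X. torsionfree X Y M \<and> omap \<pi> M \<in> W}"

lemma weakly_closed_W: "weakly_closed \<kappa> Q W"
  using W by (simp add: closed_subcat_def)

lemma lifted_iff: "M \<in> lifted \<longleftrightarrow> torsionfree X Y M \<and> M \<in> W"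
  by (auto simp: lifted_def torsionfree_def)

lemma lifted_Obj: "M \<in> lifted \<Longrightarrow> M \<in> Obj X"
  by (simp add: lifted_def)

text \<open>A monomorphism into a torsionfree object stays mono in X/Y, where W is closed under
  subobjects.\<close>

lemma lifted_mono:
  assumes "f \<in> Hom X a b" "is_mono X f" "b \<in> lifted" shows "a \<in> lifted"
  using assms torsionfree_mono Q.weakly_closed_mono[OF weakly_closed_W pi_mono[OF assms(1,2)] pi_Hom[OF assms(1)]]
  unfolding lifted_iff by blast

lemma lifted_coproduct:
  fixes I :: "'u set"
  assumes I: "small \<kappa> I" and A: "\<And>i. i \<in> I \<Longrightarrow> A i \<in> lifted" and S: "is_coproduct X I A S s"
  shows "S \<in> lifted"
  unfolding lifted_iff
proof
  show "torsionfree X Y S" using torsionfree_coproduct[OF I _ S] A unfolding lifted_iff by blast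
  show "S \<in> W"
    by (rule Q.weakly_closed_coproduct[OF weakly_closed_W I _ pi_coproduct[OF S]])
      (use A lifted_iff lifted_Obj in blast)+
qed

text \<open>P need not be the product of the A i in X/Y: \<pi> can fail to preserve products even of
  torsionfree objects, as for abelian groups modulo torsion groups. The product R of the \<omega> (A
  i) is one, and the units embed P in R.\<close>

lemma lifted_product:
  fixes I :: "'u set"
  assumes I: "small \<kappa> I" and A: "\<And>i. i \<in> I \<Longrightarrow> A i \<in> lifted" and P: "is_product X I A P p"
  shows "P \<in> lifted"
proof -
  have AO: "A i \<in> Obj X" and At: "torsionfree X Y (A i)" if "i \<in> I" for i
    using A[OF that] by (simp_all add: lifted_def)
  have "(\<lambda>i. omap \<omega> (A i)) ` I \<subseteq> Obj X" using om_Obj AO by blast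
  then obtain R r where R: "is_product X I (\<lambda>i. omap \<omega> (A i)) R r" by (rule ex_product[OF I])
  have PO: "P \<in> Obj X" and RO: "R \<in> Obj X" using P R by (simp_all add: is_product_def)
  have Rt: "torsionfree X Y R" by (rule torsionfree_product[OF R torsionfree_om[OF AO]])
  note p = product_in[OF P] and r = product_in[OF R]
  have "R \<in> W"
  proof -
    have "A ` I \<subseteq> W" using A lifted_iff by blast
    then show ?thesis using W I product_om[OF R AO] unfolding closed_subcat_def by blast
  qed
  then have RE: "R \<in> lifted" using Rt lifted_iff by blast
  note u = unit_Hom[OF AO]
  obtain m where m: "m \<in> Hom X P R" "\<And>i. i \<in> I \<Longrightarrow> r i \<cdot> m = \<eta> (A i) \<cdot> p i"
    by (rule product_ex1[OF R PO, of "\<lambda>i. \<eta> (A i) \<cdot> p i"]) (use Cmp_in[OF p u] in blast)+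
  have "is_mono X m"
  proof (rule monoI[OF m(1)])
    fix a g h assume g: "g \<in> Hom X a P" and h: "h \<in> Hom X a P" and eq: "m \<cdot> g = m \<cdot> h"
    show "g = h"
    proof (rule product_unique[OF P g h])
      fix i assume i: "i \<in> I"
      have "\<eta> (A i) \<cdot> (p i \<cdot> g) = \<eta> (A i) \<cdot> (p i \<cdot> h)"
        using Cmp_assoc[OF g p[OF i] u[OF i]] Cmp_assoc[OF h p[OF i] u[OF i]] m(2)[OF i]
          Cmp_assoc[OF g m(1) r[OF i]] Cmp_assoc[OF h m(1) r[OF i]] eq by simp
      then show "p i \<cdot> g = p i \<cdot> h"
        by (rule mono_cancel[OF torsionfree_mono_unit[OF At[OF i]] u[OF i] Cmp_in[OF g p[OF i]]
              Cmp_in[OF h p[OF i]]])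
    qed
  qed
  then show ?thesis using lifted_mono[OF m(1) _ RE] by blast
qed

lemma lift_subcat_iff:
  "N \<in> lift_subcat \<kappa> X Y \<pi> W \<longleftrightarrow> (\<exists>S\<in>lifted. \<exists>e\<in>Hom X S N. is_epi X e)"
proof
  assume "N \<in> lift_subcat \<kappa> X Y \<pi> W"
  then obtain I :: "'u set" and A S s e where *: "small \<kappa> I" "A ` I \<subseteq> lifted" "is_coproduct X I A S s"
    "e \<in> Hom X S N" "is_epi X e"
    unfolding lift_subcat_def generated_def lifted_def by blast
  have "S \<in> lifted" by (rule lifted_coproduct[OF *(1) _ *(3)]) (use *(2) in blast)
  then show "\<exists>S\<in>lifted. \<exists>e\<in>Hom X S N. is_epi X e" using *(4,5) by blast
next
  assume "\<exists>S\<in>lifted. \<exists>e\<in>Hom X S N. is_epi X e"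
  then obtain S e where S: "S \<in> lifted" and e: "e \<in> Hom X S N" "is_epi X e" by blast
  show "N \<in> lift_subcat \<kappa> X Y \<pi> W"
    unfolding lift_subcat_def lifted_def[symmetric] by (rule generated_single[OF S lifted_Obj[OF S] e])
qed

lemma lifted_in_lift_subcat: "M \<in> lifted \<Longrightarrow> M \<in> lift_subcat \<kappa> X Y \<pi> W"
  unfolding lift_subcat_iff using epi_Idt Idt_in lifted_Obj by blast

text \<open>Since \<pi> preserves epimorphisms, the quotients of the generators are mapped into W as
  well, torsionfree or not.\<close>

lemma lift_subcat_W: "M \<in> lift_subcat \<kappa> X Y \<pi> W \<Longrightarrow> M \<in> W"
  unfolding lift_subcat_iff using Q.weakly_closed_epi[OF weakly_closed_W pi_epi pi_Hom] lifted_iff by blast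

lemma om_lifted:
  assumes "M \<in> W" shows "omap \<omega> M \<in> lifted"
proof -
  have M: "M \<in> Obj X" using Q.weakly_closed_Obj[OF weakly_closed_W assms] by simp
  show ?thesis
    using torsionfree_om[OF M] assms
      Q.weakly_closed_iso[OF weakly_closed_W Q.isomorphic_sym[OF om_pi_isomorphic[OF M]]]
    unfolding lifted_iff by blast
qed

lemma closed_lift_subcat: "closed_subcat \<kappa> X (lift_subcat \<kappa> X Y \<pi> W)"
proof -
  let ?Z = "lift_subcat \<kappa> X Y \<pi> W"
  have sub: "Dom X f \<in> ?Z" if f: "is_mono X f" "Cod X f \<in> ?Z" for f
  proof -
    have fh: "f \<in> Hom X (Dom X f) (Cod X f)" using f(1) by (simp add: is_mono_def Hom_def)
    obtain S e where S: "S \<in> lifted" and e: "e \<in> Hom X S (Cod X f)" "is_epi X e"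
      using f(2) unfolding lift_subcat_iff by blast
    \<comment> \<open>A subobject of a quotient of S is a quotient of its preimage in S, and this
      preimage is again in \<open>lifted\<close>.\<close>
    obtain a k e' where k: "k \<in> Hom X a S" "is_mono X k" and e': "e' \<in> Hom X a (Dom X f)" "is_epi X e'"
      by (rule preimage[OF fh f(1) e])
    show ?thesis using lifted_mono[OF k S] e' unfolding lift_subcat_iff by blast
  qed
  have quo: "Cod X f \<in> ?Z" if f: "is_epi X f" "Dom X f \<in> ?Z" for f
  proof -
    have fh: "f \<in> Hom X (Dom X f) (Cod X f)" using f(1) by (simp add: is_epi_def Hom_def)
    obtain S e where S: "S \<in> lifted" and e: "e \<in> Hom X S (Dom X f)" "is_epi X e"
      using f(2) unfolding lift_subcat_iff by blast
    show ?thesis using S epi_Cmp[OF e(2,1) f(1) fh] Cmp_in[OF e(1) fh] unfolding lift_subcat_iff by blast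
  qed
  \<comment> \<open>As one generator covers each object, a whole family is covered by generators
    over the same index set, and (co)products can be compared termwise.\<close>
  have cover: "\<exists>S e. \<forall>i\<in>I. S i \<in> lifted \<and> e i \<in> Hom X (S i) (A i) \<and> is_epi X (e i)"
    if "A ` I \<subseteq> ?Z" for I :: "'u set" and A
  proof -
    have "\<forall>i\<in>I. \<exists>S e. S \<in> lifted \<and> e \<in> Hom X S (A i) \<and> is_epi X e"
      using that unfolding image_subset_iff lift_subcat_iff by blast
    then show ?thesis by metis
  qed
  have cop: "N \<in> ?Z" if I: "small \<kappa> I" and A: "A ` I \<subseteq> ?Z" and N: "is_coproduct X I A N n"
    for I :: "'u set" and A N n
  proof -
    obtain S e where Se: "\<And>i. i \<in> I \<Longrightarrow> S i \<in> lifted \<and> e i \<in> Hom X (S i) (A i) \<and> is_epi X (e i)"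
      using cover[OF A] by blast
    have "S ` I \<subseteq> Obj X" using Se lifted_Obj by blast
    then obtain T t where T: "is_coproduct X I S T t" by (rule ex_coproduct[OF I])
    obtain h where "h \<in> Hom X T N" "is_epi X h"
      by (rule coproduct_map_epi[OF T N, of e]) (use Se in blast)+
    moreover have "T \<in> lifted" by (rule lifted_coproduct[OF I _ T]) (use Se in blast)
    ultimately show ?thesis unfolding lift_subcat_iff by blast
  qed
  have pro: "N \<in> ?Z" if I: "small \<kappa> I" and A: "A ` I \<subseteq> ?Z" and N: "is_product X I A N n"
    for I :: "'u set" and A N n
  proof -
    obtain S e where Se: "\<And>i. i \<in> I \<Longrightarrow> S i \<in> lifted \<and> e i \<in> Hom X (S i) (A i) \<and> is_epi X (e i)"
      using cover[OF A] by blast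
    have "S ` I \<subseteq> Obj X" using Se lifted_Obj by blast
    then obtain T t where T: "is_product X I S T t" by (rule ex_product[OF I])
    obtain h where "h \<in> Hom X T N" "is_epi X h"
      by (rule product_map_epi[OF I T N, of e]) (use Se in blast)+
    moreover have "T \<in> lifted" by (rule lifted_product[OF I _ T]) (use Se in blast)
    ultimately show ?thesis unfolding lift_subcat_iff by blast
  qed
  have "?Z \<subseteq> Obj X" unfolding lift_subcat_iff subset_iff using Hom_Obj(2) by blast
  then show ?thesis by (rule closed_subcatI[OF _ sub quo cop pro])
qed

theorem Y_closed_lift_subcat: "Y_closed \<kappa> X Y \<pi> \<omega> (lift_subcat \<kappa> X Y \<pi> W)"
proof -
  let ?Z = "lift_subcat \<kappa> X Y \<pi> W"
  \<comment> \<open>Passing to the lift adds no torsionfree objects: every object of the lift is in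
    W, so a torsionfree one is a generator.\<close>
  have "{M \<in> ?Z. torsionfree X Y M} = lifted"
    using lifted_in_lift_subcat lift_subcat_W lifted_iff by blast
  then have "torsionfree_generated \<kappa> X Y ?Z"
    unfolding torsionfree_generated_def by (simp add: lift_subcat_def lifted_def)
  moreover have "essentially_stable \<pi> \<omega> ?Z"
    unfolding essentially_stable_def
  proof
    fix M assume M: "M \<in> ?Z"
    then have "M \<in> W" by (rule lift_subcat_W)
    moreover have "M \<in> Obj X" using Q.weakly_closed_Obj[OF weakly_closed_W \<open>M \<in> W\<close>] by simp
    ultimately show "omap \<omega> (omap \<pi> M) \<in> ?Z" using lifted_in_lift_subcat[OF om_lifted] by simp
  qed
  ultimately show ?thesis using closed_lift_subcat by (simp add: Y_closed_def)
qed

text \<open>Membership of N in the image means that \<omega> N is in the lift. From N in W this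
  holds as \<omega> N is a generator; the other way, \<omega> N is in W and is isomorphic to N in
  X/Y.\<close>

lemma image_lift_subcat: "image_subcat Q \<pi> (lift_subcat \<kappa> X Y \<pi> W) = W"
proof -
  have st: "essentially_stable \<pi> \<omega> (lift_subcat \<kappa> X Y \<pi> W)"
    using Y_closed_lift_subcat by (simp add: Y_closed_def)
  have wc: "weakly_closed \<kappa> X (lift_subcat \<kappa> X Y \<pi> W)"
    using closed_lift_subcat by (simp add: closed_subcat_def)
  have "N \<in> W" if "N \<in> Obj X" "omap \<omega> N \<in> lift_subcat \<kappa> X Y \<pi> W" for N
    using Q.weakly_closed_iso[OF weakly_closed_W om_pi_isomorphic[OF that(1)] lift_subcat_W[OF that(2)]] .
  moreover have "N \<in> Obj X \<and> omap \<omega> N \<in> lift_subcat \<kappa> X Y \<pi> W" if "N \<in> W" for N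
    using lifted_in_lift_subcat[OF om_lifted[OF that]] Q.weakly_closed_Obj[OF weakly_closed_W that] by simp
  ultimately show ?thesis using image_subcat_iff[OF wc st] by blast
qed

end

text \<open>A torsionfree M embeds in \<omega> M by the unit, so M is in Z as soon as \<omega> M is;
  stability gives the converse. Thus the generators of the lift are the torsionfree objects of Z,
  and these generate Z.\<close>

lemma lift_image_subcat:
  assumes Z: "Y_closed \<kappa> X Y \<pi> \<omega> Z"
  shows "lift_subcat \<kappa> X Y \<pi> (image_subcat Q \<pi> Z) = Z"
proof
  have cl: "closed_subcat \<kappa> X Z" and st: "essentially_stable \<pi> \<omega> Z"
    and gen: "generated \<kappa> X {M \<in> Z. torsionfree X Y M} = Z"
    using Z by (simp_all add: Y_closed_def torsionfree_generated_def)
  have wc: "weakly_closed \<kappa> X Z" using cl by (simp add: closed_subcat_def)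
  let ?E = "{M \<in> Obj X. torsionfree X Y M \<and> omap \<pi> M \<in> image_subcat Q \<pi> Z}"
  have EZ: "?E \<subseteq> Z"
  proof
    fix M assume "M \<in> ?E"
    then have M: "M \<in> Obj X" "torsionfree X Y M" "M \<in> image_subcat Q \<pi> Z" by auto
    have "omap \<omega> M \<in> Z" using M(3) image_subcat_iff[OF wc st] by blast
    then show "M \<in> Z"
      by (rule weakly_closed_mono[OF wc torsionfree_mono_unit[OF M(2)] unit_Hom[OF M(1)]])
  qed
  show "lift_subcat \<kappa> X Y \<pi> (image_subcat Q \<pi> Z) \<subseteq> Z"
  proof
    fix N assume "N \<in> lift_subcat \<kappa> X Y \<pi> (image_subcat Q \<pi> Z)"
    then obtain I :: "'u set" and A S s e where *: "small \<kappa> I" "A ` I \<subseteq> ?E" "is_coproduct X I A S s"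
      "e \<in> Hom X S N" "is_epi X e"
      unfolding lift_subcat_def generated_def by blast
    have "S \<in> Z" by (rule weakly_closed_coproduct[OF wc *(1) _ *(3)]) (use *(2) EZ in blast)
    then show "N \<in> Z" by (rule weakly_closed_epi[OF wc *(5,4)])
  qed
  have "{M \<in> Z. torsionfree X Y M} \<subseteq> ?E"
  proof
    fix M assume "M \<in> {M \<in> Z. torsionfree X Y M}"
    then have M: "M \<in> Z" "torsionfree X Y M" "M \<in> Obj X" by (auto simp: torsionfree_def)
    have "omap \<omega> M \<in> Z" using st M(1,3) by (auto simp: essentially_stable_def)
    then show "M \<in> ?E" using M image_subcat_iff[OF wc st] by simp
  qed
  then have "generated \<kappa> X {M \<in> Z. torsionfree X Y M} \<subseteq> generated \<kappa> X ?E"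
    by (rule generated_mono)
  then show "Z \<subseteq> lift_subcat \<kappa> X Y \<pi> (image_subcat Q \<pi> Z)"
    unfolding gen lift_subcat_def .
qed

end

theorem theorem1p2:
  fixes \<kappa> :: "'u rel"
    and X :: "('o, 'm) cat" and Y :: "'o set"
    and Q :: "('o, 'n) cat"
    and \<pi> :: "('o, 'm, 'o, 'n) ftor" and \<omega> :: "('o, 'n, 'o, 'm) ftor"
  assumes "universe \<kappa>"
    and "grothendieck \<kappa> X" and "exact_products \<kappa> X"
    and "localizing \<kappa> X Y"
    and "gabriel_quotient X Y Q \<pi>"
    and "right_adjoint X Q \<pi> \<omega>"
  shows
    "(\<forall>Z. closed_subcat \<kappa> X Z \<and> essentially_stable \<pi> \<omega> Z
        \<longrightarrow> closed_subcat \<kappa> Q (image_subcat Q \<pi> Z)) \<and>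
     (\<forall>W. closed_subcat \<kappa> Q W \<longrightarrow> Y_closed \<kappa> X Y \<pi> \<omega> (lift_subcat \<kappa> X Y \<pi> W)) \<and>
     bij_betw (image_subcat Q \<pi>) {Z. Y_closed \<kappa> X Y \<pi> \<omega> Z} {W. closed_subcat \<kappa> Q W} \<and>
     bij_betw (lift_subcat \<kappa> X Y \<pi>) {W. closed_subcat \<kappa> Q W} {Z. Y_closed \<kappa> X Y \<pi> \<omega> Z} \<and>
     (\<forall>Z. Y_closed \<kappa> X Y \<pi> \<omega> Z \<longrightarrow> lift_subcat \<kappa> X Y \<pi> (image_subcat Q \<pi> Z) = Z) \<and>
     (\<forall>W. closed_subcat \<kappa> Q W \<longrightarrow> image_subcat Q \<pi> (lift_subcat \<kappa> X Y \<pi> W) = W)"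
proof -
  have "abelian X" using assms(2) by (simp add: grothendieck_def)
  moreover from this have "category X" by (auto simp: abelian_def preadditive_def)
  ultimately interpret gabriel_AB4 X \<kappa> Y Q \<pi> \<omega>
    using assms by (intro gabriel_AB4.intro gabriel.intro abelian_category.intro
        abelian_category_axioms.intro gabriel_axioms.intro gabriel_AB4_axioms.intro)
  have image: "closed_subcat \<kappa> Q (image_subcat Q \<pi> Z)" if "Y_closed \<kappa> X Y \<pi> \<omega> Z" for Z
    using closed_image_subcat that by (simp add: Y_closed_def)
  have "bij_betw (image_subcat Q \<pi>) {Z. Y_closed \<kappa> X Y \<pi> \<omega> Z} {W. closed_subcat \<kappa> Q W}"
    by (rule bij_betw_byWitness[where f' = "lift_subcat \<kappa> X Y \<pi>"])
      (use lift_image_subcat image_lift_subcat image Y_closed_lift_subcat in auto)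
  moreover have "bij_betw (lift_subcat \<kappa> X Y \<pi>) {W. closed_subcat \<kappa> Q W} {Z. Y_closed \<kappa> X Y \<pi> \<omega> Z}"
    by (rule bij_betw_byWitness[where f' = "image_subcat Q \<pi>"])
      (use lift_image_subcat image_lift_subcat image Y_closed_lift_subcat in auto)
  ultimately show ?thesis
    using closed_image_subcat Y_closed_lift_subcat lift_image_subcat image_lift_subcat by blast
qed

end
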